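(* Let $k\ge 4$ be an even integer and let $p\ge 7$ be a prime number such that $p-1>2k-2$. If there exists a non-trivial $\mathcal{O}_K$-integral Hecke eigen Siegel cusp form $F$ of weight $k$ for $\mathrm{Sp}_4(\mathbb{Z})$, for some number field $K$, which is congruent to $G_k$ modulo some prime ideal of $\mathcal{O}_K$ above $p$, then $\mathrm{ord}_p(B_kB_{2k-2}h^+_p)>0$. In particular, if Vandiver's conjecture is true (hence $p\nmid h_p^+$) and $\mathrm{ord}_p(B_k)=0$, then $\mathrm{ord}_p(B_{2k-2})>0$.
   Context: $\mathbb{H}_2=\{Z\in M_2(\mathbb{C}) : {}^tZ=Z,\ \mathrm{Im}(Z)>0\}$, $\Gamma=\mathrm{Sp}_4(\mathbb{Z})$ acts on it by $\gamma Z=(AZ+B)(CZ+D)^{-1}$ for $\gamma=\begin{pmatrix}A&B\\C&D\end{pmatrix}$ ($2\times 2$ blocks), $j(\gamma,Z)=\det(CZ+D)$, and $\Gamma_\infty=\{\gamma\in\Gamma : C=0\}$. For even $k\ge 4$, $E_k(Z)=\sum_{\gamma\in\Gamma_\infty\backslash\Gamma} j(\gamma,Z)^{-k}$ and $G_k(Z)=\tfrac12\zeta(1-k)\zeta(3-2k)E_k(Z)$, with $\zeta$ the Riemann zeta function. When $p-1>2k-2$, all Fourier coefficients of $G_k$ lie in $\mathbb{Z}_p$. A degree 2 Siegel modular form for $\Gamma$ has Fourier expansion $F(Z)=\sum_{T}A_F(T)q^T$, $q^T=\exp(2\pi\sqrt{-1}\,\mathrm{tr}(TZ))$, where $T$ runs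 over positive semi-definite symmetric $2\times2$ matrices with integral diagonal and half-integral off-diagonal entries. $F$ is $\mathcal{O}_K$-integral if $A_F(T)\in\mathcal{O}_K$ for all $T$. For the prime $\mathcal{P}$ above $p$ in question, $F$ is non-trivial if $F\not\equiv0$ mod $\mathcal{P}$, and $F$ is congruent to $G$ modulo $\mathcal{P}$ if $A_F(T)\equiv A_G(T)$ mod $\mathcal{P}$ for all $T$ (congruence in the localization or completion of $\mathcal{O}_K$ at $\mathcal{P}$). A Hecke eigen form is a nonzero simultaneous eigenfunction of all Hecke operators of $\Gamma$. $B_n$ is the $n$-th Bernoulli number. $h_p^+$ is (the order of) the plus part of the ideal class group of $\mathbb{Q}(\zeta_p)$, i.e. the class number of its maximal real subfield, with $\zeta_p$ a primitive $p$-th root of unity. Vandiver's conjecture asserts $p\nmid h_p^+$ for every prime $p$. *)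

theory Defs
  imports
    "HOL-Complex_Analysis.Complex_Analysis"
    "HOL-Library.Extended_Real"
    "HOL-Algebra.Generated_Fields"
    "HOL-Algebra.Embedded_Algebras"
    "HOL-Algebra.Ideal_Product"
    "HOL-Algebra.Algebraic_Closure_Type"
begin

section \<open>Bernoulli numbers, the Riemann zeta function, p-adic order\<close>

text \<open>\<open>t / (e\<^sup>t - 1) = \<Sum>n. B\<^sub>n t\<^sup>n / n!\<close>\<close>

definition bernoulli :: "nat \<Rightarrow> rat" where
  "bernoulli n = fact n * fps_nth (fps_X / (fps_exp 1 - 1)) n"

text \<open>
  The analytic continuation of the Dirichlet series to the complex plane without 1; the value
  at the pole is normalised to 0 only in order to make the function unique.
\<close>

definition riemann_zeta :: "complex \<Rightarrow> complex" where
  "riemann_zeta = (THE f. f holomorphic_on - {1} \<and> f 1 = 0 \<and>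
     (\<forall>s. Re s > 1 \<longrightarrow> (\<lambda>n. 1 / of_nat (Suc n) powr s) sums f s))"

definition rat_ord :: "nat \<Rightarrow> rat \<Rightarrow> ereal" where
  "rat_ord p x =
     (if x = 0 then \<infinity>
      else ereal (real (multiplicity (int p) (fst (quotient_of x)))
                - real (multiplicity (int p) (snd (quotient_of x)))))"


section \<open>Number fields and class numbers\<close>

text \<open>
  Number fields are taken inside the complex numbers, since the Fourier coefficients of
  modular forms are complex numbers.
\<close>

abbreviation CC :: "complex ring" where
  "CC \<equiv> ring_of_type_algebra"

definition number_field :: "complex set \<Rightarrow> bool" where
  "number_field K \<longleftrightarrow> subfield K CC \<and> ring.finite_dimension CC \<rat> K"

definition ring_of_integers :: "complex set \<Rightarrow> complex ring" where
  "ring_of_integers K = CC\<lparr>carrier := {x \<in> K. algebraic_int x}\<rparr>"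

definition prime_ideal_above :: "complex set \<Rightarrow> nat \<Rightarrow> complex set \<Rightarrow> bool" where
  "prime_ideal_above K p P \<longleftrightarrow>
     primeideal P (ring_of_integers K) \<and> P \<inter> \<int> = range (\<lambda>n::int. of_int (int p * n))"

text \<open>
  Congruence modulo \<open>P\<close> in the localization of the ring of integers at \<open>P\<close>: the difference
  lies in the maximal ideal \<open>P O\<^sub>P = {a / s | a \<in> P, s \<in> O - P}\<close>.
\<close>

definition cong_at_prime :: "complex set \<Rightarrow> complex set \<Rightarrow> complex \<Rightarrow> complex \<Rightarrow> bool" where
  "cong_at_prime K P x y \<longleftrightarrow>
     (\<exists>a\<in>P. \<exists>s \<in> carrier (ring_of_integers K) - P. x - y = a / s)"

definition fractional_ideal :: "complex set \<Rightarrow> complex set \<Rightarrow> bool" where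
  "fractional_ideal K I \<longleftrightarrow>
     additive_subgroup I CC \<and> I \<subseteq> K \<and> I \<noteq> {0} \<and>
     (\<forall>a \<in> carrier (ring_of_integers K). \<forall>x\<in>I. a * x \<in> I) \<and>
     (\<exists>d \<in> carrier (ring_of_integers K) - {0}. \<forall>x\<in>I. d * x \<in> carrier (ring_of_integers K))"

definition fractional_ideal_group :: "complex set \<Rightarrow> complex set monoid" where
  "fractional_ideal_group K =
     \<lparr>carrier = {I. fractional_ideal K I},
      mult = ideal_prod CC,
      one = carrier (ring_of_integers K)\<rparr>"

definition principal_fractional_ideals :: "complex set \<Rightarrow> complex set set" where
  "principal_fractional_ideals K =
     (\<lambda>x. (\<lambda>a. a * x) ` carrier (ring_of_integers K)) ` (K - {0})"

definition class_group :: "complex set \<Rightarrow> complex set set monoid" where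
  "class_group K = fractional_ideal_group K Mod principal_fractional_ideals K"

definition class_number :: "complex set \<Rightarrow> nat" where
  "class_number K = Coset.order (class_group K)"

definition cyclotomic_field :: "nat \<Rightarrow> complex set" where
  "cyclotomic_field p = generate_field CC {cis (2 * pi / real p)}"

definition class_number_plus :: "nat \<Rightarrow> nat" where
  "class_number_plus p = class_number (cyclotomic_field p \<inter> \<real>)"

definition vandiver_conjecture :: bool where
  "vandiver_conjecture \<longleftrightarrow> (\<forall>p::nat. Factorial_Ring.prime p \<longrightarrow> \<not> p dvd class_number_plus p)"


section \<open>The symplectic group and the Siegel upper half space of degree 2\<close>

text \<open>
  A \<open>4 \<times> 4\<close> matrix is indexed by \<open>2 + 2\<close>, so that \<open>Inl\<close> and \<open>Inr\<close> select the blocks.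
\<close>

type_synonym mat4 = "rat^(2+2)^(2+2)"
type_synonym cmat2 = "complex^2^2"

definition block_A :: "mat4 \<Rightarrow> cmat2" where "block_A g = (\<chi> i j. of_rat (g $ Inl i $ Inl j))"
definition block_B :: "mat4 \<Rightarrow> cmat2" where "block_B g = (\<chi> i j. of_rat (g $ Inl i $ Inr j))"
definition block_C :: "mat4 \<Rightarrow> cmat2" where "block_C g = (\<chi> i j. of_rat (g $ Inr i $ Inl j))"
definition block_D :: "mat4 \<Rightarrow> cmat2" where "block_D g = (\<chi> i j. of_rat (g $ Inr i $ Inr j))"

definition J4 :: mat4 where
  "J4 = (\<chi> i j. case (i, j) of
           (Inl a, Inr b) \<Rightarrow> if a = b then 1 else 0
         | (Inr a, Inl b) \<Rightarrow> if a = b then - 1 else 0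
         | _ \<Rightarrow> 0)"

definition GSp4_plus :: "mat4 monoid" where
  "GSp4_plus =
     \<lparr>carrier = {g. \<exists>m>0. transpose g ** J4 ** g = mat m ** J4}, mult = (**), one = mat 1\<rparr>"

definition similitude :: "mat4 \<Rightarrow> rat" where
  "similitude g = (THE m. transpose g ** J4 ** g = mat m ** J4)"

definition Sp4_Z :: "mat4 set" where
  "Sp4_Z = {g. transpose g ** J4 ** g = J4 \<and> (\<forall>i j. g $ i $ j \<in> \<int>)}"

definition Gamma_inf :: "mat4 set" where
  "Gamma_inf = {g \<in> Sp4_Z. block_C g = 0}"

definition H2 :: "cmat2 set" where
  "H2 = {Z. transpose Z = Z \<and> (\<forall>v::real^2. v \<noteq> 0 \<longrightarrow> v \<bullet> (map_matrix Im Z *v v) > 0)}"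

definition act :: "mat4 \<Rightarrow> cmat2 \<Rightarrow> cmat2" where
  "act g Z = (block_A g ** Z + block_B g) ** matrix_inv (block_C g ** Z + block_D g)"

definition j_factor :: "mat4 \<Rightarrow> cmat2 \<Rightarrow> complex" where
  "j_factor g Z = det (block_C g ** Z + block_D g)"


section \<open>Siegel modular forms of degree 2 and level 1\<close>

text \<open>
  Holomorphy on the space of symmetric matrices is complex differentiability: the real Frechet
  derivative within \<open>H2\<close> exists and is complex linear. (\<open>H2\<close> is open in the symmetric matrices;
  the values of \<open>L\<close> on non-symmetric matrices are irrelevant.)
\<close>

definition holomorphic_H2 :: "(cmat2 \<Rightarrow> complex) \<Rightarrow> bool" where
  "holomorphic_H2 F \<longleftrightarrow>
     (\<forall>Z\<in>H2. \<exists>L. (F has_derivative L) (at Z within H2) \<and>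
        (\<forall>c W. L (map_matrix ((*) c) W) = c * L W))"

text \<open>No condition at infinity is needed in degree 2 (Koecher principle).\<close>

definition siegel_modular_form :: "nat \<Rightarrow> (cmat2 \<Rightarrow> complex) \<Rightarrow> bool" where
  "siegel_modular_form k F \<longleftrightarrow>
     holomorphic_H2 F \<and> (\<forall>g\<in>Sp4_Z. \<forall>Z\<in>H2. F (act g Z) = j_factor g Z ^ k * F Z)"

definition diag2 :: "complex \<Rightarrow> complex \<Rightarrow> cmat2" where
  "diag2 a b = (\<chi> i j. if i = j then (if i = 1 then a else b) else 0)"

text \<open>
  Cusp forms are the kernel of the Siegel operator
  \<open>(\<Phi> F)(\<tau>) = lim F(diag(\<tau>, \<i>t))\<close> for \<open>t \<rightarrow> \<infinity>\<close>; there is one 1-dimensional cusp in level 1.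
\<close>

definition siegel_cusp_form :: "nat \<Rightarrow> (cmat2 \<Rightarrow> complex) \<Rightarrow> bool" where
  "siegel_cusp_form k F \<longleftrightarrow>
     siegel_modular_form k F \<and>
     (\<forall>\<tau>. Im \<tau> > 0 \<longrightarrow> ((\<lambda>t::real. F (diag2 \<tau> (\<i> * of_real t))) \<longlongrightarrow> 0) at_top)"

definition half_integral_psd :: "(real^2^2) set" where
  "half_integral_psd =
     {T. transpose T = T \<and> (\<forall>i. T $ i $ i \<in> \<int>) \<and> (\<forall>i j. 2 * T $ i $ j \<in> \<int>) \<and>
         (\<forall>v. v \<bullet> (T *v v) \<ge> 0)}"

definition q_exp :: "real^2^2 \<Rightarrow> cmat2 \<Rightarrow> complex" where
  "q_exp T Z = exp (2 * of_real pi * \<i> * trace (map_matrix of_real T ** Z))"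

text \<open>
  The Fourier coefficients \<open>A\<^sub>F(T)\<close>, which exist and are unique for every modular form.
\<close>

definition fourier_coeff :: "(cmat2 \<Rightarrow> complex) \<Rightarrow> real^2^2 \<Rightarrow> complex" where
  "fourier_coeff F =
     (THE A. (\<forall>T. T \<notin> half_integral_psd \<longrightarrow> A T = 0) \<and>
        (\<forall>Z\<in>H2. ((\<lambda>T. A T * q_exp T Z) has_sum F Z) half_integral_psd))"


section \<open>Eisenstein series\<close>

text \<open>
  The summand is independent of the choice of a representative of the coset for even \<open>k\<close>,
  since \<open>j_factor g Z\<close> is \<open>\<plusminus>1\<close> on \<^const>\<open>Gamma_inf\<close>; the series converges absolutely for \<open>k \<ge> 4\<close>.
\<close>

definition siegel_E :: "nat \<Rightarrow> cmat2 \<Rightarrow> complex" where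
  "siegel_E k Z =
     (\<Sum>\<^sub>\<infinity>c \<in> rcosets\<^bsub>GSp4_plus\<lparr>carrier := Sp4_Z\<rparr>\<^esub> Gamma_inf.
        1 / j_factor (SOME g. g \<in> c) Z ^ k)"

definition siegel_G :: "nat \<Rightarrow> cmat2 \<Rightarrow> complex" where
  "siegel_G k Z =
     1/2 * riemann_zeta (1 - of_nat k) * riemann_zeta (3 - 2 * of_nat k) * siegel_E k Z"


section \<open>Hecke operators\<close>

definition slash :: "nat \<Rightarrow> (cmat2 \<Rightarrow> complex) \<Rightarrow> mat4 \<Rightarrow> cmat2 \<Rightarrow> complex" where
  "slash k F g Z =
     of_rat (similitude g powi (2 * int k - 3)) * F (act g Z) / j_factor g Z ^ k"

definition double_coset :: "mat4 \<Rightarrow> mat4 set" where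
  "double_coset g = (Sp4_Z #>\<^bsub>GSp4_plus\<^esub> g) <#>\<^bsub>GSp4_plus\<^esub> Sp4_Z"

text \<open>
  The operator of the double coset \<open>\<Gamma> g \<Gamma> = \<Union>\<^sub>i \<Gamma> g\<^sub>i\<close> (a finite disjoint union) sends \<open>F\<close> to
  \<open>\<Sum>\<^sub>i F |\<^sub>k g\<^sub>i\<close>. For modular \<open>F\<close> this does not depend on the representatives \<open>g\<^sub>i\<close>.
\<close>

definition hecke_operator :: "nat \<Rightarrow> mat4 \<Rightarrow> (cmat2 \<Rightarrow> complex) \<Rightarrow> cmat2 \<Rightarrow> complex" where
  "hecke_operator k g F Z =
     (\<Sum>c \<in> (\<lambda>h. Sp4_Z #>\<^bsub>GSp4_plus\<^esub> h) ` double_coset g. slash k F (SOME h. h \<in> c) Z)"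

definition hecke_eigenform :: "nat \<Rightarrow> (cmat2 \<Rightarrow> complex) \<Rightarrow> bool" where
  "hecke_eigenform k F \<longleftrightarrow>
     siegel_modular_form k F \<and> (\<exists>Z\<in>H2. F Z \<noteq> 0) \<and>
     (\<forall>g \<in> carrier GSp4_plus. \<exists>ev. \<forall>Z\<in>H2. hecke_operator k g F Z = ev * F Z)"


section \<open>Integrality and congruences\<close>

definition integral_form :: "complex set \<Rightarrow> (cmat2 \<Rightarrow> complex) \<Rightarrow> bool" where
  "integral_form K F \<longleftrightarrow>
     (\<forall>T\<in>half_integral_psd. fourier_coeff F T \<in> carrier (ring_of_integers K))"

definition form_cong ::
  "complex set \<Rightarrow> complex set \<Rightarrow> (cmat2 \<Rightarrow> complex) \<Rightarrow> (cmat2 \<Rightarrow> complex) \<Rightarrow> bool" where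
  "form_cong K P F G \<longleftrightarrow>
     (\<forall>T\<in>half_integral_psd. cong_at_prime K P (fourier_coeff F T) (fourier_coeff G T))"

definition nontrivial_mod :: "complex set \<Rightarrow> complex set \<Rightarrow> (cmat2 \<Rightarrow> complex) \<Rightarrow> bool" where
  "nontrivial_mod K P F \<longleftrightarrow>
     \<not> (\<forall>T\<in>half_integral_psd. cong_at_prime K P (fourier_coeff F T) 0)"

end

theory Submission
  imports Defs
begin

text \<open>
  The congruence is read off at the index \<open>T = 0\<close>. There a cusp form has coefficient 0, while
  \<open>G\<^sub>k\<close> has coefficient \<open>\<zeta>(1 - k) \<zeta>(3 - 2k) / 2 = B\<^sub>k B\<^sub>m / (2 k m)\<close> with \<open>m = 2k - 2\<close>, because the
  constant coefficient of \<open>E\<^sub>k\<close> is 1. So this rational number lies in the maximal ideal of the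
  localization at the prime above \<open>p\<close>, which means that \<open>p\<close> divides its numerator; multiplying by
  the integers \<open>2 k m\<close> and the class number keeps \<open>p\<close> in the numerator. If \<open>p\<close> divides neither
  numerator nor denominator of \<open>B\<^sub>k\<close>, dividing by \<open>B\<^sub>k\<close> leaves the factor \<open>p\<close> to \<open>B\<^sub>m\<close>.

  The work lies in showing that the three objects involved have these constants.
  Since \<open>fourier_coeff\<close> selects the unique family of coefficients, both for the cusp form and for
  \<open>E\<^sub>k\<close> an absolutely convergent expansion supported on semi-definite indices has to be produced.

  Expansions. The Siegel half space is a tube domain in the three coordinates of a symmetric matrix.
  A function that is continuous, separately holomorphic and 1-periodic in each coordinate is expanded
  one coordinate after the other (\<open>fourier_expansion_strip\<close>, \<open>fourier_expansion_tube\<close>). Invariance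
  under \<open>SL\<^sub>2(\<int>)\<close> makes the coefficients constant along the orbits of indices; an index that is not
  semi-definite has in its orbit indices with trace tending to \<open>-\<infinity>\<close>, whose terms would be unbounded
  (\<open>koecher_principle\<close>). The constant coefficient is then the limit of the function at
  \<open>diag(it, is)\<close> for \<open>t, s \<rightarrow> \<infinity>\<close> (\<open>constant_coefficient_limit\<close>), which is 0 for a cusp form.

  Eisenstein series. The Pluecker coordinates of the lower half of a representative map the cosets of
  \<open>Gamma_inf\<close> injectively to nonzero integer points of the cone \<open>ae = bd - c\<^sup>2\<close>, and
  \<open>det (CZ + D)\<close> becomes a linear form in these coordinates, comparable to their norm locally
  uniformly in \<open>Z\<close>. The cone has few integer points: \<open>summable_int_cone\<close> gives the convergence of
  the sum of \<open>|p|\<^sup>-\<^sup>k\<close> over them for \<open>k \<ge> 4\<close>. Hence \<open>E\<^sub>k\<close> is holomorphic, and along \<open>diag(iu, iu)\<close> all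
  terms but the one of the trivial coset tend to 0.

  Zeta values. A Taylor expansion of \<open>(n + 1)\<^sup>1\<^sup>-\<^sup>s\<close> and telescoping express \<open>(s - 1) \<zeta>(s)\<close> by its
  values at \<open>s + 1, s + 2, \<dots>\<close> and a remainder that is holomorphic further to the left; this continues it to an entire function and becomes the Bernoulli
  recursion at \<open>s = 1 - m\<close> (\<open>riemann_zeta_negative\<close>).
\<close>

section \<open>Periodic holomorphic functions of one variable\<close>

definition echar :: "complex \<Rightarrow> complex" where "echar w = exp (2 * of_real pi * \<i> * w)"

lemma echar_add: "echar (a + b) = echar a * echar b"
  by (simp add: echar_def exp_add [symmetric] algebra_simps)

lemma echar_0 [simp]: "echar 0 = 1" by (simp add: echar_def)

lemma echar_nonzero [simp]: "echar w \<noteq> 0" by (simp add: echar_def)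

lemma norm_echar: "norm (echar w) = exp (- (2 * pi * Im w))"
  by (simp add: echar_def norm_exp_eq_Re)

lemma echar_of_int [simp]: "echar (of_int n) = 1"
  unfolding echar_def using exp_two_pi_i' [symmetric]
  by (simp add: exp_eq_1)

lemma echar_1 [simp]: "echar 1 = 1"
  using echar_of_int [of 1] by simp

lemma echar_eq_1_iff: "echar w = 1 \<longleftrightarrow> w \<in> \<int>"
proof
  assume "echar w = 1"
  then obtain n :: int where "Im (2 * of_real pi * \<i> * w) = real_of_int (2 * n) * pi" and "Re (2 * of_real pi * \<i> * w) = 0"
    unfolding echar_def exp_eq_1 by auto
  then have "w = of_int n"
    by (simp add: complex_eq_iff)
  then show "w \<in> \<int>" by simp
qed (auto elim: Ints_cases)

lemma holomorphic_echar [holomorphic_intros]: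
  "f holomorphic_on A \<Longrightarrow> (\<lambda>w. echar (f w)) holomorphic_on A"
  unfolding echar_def by (intro holomorphic_intros)

lemma continuous_echar [continuous_intros]:
  "continuous_on A f \<Longrightarrow> continuous_on A (\<lambda>w. echar (f w))"
  unfolding echar_def by (intro continuous_intros)

definition unit_mean :: "(complex \<Rightarrow> complex) \<Rightarrow> complex \<Rightarrow> complex" where
  "unit_mean f w = integral {0..1} (\<lambda>t. f (w + of_real t))"

lemma unit_mean_primitive:
  assumes "\<And>u. u \<in> S \<Longrightarrow> (F has_field_derivative f u) (at u within S)"
    and "\<And>t. t \<in> {0..1} \<Longrightarrow> w + of_real t \<in> S"
  shows "unit_mean f w = F (w + 1) - F w"
proof -
  have "((\<lambda>t. F (w + of_real t)) has_vector_derivative f (w + of_real t)) (at t within {0..1})"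
    if t: "t \<in> {0..1}" for t :: real
  proof -
    have "((\<lambda>t. w + of_real t) has_vector_derivative 1) (at t within {0..1})"
      by (auto intro!: derivative_eq_intros)
    moreover have "(F has_field_derivative f (w + of_real t)) (at (w + of_real t) within (\<lambda>t. w + of_real t) ` {0..1})"
      using assms t by (blast intro: DERIV_subset)
    ultimately show ?thesis
      using field_vector_diff_chain_within [of "\<lambda>t. w + of_real t" 1 t "{0..1}" F "f (w + of_real t)"]
      by (simp add: o_def)
  qed
  then have d: "\<And>t::real. t \<in> {0..1} \<Longrightarrow> ((\<lambda>t. F (w + of_real t)) has_vector_derivative f (w + of_real t)) (at t within {0..1})" by blast
  from fundamental_theorem_of_calculus [OF _ this]
  show ?thesis unfolding unit_mean_def by (simp add: integral_unique)
qed

definition strip :: "complex set \<Rightarrow> bool" where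
  "strip S \<longleftrightarrow> open S \<and> convex S \<and> (\<forall>w\<in>S. \<forall>t::real. w + of_real t \<in> S)"

text \<open>
  A primitive \<open>F\<close> exists on the convex set \<open>S\<close>, the mean at \<open>w\<close> is \<open>F(w + 1) - F(w)\<close>, and this
  difference has derivative 0. This is what allows contours to be moved between heights.
\<close>

lemma unit_mean_const:
  assumes S: "strip S" and f: "f holomorphic_on S"
    and per: "\<And>w. w \<in> S \<Longrightarrow> f (w + 1) = f w"
    and w: "w \<in> S" and w': "w' \<in> S"
  shows "unit_mean f w = unit_mean f w'"
proof -
  obtain F where F: "\<And>u. u \<in> S \<Longrightarrow> (F has_field_derivative f u) (at u within S)"
    using holomorphic_convex_primitive' S f unfolding strip_def by metis
  have tr: "u + 1 \<in> S" if "u \<in> S" for u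
    using S that unfolding strip_def by (metis of_real_1)
  have "((\<lambda>u. F (u + 1) - F u) has_field_derivative 0) (at u within S)" if "u \<in> S" for u
  proof -
    have "(F has_field_derivative f (u + 1)) (at (u + 1))"
      using F [OF tr [OF that]] S tr [OF that] unfolding strip_def by (metis at_within_open)
    then have "((\<lambda>u. F (u + 1)) has_field_derivative f (u + 1)) (at u within S)"
      using DERIV_at_within_shift [of F "f (u+1)" 1 u UNIV] by (simp add: add.commute has_field_derivative_at_within)
    with F [OF that] per [OF that] show ?thesis
      by (auto intro!: derivative_eq_intros)
  qed
  then obtain c where "\<And>u. u \<in> S \<Longrightarrow> F (u + 1) - F u = c"
    using has_field_derivative_zero_constant [of S "\<lambda>u. F (u + 1) - F u"] S
    unfolding strip_def by metis
  moreover have "unit_mean f u = F (u + 1) - F u" if "u \<in> S" for u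
    using S that unfolding strip_def by (intro unit_mean_primitive [OF F]) auto
  ultimately show ?thesis using w w' by simp
qed

lemma norm_unit_mean_le:
  assumes "continuous_on {0..1} (\<lambda>t. f (w + of_real t))"
    and "\<And>t. t \<in> {0..1} \<Longrightarrow> norm (f (w + of_real t)) \<le> B"
  shows "norm (unit_mean f w) \<le> B"
proof -
  have "norm (integral {0..1} (\<lambda>t. f (w + of_real t))) \<le> B * (1 - 0)"
    by (rule integral_bound) (use assms in auto)
  then show ?thesis by (simp add: unit_mean_def)
qed

text \<open>
  The singularities at the common zeros are removable by l'Hopital's rule.
\<close>

lemma holomorphic_quotient_simple_zeros:
  assumes h: "h holomorphic_on A" and q: "q holomorphic_on A" and A: "open A"
    and z: "\<And>w. w \<in> A \<Longrightarrow> q w = 0 \<Longrightarrow> h w = 0 \<and> deriv q w \<noteq> 0"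
  shows "(\<lambda>w. if q w = 0 then deriv h w / deriv q w else h w / q w) holomorphic_on A"
    (is "?g holomorphic_on A")
proof (subst holomorphic_on_open [OF A], rule ballI)
  fix a assume a: "a \<in> A"
  have "\<exists>r>0. ball a r \<subseteq> A \<and> (\<forall>w\<in>ball a r - {a}. q w \<noteq> 0)"
  proof (cases "q a = 0")
    case True
    have dq: "(q has_field_derivative deriv q a) (at a)"
      using A a holomorphic_derivI q by blast
    have "(\<lambda>w. (q w - q a) / (w - a)) \<midarrow>a\<rightarrow> deriv q a"
      using dq by (simp add: has_field_derivative_iff)
    then have "\<forall>\<^sub>F w in at a. (q w - q a) / (w - a) \<noteq> 0"
      using z [OF a True] tendsto_imp_eventually_ne by blast
    then have "\<forall>\<^sub>F w in at a. q w \<noteq> 0"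
      by eventually_elim (auto simp: True)
    then obtain r where r: "r > 0" "\<And>w. w \<noteq> a \<Longrightarrow> dist w a < r \<Longrightarrow> q w \<noteq> 0"
      unfolding eventually_at by auto
    obtain s where s: "s > 0" "ball a s \<subseteq> A" using A a open_contains_ball by blast
    show ?thesis
      by (rule exI [of _ "min r s"]) (use r s in \<open>auto simp: dist_commute\<close>)
  next
    case False
    have "open {w \<in> A. q w \<noteq> 0}"
      using continuous_open_preimage [OF holomorphic_on_imp_continuous_on [OF q] A, of "-{0}"]
      by (auto simp: vimage_def Int_def)
    then obtain s where s: "s > 0" "ball a s \<subseteq> {w \<in> A. q w \<noteq> 0}"
      using a False open_contains_ball by (metis (mono_tags, lifting) mem_Collect_eq)
    then show ?thesis by (intro exI [of _ s]) blast
  qed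
  then obtain r where r: "r > 0" "ball a r \<subseteq> A" "\<And>w. w \<in> ball a r - {a} \<Longrightarrow> q w \<noteq> 0" by blast
  have hol: "(\<lambda>w. h w / q w) holomorphic_on ball a r - {a}"
    using r by (intro holomorphic_on_divide holomorphic_on_subset [OF h] holomorphic_on_subset [OF q]) auto
  have lim: "(\<lambda>w. h w / q w) \<midarrow>a\<rightarrow> ?g a"
  proof (cases "q a = 0")
    case True
    then show ?thesis
      using z [OF a True] A a holomorphic_derivI [OF h] holomorphic_derivI [OF q]
      by (auto intro!: lhopital_complex_simple)
  next
    case False
    have "isCont h a" "isCont q a"
      using A a h q holomorphic_on_imp_continuous_on continuous_on_eq_continuous_at by blast+
    with False show ?thesis by (auto simp: isCont_def intro: tendsto_divide)
  qed
  have "(\<lambda>y. if y = a then ?g a else h y / q y) holomorphic_on ball a r"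
    by (rule removable_singularity [OF hol open_ball lim])
  then have "?g holomorphic_on ball a r"
    by (rule holomorphic_transform) (use r in auto)
  then show "\<exists>f'. (?g has_field_derivative f') (at a)"
    using r holomorphic_on_open [of "ball a r"] by auto
qed

lemma summable_on_int_abs:
  fixes f :: "nat \<Rightarrow> real"
  assumes f: "summable f" "\<And>n. f n \<ge> 0"
  shows "(\<lambda>n::int. f (nat \<bar>n\<bar>)) summable_on UNIV"
proof -
  have s: "f summable_on UNIV"
    using f by (simp add: summable_on_UNIV_nonneg_real_iff)
  have 1: "(\<lambda>n::int. f (nat \<bar>n\<bar>)) summable_on range int"
    by (subst summable_on_reindex) (use s in \<open>auto simp: o_def\<close>)
  have 2: "(\<lambda>n::int. f (nat \<bar>n\<bar>)) summable_on range (\<lambda>n. - int n)"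
    by (subst summable_on_reindex) (use s in \<open>auto simp: o_def inj_on_def\<close>)
  have "n \<in> range int \<union> range (\<lambda>n. - int n)" for n :: int
    by (cases n rule: int_cases2) auto
  then have "(UNIV :: int set) = range int \<union> range (\<lambda>n. - int n)"
    by blast
  moreover have "(\<lambda>n::int. f (nat \<bar>n\<bar>)) summable_on (range int \<union> range (\<lambda>n. - int n))"
    by (rule summable_on_union [OF 1 2])
  ultimately show ?thesis by simp
qed

lemma summable_on_exp_abs_int:
  assumes "c > 0"
  shows "(\<lambda>n::int. exp (- (c * real_of_int \<bar>n\<bar>))) summable_on UNIV"
proof -
  have "summable (\<lambda>n. exp (- c) ^ n)"
    using assms by (intro summable_geometric) auto
  then have "summable (\<lambda>n. exp (- (c * real n)))"
    by (simp add: exp_of_nat_mult [symmetric] mult.commute)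
  from summable_on_int_abs [OF this] show ?thesis by simp
qed

lemma has_sum_int_symmetric_limit:
  fixes f :: "int \<Rightarrow> complex"
  assumes "(f has_sum s) UNIV"
  shows "(\<lambda>N. \<Sum>n=- int N..int N. f n) \<longlonglongrightarrow> s"
proof -
  have "\<forall>\<^sub>F N in sequentially. finite {- int N..int N} \<and> Y \<subseteq> {- int N..int N} \<and> {- int N..int N} \<subseteq> UNIV"
    if Y: "finite Y" for Y :: "int set"
  proof -
    obtain M where M: "\<And>x. x \<in> Y \<Longrightarrow> nat \<bar>x\<bar> \<le> M"
      using Y by (metis finite_imageI Max_ge imageI)
    show ?thesis
      by (rule eventually_sequentiallyI [of M]) (use M in force)
  qed
  then have "filterlim (\<lambda>N. {- int N..int N}) (finite_subsets_at_top (UNIV :: int set)) sequentially"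
    unfolding filterlim_finite_subsets_at_top by blast
  then show ?thesis
    using assms unfolding has_sum_def by (rule filterlim_compose [rotated])
qed

lemma unit_mean_echar: "unit_mean (\<lambda>w. echar (of_int n * w)) 0 = (if n = 0 then 1 else 0)"
proof (cases "n = 0")
  case True
  then show ?thesis by (simp add: unit_mean_def)
next
  case False
  define c where "c = (2 * of_real pi * \<i> * of_int n :: complex)"
  have c: "c \<noteq> 0" using False by (simp add: c_def)
  have *: "((\<lambda>t. exp (c * t) / c) has_field_derivative exp (c * t)) (at t within UNIV)" for t
    using c by (auto intro!: derivative_eq_intros)
  have "unit_mean (\<lambda>t. exp (c * t)) 0 = exp (c * (0 + 1)) / c - exp (c * 0) / c"
    by (rule unit_mean_primitive [OF *]) auto
  moreover have "exp c = 1"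
    using echar_of_int [of n] unfolding echar_def c_def .
  moreover have "exp (c * t) = echar (of_int n * t)" for t
    by (simp add: c_def echar_def mult_ac)
  ultimately show ?thesis using False by simp
qed

text \<open>
  The proof avoids Laurent series and kernels. For fixed \<open>z\<close> write
  \<open>f(z) - f(w) = g(w) (1 - e(w - z))\<close>; the quotient \<open>g\<close> is again holomorphic and periodic, so this
  relation makes the \<open>n\<close>-th term of the series equal to \<open>\<delta>\<^bsub>n0\<^esub> f(z) - c\<^sub>n(g) + c\<^bsub>n-1\<^esub>(g)\<close>. The sum
  telescopes, and the coefficients decay exponentially because the mean may be taken above or below
  the height of \<open>z\<close>.
\<close>

lemma fourier_expansion_strip:
  assumes S: "strip S" and f: "f holomorphic_on S"
    and per: "\<And>w. w \<in> S \<Longrightarrow> f (w + 1) = f w"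
    and z: "z \<in> S"
  shows "((\<lambda>n::int. unit_mean (\<lambda>w. f w * echar (- of_int n * w)) z * echar (of_int n * z)) has_sum f z) UNIV"
proof -
  define C where "C g n = unit_mean (\<lambda>w. g w * echar (- of_int n * (w - z))) z" for g and n :: int
  have op: "open S" and tr: "\<And>w t. w \<in> S \<Longrightarrow> w + complex_of_real t \<in> S"
    using S by (auto simp: strip_def)
  have tr1: "w + 1 \<in> S" if "w \<in> S" for w using tr [OF that, of 1] by simp
  obtain \<epsilon> where \<epsilon>: "\<epsilon> > 0" "z + \<i> * of_real \<epsilon> \<in> S" "z - \<i> * of_real \<epsilon> \<in> S"
  proof -
    obtain r where r: "r > 0" "ball z r \<subseteq> S" using op z open_contains_ball by blast
    have "0 < r / 2" "z + \<i> * of_real (r/2) \<in> ball z r" "z - \<i> * of_real (r/2) \<in> ball z r"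
      using r by (simp_all add: dist_norm norm_mult)
    then show ?thesis using that [of "r/2"] r by blast
  qed
  have cont: "continuous_on {0..1} (\<lambda>t. g (w + of_real t))" if "g holomorphic_on S" "w \<in> S" for g w
    by (rule continuous_on_compose2 [OF holomorphic_on_imp_continuous_on [OF that(1)]])
       (use tr that in \<open>auto intro!: continuous_intros\<close>)
  have decay: "\<exists>B. \<forall>n. norm (C g n) \<le> B * exp (- (2 * pi * \<epsilon> * \<bar>real_of_int n\<bar>))"
    if g: "g holomorphic_on S" and gper: "\<And>w. w \<in> S \<Longrightarrow> g (w + 1) = g w" for g
  proof -
    have bd: "\<exists>B. \<forall>t\<in>{0..1}. norm (g (w + of_real t)) \<le> B" if "w \<in> S" for w
    proof -
      have "compact ((\<lambda>t. g (w + of_real t)) ` {0..1})"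
        by (intro compact_continuous_image cont g that) auto
      then show ?thesis by (auto dest!: compact_imp_bounded simp: bounded_iff)
    qed
    obtain B1 where B1: "\<And>t. t \<in> {0..1} \<Longrightarrow> norm (g (z + \<i> * of_real \<epsilon> + of_real t)) \<le> B1"
      using bd [OF \<epsilon>(2)] by blast
    obtain B2 where B2: "\<And>t. t \<in> {0..1} \<Longrightarrow> norm (g (z - \<i> * of_real \<epsilon> + of_real t)) \<le> B2"
      using bd [OF \<epsilon>(3)] by blast
    have hol: "(\<lambda>w. g w * echar (- of_int n * (w - z))) holomorphic_on S" for n
      by (intro holomorphic_intros g)
    have shift: "C g n = unit_mean (\<lambda>w. g w * echar (- of_int n * (w - z))) w'" if "w' \<in> S" for n w'
    proof -
      have "g (w + 1) * echar (- of_int n * (w + 1 - z)) = g w * echar (- of_int n * (w - z))" if "w \<in> S" for w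
      proof -
        have "- of_int n * (w + 1 - z) = - of_int n * (w - z) + of_int (- n)"
          by (simp add: algebra_simps)
        then show ?thesis using gper [OF that] by (simp only: echar_add echar_of_int) simp
      qed
      then show ?thesis unfolding C_def
        by (intro unit_mean_const [OF S hol _ z that])
    qed
    have up: "norm (C g n) \<le> B1 * exp (2 * pi * \<epsilon> * real_of_int n)" for n
      unfolding shift [OF \<epsilon>(2)]
    proof (rule norm_unit_mean_le)
      show "continuous_on {0..1} (\<lambda>t. g (z + \<i> * of_real \<epsilon> + of_real t) * echar (- of_int n * (z + \<i> * of_real \<epsilon> + of_real t - z)))"
        using cont [OF hol \<epsilon>(2)] by simp
      fix t :: real assume "t \<in> {0..1}"
      then show "norm (g (z + \<i> * of_real \<epsilon> + of_real t) * echar (- of_int n * (z + \<i> * of_real \<epsilon> + of_real t - z)))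
          \<le> B1 * exp (2 * pi * \<epsilon> * real_of_int n)"
        using B1 [of t] by (auto simp: norm_mult norm_echar algebra_simps intro!: mult_mono)
    qed
    have dn: "norm (C g n) \<le> B2 * exp (- (2 * pi * \<epsilon> * real_of_int n))" for n
      unfolding shift [OF \<epsilon>(3)]
    proof (rule norm_unit_mean_le)
      show "continuous_on {0..1} (\<lambda>t. g (z - \<i> * of_real \<epsilon> + of_real t) * echar (- of_int n * (z - \<i> * of_real \<epsilon> + of_real t - z)))"
        using cont [OF hol \<epsilon>(3)] by simp
      fix t :: real assume "t \<in> {0..1}"
      then show "norm (g (z - \<i> * of_real \<epsilon> + of_real t) * echar (- of_int n * (z - \<i> * of_real \<epsilon> + of_real t - z)))
          \<le> B2 * exp (- (2 * pi * \<epsilon> * real_of_int n))"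
        using B2 [of t] by (auto simp: norm_mult norm_echar algebra_simps intro!: mult_mono)
    qed
    have "norm (C g n) \<le> max B1 B2 * exp (- (2 * pi * \<epsilon> * \<bar>real_of_int n\<bar>))" for n
    proof (cases "n \<ge> 0")
      case True
      then have "norm (C g n) \<le> B2 * exp (- (2 * pi * \<epsilon> * \<bar>real_of_int n\<bar>))" using dn [of n] by simp
      also have "\<dots> \<le> max B1 B2 * exp (- (2 * pi * \<epsilon> * \<bar>real_of_int n\<bar>))" by (intro mult_right_mono) auto
      finally show ?thesis .
    next
      case False
      then have "norm (C g n) \<le> B1 * exp (- (2 * pi * \<epsilon> * \<bar>real_of_int n\<bar>))" using up [of n] by simp
      also have "\<dots> \<le> max B1 B2 * exp (- (2 * pi * \<epsilon> * \<bar>real_of_int n\<bar>))" by (intro mult_right_mono) auto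
      finally show ?thesis .
    qed
    then show ?thesis by blast
  qed
  define g where "g = (\<lambda>w. if 1 - echar (w - z) = 0 then deriv (\<lambda>w. f z - f w) w / deriv (\<lambda>w. 1 - echar (w - z)) w
                     else (f z - f w) / (1 - echar (w - z)))"
  have per_int: "f (w + of_nat n) = f w" if "w \<in> S" for w n
  proof (induction n)
    case (Suc n)
    have "f (w + of_nat n + 1) = f (w + of_nat n)"
      using per [of "w + of_nat n"] tr [OF that, of "real n"] by simp
    then show ?case using Suc by (simp add: add.assoc add.commute [of 1])
  qed simp
  have per_int': "f (w + of_int n) = f w" if "w \<in> S" for w n
  proof (cases "n \<ge> 0")
    case True
    then show ?thesis using per_int [OF that, of "nat n"] by simp
  next
    case False
    then have "f (w + of_int n) = f (w + of_int n + of_nat (nat (- n)))"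
      using per_int [of "w + of_int n" "nat (-n)"] tr [OF that, of "real_of_int n"] by simp
    then show ?thesis using False by simp
  qed
  have zero: "f w = f z" if "w \<in> S" "echar (w - z) = 1" for w
  proof -
    have "w - z \<in> \<int>" using that echar_eq_1_iff by blast
    then obtain n where "w - z = of_int n" by (rule Ints_cases)
    then have "w = z + of_int n" by (simp add: algebra_simps)
    then show ?thesis using per_int' [OF z, of n] by simp
  qed
  have dq: "((\<lambda>w. 1 - echar (w - z)) has_field_derivative - (2 * of_real pi * \<i> * echar (w - z))) (at w)" for w
    unfolding echar_def by (auto intro!: derivative_eq_intros)
  have hol_g: "g holomorphic_on S"
    unfolding g_def
  proof (rule holomorphic_quotient_simple_zeros)
    show "(\<lambda>w. f z - f w) holomorphic_on S" "(\<lambda>w. 1 - echar (w - z)) holomorphic_on S"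
      by (intro holomorphic_intros f)+
    fix w assume w: "w \<in> S" "1 - echar (w - z) = 0"
    then show "f z - f w = 0 \<and> deriv (\<lambda>w. 1 - echar (w - z)) w \<noteq> 0"
      using zero [of w] DERIV_imp_deriv [OF dq, of w] by simp
  qed (use op in auto)
  have g_eq: "f z - f w = g w * (1 - echar (w - z))" if "w \<in> S" for w
    using zero [OF that] by (auto simp: g_def)
  have per_g: "g (w + 1) = g w" if w: "w \<in> S" for w
  proof -
    have e: "echar (w + 1 - z) = echar (w - z)" 
      using echar_add [of "w - z" 1] by (simp add: algebra_simps)
    show ?thesis
    proof (cases "echar (w - z) = 1")
      case False
      then show ?thesis using e per [OF w] by (simp add: g_def)
    next
      case True
      have fd: "(f has_field_derivative deriv f (w + 1)) (at (w + 1))"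
        using holomorphic_derivI [OF f op tr1 [OF w]] .
      have "((\<lambda>w. f (w + 1)) has_field_derivative deriv f (w + 1)) (at w)"
        using fd DERIV_shift [of f "deriv f (w+1)" w 1] by simp
      moreover have "\<forall>\<^sub>F u in nhds w. u \<in> S" using op w eventually_nhds by blast
      then have "\<forall>\<^sub>F u in nhds w. f (u + 1) = f u" by eventually_elim (rule per)
      ultimately have "(f has_field_derivative deriv f (w + 1)) (at w)"
        using DERIV_cong_ev [OF refl _ refl] by fastforce
      then have df: "deriv f w = deriv f (w + 1)" by (rule DERIV_imp_deriv)
      have "((\<lambda>w. f z - f w) has_field_derivative - deriv f u) (at u)" if "u \<in> S" for u
        using holomorphic_derivI [OF f op that] by (auto intro!: derivative_eq_intros)
      then have dh: "deriv (\<lambda>w. f z - f w) u = - deriv f u" if "u \<in> S" for u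
        using that DERIV_imp_deriv by blast
      show ?thesis using True e w tr1 [OF w] df dh DERIV_imp_deriv [OF dq]
        by (simp add: g_def)
    qed
  qed
  have int_g: "(\<lambda>t. g (z + of_real t) * echar (- of_int n * of_real t)) integrable_on {0..1}" for n :: int
    by (intro integrable_continuous_interval continuous_intros cont [OF hol_g z])
  have tele: "C f n = (if n = 0 then f z else 0) - C g n + C g (n - 1)" for n
  proof -
    have A: "integral {0..1} (\<lambda>t::real. f z * echar (- of_int n * of_real t)) = (if n = 0 then f z else 0)"
      using unit_mean_echar [of "- n"] by (simp add: unit_mean_def)
    have "C f n = integral {0..1} (\<lambda>t. f z * echar (- of_int n * of_real t)
        - g (z + of_real t) * echar (- of_int n * of_real t)
        + g (z + of_real t) * echar (- of_int (n - 1) * of_real t))"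
      unfolding C_def unit_mean_def
    proof (intro integral_cong)
      fix t :: real assume "t \<in> {0..1}"
      have fg: "f (z + of_real t) = f z - g (z + of_real t) * (1 - echar (of_real t))"
        using g_eq [OF tr [OF z, of t]] by (simp add: algebra_simps)
      have e: "echar (- of_int (n - 1) * of_real t) = echar (- of_int n * of_real t) * echar (of_real t)"
        by (simp add: echar_add [symmetric] algebra_simps)
      show "f (z + of_real t) * echar (- of_int n * (z + of_real t - z)) = f z * echar (- of_int n * of_real t)
        - g (z + of_real t) * echar (- of_int n * of_real t)
        + g (z + of_real t) * echar (- of_int (n - 1) * of_real t)"
        unfolding e fg by (simp add: algebra_simps)
    qed
    also have "\<dots> = integral {0..1} (\<lambda>t::real. f z * echar (- of_int n * of_real t)) - C g n + C g (n - 1)"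
    proof -
      have i1: "(\<lambda>t::real. f z * echar (- of_int n * of_real t)) integrable_on {0..1}"
        by (intro integrable_continuous_interval continuous_intros)
      show ?thesis
        unfolding C_def unit_mean_def
        using integral_add [OF integrable_diff [OF i1 int_g [of n]] int_g [of "n - 1"]]
          integral_diff [OF i1 int_g [of n]] by simp
    qed
    finally show ?thesis using A by simp
  qed
  have Ceq: "unit_mean (\<lambda>w. f w * echar (- of_int n * w)) z * echar (of_int n * z) = C f n" for n
  proof -
    have "f w * echar (- of_int n * w) * echar (of_int n * z) = f w * echar (- of_int n * (w - z))" for w
    proof -
      have "- of_int n * (w - z) = - of_int n * w + of_int n * z" by (simp add: algebra_simps)
      then show ?thesis by (simp only: echar_add mult.assoc)
    qed
    then show ?thesis unfolding C_def unit_mean_def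
      by (simp only: integral_mult_left [symmetric])
  qed
  obtain B where B: "\<And>n. norm (C f n) \<le> B * exp (- (2 * pi * \<epsilon> * \<bar>real_of_int n\<bar>))"
    using decay [OF f per] by blast
  obtain B' where B': "\<And>n. norm (C g n) \<le> B' * exp (- (2 * pi * \<epsilon> * \<bar>real_of_int n\<bar>))"
    using decay [OF hol_g per_g] by blast
  have "(\<lambda>n::int. B * exp (- (2 * pi * \<epsilon> * real_of_int \<bar>n\<bar>))) summable_on UNIV"
    by (intro summable_on_cmult_right summable_on_exp_abs_int) (use \<epsilon> in auto)
  then have "(\<lambda>n. norm (C f n)) summable_on UNIV"
    by (rule Infinite_Sum.abs_summable_on_comparison_test') (use B in auto)
  then obtain s where s: "(C f has_sum s) UNIV"
    using Infinite_Sum.abs_summable_summable summable_on_def by blast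
  have part: "(\<Sum>n=- int N..int N. C f n) = f z - C g (int N) + C g (- int N - 1)" for N
  proof (induction N)
    case 0
    then show ?case using tele [of 0] by simp
  next
    case (Suc N)
    have "{- int (Suc N)..int (Suc N)} = insert (int (Suc N)) (insert (- int (Suc N)) {- int N..int N})"
      by auto
    then have "(\<Sum>n=- int (Suc N)..int (Suc N). C f n) =
        C f (int (Suc N)) + (C f (- int (Suc N)) + (\<Sum>n=- int N..int N. C f n))"
      by simp
    also have "C f (int (Suc N)) = C g (int N) - C g (int (Suc N))"
      using tele [of "int (Suc N)"] by simp
    also have "C f (- int (Suc N)) = C g (- int (Suc N) - 1) - C g (- int N - 1)"
    proof -
      have "- int (Suc N) = - int N - 1" by simp
      then show ?thesis unfolding tele [of "- int (Suc N)"] by (simp only:) simp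
    qed
    finally show ?case unfolding Suc by simp
  qed
  have lim0: "(\<lambda>N. C g (h N)) \<longlonglongrightarrow> 0" if h: "\<And>N. \<bar>h N\<bar> \<ge> int N" for h :: "nat \<Rightarrow> int"
  proof -
    have B'0: "B' \<ge> 0" using order_trans [OF norm_ge_zero B' [of 0]] by simp
    have *: "(\<lambda>N. B' * exp (- (2 * pi * \<epsilon>)) ^ N) \<longlonglongrightarrow> 0"
      by (rule tendsto_mult_right_zero, rule LIMSEQ_power_zero) (use \<epsilon> in auto)
    have le: "norm (C g (h N)) \<le> B' * exp (- (2 * pi * \<epsilon>)) ^ N" for N
    proof -
      have hN: "real N \<le> \<bar>real_of_int (h N)\<bar>" using h [of N] by linarith
      have "norm (C g (h N)) \<le> B' * exp (- (2 * pi * \<epsilon> * \<bar>real_of_int (h N)\<bar>))" by (rule B')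
      also have "\<dots> \<le> B' * exp (- (2 * pi * \<epsilon> * real N))"
        using hN B'0 \<epsilon> by (intro mult_left_mono) (auto intro: mult_left_mono)
      also have "\<dots> = B' * exp (- (2 * pi * \<epsilon>)) ^ N"
        by (simp add: exp_of_nat_mult [symmetric] mult_ac)
      finally show ?thesis .
    qed
    show ?thesis
      by (rule Lim_null_comparison [OF always_eventually *]) (use le in blast)
  qed
  have "(\<lambda>N. f z - C g (int N) + C g (- int N - 1)) \<longlonglongrightarrow> f z - 0 + 0"
    by (intro tendsto_intros lim0) auto
  moreover have "(\<lambda>N. f z - C g (int N) + C g (- int N - 1)) \<longlonglongrightarrow> s"
    using has_sum_int_symmetric_limit [OF s] unfolding part .
  ultimately have "s = f z" using LIMSEQ_unique by fastforce
  with s show ?thesis unfolding Ceq by simp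
qed

section \<open>Periodic holomorphic functions on the tube domain\<close>

type_synonym complex3 = "complex \<times> complex \<times> complex"

text \<open>
  Cauchy's formula for each parameter value, integrated over the parameter, presents the integral as
  a Cauchy integral of a continuous function.
\<close>

lemma holomorphic_integral_param:
  fixes g :: "complex \<Rightarrow> real \<Rightarrow> complex"
  assumes U: "open U"
    and cont: "continuous_on (U \<times> {0..1}) (\<lambda>(w, t). g w t)"
    and hol: "\<And>t. t \<in> {0..1} \<Longrightarrow> (\<lambda>w. g w t) holomorphic_on U"
  shows "(\<lambda>w. integral {0..1} (g w)) holomorphic_on U"
proof -
  define f where "f w = integral {0..1} (g w)" for w
  have contf: "continuous_on U f"
    unfolding f_def using integral_continuous_on_param [of U 0 1 g] cont by simp
  have lin: "contour_integral (linepath 0 1) h = integral {0..1} (\<lambda>t. h (of_real t))" for h :: "complex \<Rightarrow> complex"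
    by (simp add: contour_integral_integral linepath_def scaleR_conv_of_real)
  have "\<exists>f'. (f has_field_derivative f') (at z)" if z: "z \<in> U" for z
  proof -
    obtain r where r: "r > 0" "cball z r \<subseteq> U" using U z open_contains_cball by blast
    have sph: "path_image (circlepath z r) \<subseteq> U" using r by (auto simp: path_image_circlepath_nonneg)
    have *: "((\<lambda>u. f u / (u - w) ^ 1) has_contour_integral (2 * of_real pi * \<i> * f w)) (circlepath z r)"
      if w: "w \<in> ball z r" for w
    proof -
      have ne: "u \<noteq> w" if "u \<in> path_image (circlepath z r)" for u
        using that w r by (auto simp: path_image_circlepath_nonneg)
      have "contour_integral (circlepath z r) (\<lambda>u. contour_integral (linepath 0 1) (\<lambda>t. g u (Re t) / (u - w)))
          = contour_integral (linepath 0 1) (\<lambda>t. contour_integral (circlepath z r) (\<lambda>u. g u (Re t) / (u - w)))"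
      proof (rule contour_integral_swap)
        have "continuous_on (path_image (circlepath z r) \<times> path_image (linepath 0 1))
            ((\<lambda>(w, t). g w t) \<circ> (\<lambda>(u, t::complex). (u, Re t)))"
        proof (rule continuous_on_compose)
          show "continuous_on (path_image (circlepath z r) \<times> path_image (linepath 0 1)) (\<lambda>(u, t::complex). (u, Re t))"
            by (auto simp: case_prod_unfold intro!: continuous_intros)
          show "continuous_on ((\<lambda>(u, t). (u, Re t)) ` (path_image (circlepath z r) \<times> path_image (linepath 0 1))) (\<lambda>(w, t). g w t)"
            by (rule continuous_on_subset [OF cont]) (use sph in \<open>auto simp: closed_segment_def\<close>)
        qed
        then have c: "continuous_on (path_image (circlepath z r) \<times> path_image (linepath 0 1)) (\<lambda>p. g (fst p) (Re (snd p)))"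
          by (simp add: o_def case_prod_unfold)
        show "continuous_on (path_image (circlepath z r) \<times> path_image (linepath 0 1)) (\<lambda>(u, t). g u (Re t) / (u - w))"
          unfolding case_prod_unfold by (intro continuous_intros c) (use ne in auto)
        show "continuous_on {0..1} (\<lambda>t. vector_derivative (circlepath z r) (at t))"
          by (simp add: vector_derivative_circlepath) (intro continuous_intros)
      qed (auto simp: vector_derivative_linepath_at)
      also have "contour_integral (circlepath z r) (\<lambda>u. contour_integral (linepath 0 1) (\<lambda>t. g u (Re t) / (u - w)))
          = contour_integral (circlepath z r) (\<lambda>u. f u / (u - w))"
        by (simp add: lin f_def)
      also have "contour_integral (linepath 0 1) (\<lambda>t. contour_integral (circlepath z r) (\<lambda>u. g u (Re t) / (u - w)))
          = integral {0..1} (\<lambda>t. contour_integral (circlepath z r) (\<lambda>u. g u t / (u - w)))"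
        by (simp add: lin)
      also have "\<dots> = integral {0..1} (\<lambda>t. 2 * of_real pi * \<i> * g w t)"
      proof (rule integral_cong)
        fix t :: real assume t: "t \<in> {0..1}"
        have "(\<lambda>w. g w t) holomorphic_on cball z r"
          using hol [OF t] r holomorphic_on_subset by blast
        then have "((\<lambda>u. g u t / (u - w)) has_contour_integral (2 * of_real pi * \<i> * g w t)) (circlepath z r)"
          by (intro Cauchy_integral_circlepath holomorphic_on_imp_continuous_on)
             (use w in \<open>auto intro: holomorphic_on_subset simp: dist_norm norm_minus_commute\<close>)
        then show "contour_integral (circlepath z r) (\<lambda>u. g u t / (u - w)) = 2 * of_real pi * \<i> * g w t"
          by (rule contour_integral_unique)
      qed
      also have "\<dots> = 2 * of_real pi * \<i> * f w"
        by (simp add: f_def)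
      finally have "contour_integral (circlepath z r) (\<lambda>u. f u / (u - w)) = 2 * of_real pi * \<i> * f w" .
      moreover have ci: "continuous_on (path_image (circlepath z r)) (\<lambda>u. f u / (u - w))"
        by (intro continuous_intros continuous_on_subset [OF contf sph]) (use ne in auto)
      have "((\<lambda>u. f u / (u - w)) has_contour_integral
          contour_integral (circlepath z r) (\<lambda>u. f u / (u - w))) (circlepath z r)"
        by (intro has_contour_integral_integral contour_integrable_continuous_circlepath ci)
      ultimately show ?thesis by simp
    qed
    have "((\<lambda>w. 2 * of_real pi * \<i> * f w) has_field_derivative
        (of_nat 1 * contour_integral (circlepath z r) (\<lambda>u. f u / (u - z) ^ Suc 1))) (at z)"
      by (rule Cauchy_next_derivative_circlepath(2) [OF continuous_on_subset [OF contf sph] *]) (use r in auto)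
    from DERIV_cmult [OF this, of "1 / (2 * of_real pi * \<i>)"] show ?thesis by auto
  qed
  then show ?thesis
    using holomorphic_on_open [OF U] unfolding f_def by blast
qed

lemma summable_on_product:
  fixes f :: "'a \<Rightarrow> real" and g :: "'b \<Rightarrow> real"
  assumes "f summable_on A" "g summable_on B" "\<And>x. f x \<ge> 0" "\<And>y. g y \<ge> 0"
  shows "(\<lambda>(x, y). f x * g y) summable_on A \<times> B"
proof (rule summable_on_SigmaI)
  show "((\<lambda>y. case (x, y) of (x, y) \<Rightarrow> f x * g y) has_sum f x * infsum g B) B" for x
    using has_sum_cmult_right [OF has_sum_infsum [OF assms(2)], of "f x"] by simp
  show "(\<lambda>x. f x * infsum g B) summable_on A"
    by (intro summable_on_cmult_left assms)
qed (use assms in auto)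

definition tube :: "complex3 set" where
  "tube = {(t, z, s). 0 < Im t \<and> 0 < Im s \<and> (Im z)\<^sup>2 < Im t * Im s}"

text \<open>
  Directions are numbered by natural numbers; beyond the three coordinates the direction is 0, so that
  statements about all directions need no bound.
\<close>

definition dir_vec :: "nat \<Rightarrow> complex \<Rightarrow> complex3" where
  "dir_vec i w = (if i = 0 then w else 0, if i = 1 then w else 0, if i = 2 then w else 0)"

definition coord :: "nat \<Rightarrow> complex3 \<Rightarrow> complex" where
  "coord i P = (case P of (t, z, s) \<Rightarrow> if i = 0 then t else if i = 1 then z else if i = 2 then s else 0)"

definition slice :: "nat \<Rightarrow> complex3 \<Rightarrow> complex set" where
  "slice i P = {w. P + dir_vec i w \<in> tube}"

lemma dir_vec_0 [simp]: "dir_vec i 0 = 0"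
  by (simp add: dir_vec_def zero_prod_def)

lemma dir_vec_add: "dir_vec i (v + w) = dir_vec i v + dir_vec i w"
  by (simp add: dir_vec_def)

lemma coord_axis: "i < 3 \<Longrightarrow> coord i (P + dir_vec i w) = coord i P + w"
  by (cases P) (auto simp: dir_vec_def coord_def)

lemma coord_axis_other: "i \<noteq> j \<Longrightarrow> coord i (P + dir_vec j w) = coord i P"
  by (cases P) (auto simp: dir_vec_def coord_def)

lemma continuous_dir_vec [continuous_intros]:
  "continuous_on A f \<Longrightarrow> continuous_on A (\<lambda>x. dir_vec i (f x))"
  unfolding dir_vec_def
  by (cases "i = 0"; cases "i = 1"; cases "i = 2") (simp_all add: continuous_on_Pair)

lemma coord_eq: "coord i P = (if i = 0 then fst P else if i = 1 then fst (snd P) else if i = 2 then snd (snd P) else 0)"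
  by (cases P) (auto simp: coord_def)

lemma continuous_coord [continuous_intros]:
  "continuous_on A f \<Longrightarrow> continuous_on A (\<lambda>x. coord i (f x))"
  unfolding coord_eq
  by (cases "i = 0"; cases "i = 1"; cases "i = 2") (simp_all add: continuous_on_fst continuous_on_snd)

text \<open>
  Positive definiteness is an intersection of half spaces in this form, which gives convexity, and it
  transforms well under \<open>SL\<^sub>2(\<int>)\<close>.
\<close>

lemma tube_iff_quadratic_form:
  "(t, z, s) \<in> tube \<longleftrightarrow> (\<forall>x y. (x, y) \<noteq> (0, 0) \<longrightarrow> 0 < x\<^sup>2 * Im t + 2 * x * y * Im z + y\<^sup>2 * Im s)"
proof
  assume "(t, z, s) \<in> tube"
  then have pos: "0 < Im t" "0 < Im s" "(Im z)\<^sup>2 < Im t * Im s" by (auto simp: tube_def)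
  show "\<forall>x y. (x, y) \<noteq> (0, 0) \<longrightarrow> 0 < x\<^sup>2 * Im t + 2 * x * y * Im z + y\<^sup>2 * Im s"
  proof (intro allI impI)
    fix x y :: real assume nz: "(x, y) \<noteq> (0, 0)"
    have "Im t * (x\<^sup>2 * Im t + 2 * x * y * Im z + y\<^sup>2 * Im s)
        = (x * Im t + y * Im z)\<^sup>2 + y\<^sup>2 * (Im t * Im s - (Im z)\<^sup>2)"
      by (simp add: power2_eq_square algebra_simps)
    also have "\<dots> > 0"
    proof (cases "y = 0")
      case True
      then show ?thesis using nz pos by simp
    next
      case False
      then show ?thesis using pos by (intro add_nonneg_pos mult_pos_pos) auto
    qed
    finally show "0 < x\<^sup>2 * Im t + 2 * x * y * Im z + y\<^sup>2 * Im s"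
      using pos(1) zero_less_mult_pos by blast
  qed
next
  assume *: "\<forall>x y. (x, y) \<noteq> (0, 0) \<longrightarrow> 0 < x\<^sup>2 * Im t + 2 * x * y * Im z + y\<^sup>2 * Im s"
  have t: "0 < Im t" using * [rule_format, of 1 0] by simp
  have s: "0 < Im s" using * [rule_format, of 0 1] by simp
  have "0 < (Im z)\<^sup>2 * Im t + 2 * Im z * (- Im t) * Im z + (- Im t)\<^sup>2 * Im s"
    using * [rule_format, of "Im z" "- Im t"] t by simp
  also have "\<dots> = Im t * (Im t * Im s - (Im z)\<^sup>2)"
    by (simp add: power2_eq_square algebra_simps)
  finally have "(Im z)\<^sup>2 < Im t * Im s"
    using t zero_less_mult_pos by fastforce
  with t s show "(t, z, s) \<in> tube" by (simp add: tube_def)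
qed

lemma open_tube: "open tube"
proof -
  have eq: "tube = {P. 0 < Im (fst P)} \<inter> {P. 0 < Im (snd (snd P))} \<inter> {P. (Im (fst (snd P)))\<^sup>2 < Im (fst P) * Im (snd (snd P))}"
    by (auto simp: tube_def)
  show ?thesis
    unfolding eq by (intro open_Int open_Collect_less continuous_intros)
qed

lemma convex_tube: "convex tube"
proof (rule convexI)
  fix P Q :: complex3 and u v :: real
  assume P: "P \<in> tube" and Q: "Q \<in> tube" and uv: "0 \<le> u" "0 \<le> v" "u + v = 1"
  obtain t z s where P': "P = (t, z, s)" by (cases P)
  obtain t' z' s' where Q': "Q = (t', z', s')" by (cases Q)
  have "0 < x\<^sup>2 * Im (u *\<^sub>R t + v *\<^sub>R t') + 2 * x * y * Im (u *\<^sub>R z + v *\<^sub>R z') + y\<^sup>2 * Im (u *\<^sub>R s + v *\<^sub>R s')"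
    if nz: "(x, y) \<noteq> (0, 0)" for x y
  proof -
    define a where "a = x\<^sup>2 * Im t + 2 * x * y * Im z + y\<^sup>2 * Im s"
    define b where "b = x\<^sup>2 * Im t' + 2 * x * y * Im z' + y\<^sup>2 * Im s'"
    have ab: "0 < a" "0 < b"
      using P Q nz unfolding P' Q' tube_iff_quadratic_form a_def b_def by blast+
    have "x\<^sup>2 * Im (u *\<^sub>R t + v *\<^sub>R t') + 2 * x * y * Im (u *\<^sub>R z + v *\<^sub>R z') + y\<^sup>2 * Im (u *\<^sub>R s + v *\<^sub>R s') = u * a + v * b"
      by (simp add: a_def b_def algebra_simps)
    also have "\<dots> > 0"
      using ab uv by (cases "u = 0") (auto intro!: add_pos_nonneg)
    finally show ?thesis .
  qed
  then show "u *\<^sub>R P + v *\<^sub>R Q \<in> tube"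
    unfolding P' Q' by (simp add: tube_iff_quadratic_form)
qed

lemma tube_real_translate: "P + dir_vec i (of_real t) \<in> tube \<longleftrightarrow> P \<in> tube"
  by (cases P) (auto simp: tube_def dir_vec_def)

lemma strip_slice: "strip (slice i P)"
proof -
  have "slice i P = (\<lambda>w. P + dir_vec i w) -` tube" by (auto simp: slice_def)
  then have "open (slice i P)"
    using open_tube by (auto intro!: open_vimage continuous_intros)
  moreover have "convex (slice i P)"
  proof (rule convexI)
    fix x y u v assume *: "x \<in> slice i P" "y \<in> slice i P" and uv: "0 \<le> u" "0 \<le> v" "u + v = (1::real)"
    have "P + dir_vec i (u *\<^sub>R x + v *\<^sub>R y) = (u + v) *\<^sub>R P + dir_vec i (u *\<^sub>R x + v *\<^sub>R y)"
      using uv by simp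
    also have "\<dots> = u *\<^sub>R (P + dir_vec i x) + v *\<^sub>R (P + dir_vec i y)"
      by (cases P) (simp add: dir_vec_def algebra_simps)
    also have "\<dots> \<in> tube"
      using * uv convex_tube unfolding slice_def convex_def by blast
    finally show "u *\<^sub>R x + v *\<^sub>R y \<in> slice i P" by (simp add: slice_def)
  qed
  moreover have "w + of_real t \<in> slice i P" if "w \<in> slice i P" for w t
    using that unfolding slice_def by (simp add: dir_vec_add add.assoc [symmetric] tube_real_translate)
  ultimately show ?thesis by (auto simp: strip_def)
qed

lemma zero_in_slice: "P \<in> tube \<Longrightarrow> 0 \<in> slice i P"
  by (simp add: slice_def)

text \<open>
  Joint continuity and holomorphy in each coordinate separately are the properties that pass to means
  over one coordinate.
\<close>

definition periodic_holomorphic :: "(complex3 \<Rightarrow> complex) \<Rightarrow> bool" where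
  "periodic_holomorphic \<phi> \<longleftrightarrow> continuous_on tube \<phi> \<and>
     (\<forall>i. \<forall>P\<in>tube. (\<lambda>w. \<phi> (P + dir_vec i w)) holomorphic_on slice i P \<and> \<phi> (P + dir_vec i 1) = \<phi> P)"

definition coord_mean :: "nat \<Rightarrow> (complex3 \<Rightarrow> complex) \<Rightarrow> complex3 \<Rightarrow> complex" where
  "coord_mean i \<phi> P = unit_mean (\<lambda>w. \<phi> (P + dir_vec i w)) 0"

lemma unit_mean_slice: "unit_mean (\<lambda>w. \<phi> (P + dir_vec i w)) w = coord_mean i \<phi> (P + dir_vec i w)"
  by (simp add: unit_mean_def coord_mean_def dir_vec_add add.assoc)

lemma mean_eq_integral: "coord_mean i \<phi> P = integral {0..1} (\<lambda>t. \<phi> (P + dir_vec i (of_real t)))"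
  by (simp add: unit_mean_def coord_mean_def)

lemma period_slice:
  assumes "periodic_holomorphic \<phi>" "w \<in> slice i P"
  shows "\<phi> (P + dir_vec i (w + 1)) = \<phi> (P + dir_vec i w)"
  using assms by (simp add: periodic_holomorphic_def slice_def dir_vec_add add.assoc [symmetric])

lemma holomorphic_slice:
  assumes "periodic_holomorphic \<phi>"
  shows "(\<lambda>w. \<phi> (P + dir_vec i w)) holomorphic_on slice i P"
proof (cases "slice i P = {}")
  case False
  then obtain w0 where w0: "P + dir_vec i w0 \<in> tube" by (auto simp: slice_def)
  have "(\<lambda>w. \<phi> (P + dir_vec i w0 + dir_vec i w)) holomorphic_on slice i (P + dir_vec i w0)"
    using assms w0 by (auto simp: periodic_holomorphic_def)
  then have "((\<lambda>w. \<phi> (P + dir_vec i w0 + dir_vec i w)) \<circ> (\<lambda>w. w - w0)) holomorphic_on slice i P"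
    by (rule holomorphic_on_compose_gen [rotated])
       (auto simp: slice_def add.assoc dir_vec_add [symmetric] intro!: holomorphic_intros)
  then show ?thesis by (simp add: o_def add.assoc dir_vec_add [symmetric])
qed (simp add: holomorphic_on_def)

definition const_along :: "nat \<Rightarrow> (complex3 \<Rightarrow> complex) \<Rightarrow> bool" where
  "const_along i \<phi> \<longleftrightarrow> (\<forall>P\<in>tube. \<forall>w\<in>slice i P. \<phi> (P + dir_vec i w) = \<phi> P)"

lemma mean_const_along: "periodic_holomorphic \<phi> \<Longrightarrow> const_along i (coord_mean i \<phi>)"
  unfolding const_along_def
proof (intro ballI)
  fix P w assume *: "periodic_holomorphic \<phi>" "P \<in> tube" "w \<in> slice i P"
  have "unit_mean (\<lambda>w. \<phi> (P + dir_vec i w)) w = unit_mean (\<lambda>w. \<phi> (P + dir_vec i w)) 0"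
    using * by (intro unit_mean_const [OF strip_slice holomorphic_slice] zero_in_slice period_slice)
  then show "coord_mean i \<phi> (P + dir_vec i w) = coord_mean i \<phi> P"
    by (simp add: unit_mean_slice)
qed

lemma mean_preserves_const_along:
  assumes "const_along j \<phi>"
  shows "const_along j (coord_mean i \<phi>)"
  unfolding const_along_def mean_eq_integral
proof (intro ballI integral_cong)
  fix P w and t :: real assume P: "P \<in> tube" and w: "w \<in> slice j P"
  have "P + dir_vec i (of_real t) \<in> tube" "w \<in> slice j (P + dir_vec i (of_real t))"
    using P w tube_real_translate [of "P + dir_vec j w" i t]
    by (auto simp: tube_real_translate slice_def add_ac)
  then have "\<phi> (P + dir_vec i (of_real t) + dir_vec j w) = \<phi> (P + dir_vec i (of_real t))"
    using assms by (auto simp: const_along_def)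
  then show "\<phi> (P + dir_vec j w + dir_vec i (of_real t)) = \<phi> (P + dir_vec i (of_real t))"
    by (simp add: add_ac)
qed

lemma const_along_echar:
  assumes "const_along j \<phi>" "i \<noteq> j"
  shows "const_along j (\<lambda>P. \<phi> P * echar (c * coord i P))"
  using assms by (simp add: const_along_def coord_axis_other)

lemma periodic_holomorphic_mean:
  assumes \<phi>: "periodic_holomorphic \<phi>"
  shows "periodic_holomorphic (coord_mean i \<phi>)"
  unfolding periodic_holomorphic_def
proof (intro conjI allI ballI)
  have cont: "continuous_on tube \<phi>" using \<phi> by (simp add: periodic_holomorphic_def)
  have "continuous_on (tube \<times> {0..1}) (\<lambda>p. \<phi> (fst p + dir_vec i (of_real (snd p))))"
    by (rule continuous_on_compose2 [OF cont])
       (auto intro!: continuous_intros simp: tube_real_translate)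
  then show "continuous_on tube (coord_mean i \<phi>)"
    using integral_continuous_on_param [of tube 0 1 "\<lambda>P t. \<phi> (P + dir_vec i (of_real t))"]
    by (simp add: mean_eq_integral [abs_def] case_prod_unfold)
  fix j P assume P: "P \<in> tube"
  have tr: "P + dir_vec j w + dir_vec i (of_real t) \<in> tube \<longleftrightarrow> w \<in> slice j P" for w t
    by (simp add: tube_real_translate slice_def)
  have "(\<lambda>w. integral {0..1} (\<lambda>t. \<phi> (P + dir_vec j w + dir_vec i (of_real t)))) holomorphic_on slice j P"
  proof (rule holomorphic_integral_param)
    show "open (slice j P)" using strip_slice by (auto simp: strip_def)
    show "continuous_on (slice j P \<times> {0..1}) (\<lambda>(w, t). \<phi> (P + dir_vec j w + dir_vec i (of_real t)))"
      unfolding case_prod_unfold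
      by (rule continuous_on_compose2 [OF cont]) (auto intro!: continuous_intros simp: tr)
    fix t :: real assume "t \<in> {0..1}"
    have "(\<lambda>w. \<phi> (P + dir_vec i (of_real t) + dir_vec j w)) holomorphic_on slice j (P + dir_vec i (of_real t))"
      by (rule holomorphic_slice [OF \<phi>])
    moreover have "slice j (P + dir_vec i (of_real t)) = slice j P"
      unfolding slice_def using tube_real_translate [of "P + dir_vec j w" i t for w] by (auto simp: add_ac)
    ultimately show "(\<lambda>w. \<phi> (P + dir_vec j w + dir_vec i (of_real t))) holomorphic_on slice j P"
      by (simp add: add_ac)
  qed
  then show "(\<lambda>w. coord_mean i \<phi> (P + dir_vec j w)) holomorphic_on slice j P"
    by (simp add: mean_eq_integral)
  show "coord_mean i \<phi> (P + dir_vec j 1) = coord_mean i \<phi> P"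
    unfolding mean_eq_integral
  proof (rule integral_cong)
    fix t :: real assume "t \<in> {0..1}"
    have "P + dir_vec i (of_real t) \<in> tube" using P by (simp add: tube_real_translate)
    then have "\<phi> (P + dir_vec i (of_real t) + dir_vec j 1) = \<phi> (P + dir_vec i (of_real t))"
      using \<phi> by (auto simp: periodic_holomorphic_def)
    then show "\<phi> (P + dir_vec j 1 + dir_vec i (of_real t)) = \<phi> (P + dir_vec i (of_real t))"
      by (simp add: add_ac)
  qed
qed

lemma periodic_holomorphic_echar:
  assumes \<phi>: "periodic_holomorphic \<phi>"
  shows "periodic_holomorphic (\<lambda>P. \<phi> P * echar (of_int n * coord i P))"
  unfolding periodic_holomorphic_def
proof (intro conjI allI ballI)
  show "continuous_on tube (\<lambda>P. \<phi> P * echar (of_int n * coord i P))"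
    using \<phi> by (intro continuous_intros) (auto simp: periodic_holomorphic_def)
  fix j P assume P: "P \<in> tube"
  have c: "coord i (P + dir_vec j w) = coord i P + (if i = j \<and> i < 3 then w else 0)" for w
    by (cases P) (auto simp: coord_def dir_vec_def)
  note hs = holomorphic_slice [OF \<phi>, of P j]
  show "(\<lambda>w. \<phi> (P + dir_vec j w) * echar (of_int n * coord i (P + dir_vec j w))) holomorphic_on slice j P"
  proof (cases "i = j \<and> i < 3")
    case True
    then have "coord i (P + dir_vec j w) = coord i P + w" for w using coord_axis by blast
    then show ?thesis by (simp only:) (intro holomorphic_intros hs)
  next
    case False
    then have "coord i (P + dir_vec j w) = coord i P" for w unfolding c by (simp only: if_False add_0_right)
    then show ?thesis by (simp only:) (intro holomorphic_intros hs)
  qed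
  show "\<phi> (P + dir_vec j 1) * echar (of_int n * coord i (P + dir_vec j 1)) = \<phi> P * echar (of_int n * coord i P)"
    using \<phi> P unfolding c by (auto simp: periodic_holomorphic_def distrib_left echar_add)
qed

text \<open>
  The \<open>n\<close>-th Fourier coefficient with respect to one coordinate, as a function of the others.
\<close>

definition fourier_part :: "nat \<Rightarrow> int \<Rightarrow> (complex3 \<Rightarrow> complex) \<Rightarrow> complex3 \<Rightarrow> complex" where
  "fourier_part i n \<phi> = coord_mean i (\<lambda>P. \<phi> P * echar (of_int (- n) * coord i P))"

lemma periodic_holomorphic_fourier_part:
  "periodic_holomorphic \<phi> \<Longrightarrow> periodic_holomorphic (fourier_part i n \<phi>)"
  unfolding fourier_part_def by (intro periodic_holomorphic_mean periodic_holomorphic_echar)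

lemma fourier_part_const_along:
  "periodic_holomorphic \<phi> \<Longrightarrow> const_along i (fourier_part i n \<phi>)"
  unfolding fourier_part_def by (intro mean_const_along periodic_holomorphic_echar)

lemma fourier_part_preserves_const_along:
  "const_along j \<phi> \<Longrightarrow> i \<noteq> j \<Longrightarrow> const_along j (fourier_part i n \<phi>)"
  unfolding fourier_part_def by (intro mean_preserves_const_along const_along_echar)

lemma fourier_part_has_sum:
  assumes \<phi>: "periodic_holomorphic \<phi>" and P: "P \<in> tube" and i: "i < 3"
  shows "((\<lambda>n. fourier_part i n \<phi> P * echar (of_int n * coord i P)) has_sum \<phi> P) UNIV"
proof -
  have "((\<lambda>n. unit_mean (\<lambda>w. \<phi> (P + dir_vec i w) * echar (- of_int n * w)) 0 * echar (of_int n * 0)) has_sum \<phi> (P + dir_vec i 0)) UNIV"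
    by (rule fourier_expansion_strip [OF strip_slice holomorphic_slice [OF \<phi>] period_slice [OF \<phi>] zero_in_slice [OF P]])
  moreover have "fourier_part i n \<phi> P * echar (of_int n * coord i P)
      = unit_mean (\<lambda>w. \<phi> (P + dir_vec i w) * echar (- of_int n * w)) 0" for n
  proof -
    have "\<phi> (P + dir_vec i w) * echar (of_int (- n) * coord i (P + dir_vec i w)) * echar (of_int n * coord i P)
        = \<phi> (P + dir_vec i w) * echar (- of_int n * w)" for w
      unfolding coord_axis [OF i]
      by (simp add: mult.assoc echar_add [symmetric] algebra_simps del: mult_minus_left)
    then show ?thesis
      unfolding fourier_part_def mean_eq_integral unit_mean_def
      by (simp only: integral_mult_left [symmetric] add_0)
  qed
  ultimately show ?thesis by simp
qed

lemma norm_mean_le: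
  assumes \<phi>: "continuous_on tube \<phi>" and P: "P \<in> tube"
    and B: "\<And>t. t \<in> {0..1} \<Longrightarrow> norm (\<phi> (P + dir_vec i (of_real t))) \<le> B"
  shows "norm (coord_mean i \<phi> P) \<le> B"
  unfolding coord_mean_def
proof (rule norm_unit_mean_le)
  show "continuous_on {0..1} (\<lambda>t. \<phi> (P + dir_vec i (0 + of_real t)))"
    by (rule continuous_on_compose2 [OF \<phi>])
       (use P in \<open>auto intro!: continuous_intros simp: tube_real_translate\<close>)
qed (use B in auto)

lemma norm_fourier_part_le:
  assumes \<phi>: "periodic_holomorphic \<phi>" and P: "P \<in> tube"
    and B: "\<And>t. t \<in> {0..1} \<Longrightarrow> norm (\<phi> (P + dir_vec i (of_real t))) \<le> B"
  shows "norm (fourier_part i n \<phi> P * echar (of_int n * coord i P)) \<le> B"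
proof -
  have "norm (fourier_part i n \<phi> P) \<le> B * norm (echar (of_int (- n) * coord i P))"
    unfolding fourier_part_def
  proof (rule norm_mean_le [OF _ P])
    show "continuous_on tube (\<lambda>P. \<phi> P * echar (of_int (- n) * coord i P))"
      using periodic_holomorphic_echar [OF \<phi>] by (simp only: periodic_holomorphic_def)
    fix t :: real assume t: "t \<in> {0..1}"
    have "Im (coord i (P + dir_vec i (of_real t))) = Im (coord i P)"
      by (cases P) (auto simp: coord_def dir_vec_def)
    then have "norm (echar (of_int (- n) * coord i (P + dir_vec i (of_real t)))) = norm (echar (of_int (- n) * coord i P))"
      by (simp add: norm_echar)
    then show "norm (\<phi> (P + dir_vec i (of_real t)) * echar (of_int (- n) * coord i (P + dir_vec i (of_real t))))
        \<le> B * norm (echar (of_int (- n) * coord i P))"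
      using B [OF t] by (simp only: norm_mult) (intro mult_right_mono, auto)
  qed
  then have "norm (fourier_part i n \<phi> P) * norm (echar (of_int n * coord i P))
      \<le> B * norm (echar (of_int (- n) * coord i P)) * norm (echar (of_int n * coord i P))"
    by (rule mult_right_mono) simp
  also have "\<dots> = B" by (simp add: norm_mult [symmetric] mult.assoc echar_add [symmetric])
  finally show ?thesis by (simp add: norm_mult)
qed

definition monomial :: "int \<times> int \<times> int \<Rightarrow> complex3 \<Rightarrow> complex" where
  "monomial T P = (case T of (n, r, m) \<Rightarrow> echar (of_int n * fst P + of_int r * fst (snd P) + of_int m * snd (snd P)))"

text \<open>
  Slices are connected, but the tube domain is not a product: the imaginary parts of the outer
  coordinates are first raised, so that the middle coordinate can be moved to 0.
\<close>

lemma const_along_constant: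
  assumes const: "\<And>i. const_along i \<psi>" and P: "P \<in> tube"
  shows "\<psi> P = \<psi> (\<i>, 0, \<i>)"
proof -
  have base: "(\<i>, 0, \<i>) \<in> tube" by (simp add: tube_def)
  obtain t z s where P': "P = (t, z, s)" by (cases P)
  have pos: "0 < Im t" "0 < Im s" "(Im z)\<^sup>2 < Im t * Im s" using P by (auto simp: P' tube_def)
  define M where "M = (Im z)\<^sup>2 + 1 + Im t + Im s"
  have M: "1 \<le> M" "0 < M" "Im t \<le> M" "Im s \<le> M" "(Im z)\<^sup>2 < M"
    unfolding M_def using pos by (auto simp: add_nonneg_pos intro!: add_nonneg_nonneg)
  have MM: "(Im z)\<^sup>2 < M * M" using M mult_mono [of 1 M M M] by linarith
  have step: "\<psi> Q = \<psi> (Q + dir_vec i w)" if "Q \<in> tube" "Q + dir_vec i w \<in> tube" for Q i w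
    using const [of i] that by (auto simp: const_along_def slice_def)
  have "(t + \<i> * of_real M, z, s) \<in> tube"
    using pos M by (auto simp: tube_def distrib_right intro: order_less_le_trans add_pos_pos)
  then have 1: "\<psi> (t, z, s) = \<psi> (t + \<i> * of_real M, z, s)"
    using step [of "(t, z, s)" 0 "\<i> * of_real M"] P by (simp add: P' dir_vec_def)
  have "(Im z)\<^sup>2 < (Im t + M) * (Im s + M)"
    using MM pos M by (smt (verit, ccfv_SIG) mult_mono)
  then have t2: "(t + \<i> * of_real M, z, s + \<i> * of_real M) \<in> tube"
    using pos M by (auto simp: tube_def)
  then have 2: "\<psi> (t + \<i> * of_real M, z, s) = \<psi> (t + \<i> * of_real M, z, s + \<i> * of_real M)"
    using step [of "(t + \<i> * of_real M, z, s)" 2 "\<i> * of_real M"] \<open>(t + \<i> * of_real M, z, s) \<in> tube\<close>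
    by (simp add: dir_vec_def)
  have t3: "(t + \<i> * of_real M, 0, s + \<i> * of_real M) \<in> tube"
    using pos M by (auto simp: tube_def)
  then have 3: "\<psi> (t + \<i> * of_real M, z, s + \<i> * of_real M) = \<psi> (t + \<i> * of_real M, 0, s + \<i> * of_real M)"
    using step [OF t2, of 1 "- z"] by (simp add: dir_vec_def)
  have t4: "(\<i>, 0, s + \<i> * of_real M) \<in> tube"
    using pos M by (auto simp: tube_def)
  then have 4: "\<psi> (t + \<i> * of_real M, 0, s + \<i> * of_real M) = \<psi> (\<i>, 0, s + \<i> * of_real M)"
    using step [OF t3, of 0 "\<i> - (t + \<i> * of_real M)"] by (simp add: dir_vec_def)
  have 5: "\<psi> (\<i>, 0, s + \<i> * of_real M) = \<psi> (\<i>, 0, \<i>)"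
    using step [OF t4, of 2 "\<i> - (s + \<i> * of_real M)"] base by (simp add: dir_vec_def)
  show ?thesis unfolding P' using 1 2 3 4 5 by simp
qed

text \<open>
  A bound for all terms at nearby points gives exponential decay at \<open>P\<close>: for each index the
  point is moved by \<open>\<epsilon>\<close> in the direction in which the monomial grows, and eight directions suffice.
\<close>

lemma summable_from_tube_bounds:
  assumes bound: "\<And>P T. P \<in> tube \<Longrightarrow> norm (a T * monomial T P) \<le> B P" and P: "P \<in> tube"
  shows "(\<lambda>T. a T * monomial T P) summable_on UNIV"
proof -
  obtain \<epsilon>0 where \<epsilon>0: "\<epsilon>0 > 0" "ball P \<epsilon>0 \<subseteq> tube" using open_tube P open_contains_ball by blast
  define \<epsilon> where "\<epsilon> = \<epsilon>0 / 4"
  have \<epsilon>: "\<epsilon> > 0" using \<epsilon>0 by (simp add: \<epsilon>_def)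
  define sg where "sg n = (if n < 0 then - 1 else 1 :: real)" for n :: int
  define Q where "Q u v w = P - dir_vec 0 (\<i> * of_real (\<epsilon> * u)) - dir_vec 1 (\<i> * of_real (\<epsilon> * v)) - dir_vec 2 (\<i> * of_real (\<epsilon> * w))" for u v w :: real
  have Qt: "Q u v w \<in> tube" if "\<bar>u\<bar> \<le> 1" "\<bar>v\<bar> \<le> 1" "\<bar>w\<bar> \<le> 1" for u v w
  proof -
    have "dist P (Q u v w) = norm (dir_vec 0 (\<i> * of_real (\<epsilon> * u)) + dir_vec 1 (\<i> * of_real (\<epsilon> * v)) + dir_vec 2 (\<i> * of_real (\<epsilon> * w)))"
      by (simp add: dist_norm Q_def algebra_simps)
    also have "\<dots> \<le> norm (dir_vec 0 (\<i> * of_real (\<epsilon> * u))) + norm (dir_vec 1 (\<i> * of_real (\<epsilon> * v))) + norm (dir_vec 2 (\<i> * of_real (\<epsilon> * w)))"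
      by (meson norm_triangle_ineq norm_triangle_mono order_refl)
    also have "\<dots> = \<epsilon> * \<bar>u\<bar> + \<epsilon> * \<bar>v\<bar> + \<epsilon> * \<bar>w\<bar>"
      using \<epsilon> by (simp add: dir_vec_def norm_Pair norm_mult abs_mult)
    also have "\<dots> \<le> \<epsilon> * 1 + \<epsilon> * 1 + \<epsilon> * 1"
      using that \<epsilon> by (intro add_mono mult_left_mono) auto
    also have "\<dots> < \<epsilon>0" using \<epsilon>0 by (simp add: \<epsilon>_def)
    finally have "Q u v w \<in> ball P \<epsilon>0" by simp
    then show ?thesis using \<epsilon>0 by blast
  qed
  define BB where "BB = (\<Sum>(u, v, w) \<in> {-1, 1} \<times> {-1, 1} \<times> {-1, 1}. B (Q u v w))"
  have B0: "0 \<le> B P'" if "P' \<in> tube" for P' using bound [OF that] norm_ge_zero order_trans by blast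
  have BBge: "B (Q (sg n) (sg r) (sg m)) \<le> BB" for n r m
  proof -
    have "(case (sg n, sg r, sg m) of (u, v, w) \<Rightarrow> B (Q u v w)) \<le> BB"
      unfolding BB_def by (rule member_le_sum) (auto simp: sg_def intro!: B0 Qt)
    then show ?thesis by simp
  qed
  have le: "norm (a (n, r, m) * monomial (n, r, m) P) \<le>
      BB * (exp (- (2 * pi * \<epsilon> * real_of_int \<bar>n\<bar>)) * (exp (- (2 * pi * \<epsilon> * real_of_int \<bar>r\<bar>)) * exp (- (2 * pi * \<epsilon> * real_of_int \<bar>m\<bar>))))" for n r m
  proof -
    define P' where "P' = Q (sg n) (sg r) (sg m)"
    define E where "E = exp (- (2 * pi * \<epsilon> * real_of_int \<bar>n\<bar>)) * (exp (- (2 * pi * \<epsilon> * real_of_int \<bar>r\<bar>)) * exp (- (2 * pi * \<epsilon> * real_of_int \<bar>m\<bar>)))"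
    have P't: "P' \<in> tube" unfolding P'_def by (rule Qt) (auto simp: sg_def)
    have sgn: "real_of_int n * sg n = real_of_int \<bar>n\<bar>" for n by (simp add: sg_def)
    have "norm (monomial (n, r, m) P) = norm (monomial (n, r, m) P') * E"
    proof -
      have im: "Im (fst P') = Im (fst P) - \<epsilon> * sg n" "Im (fst (snd P')) = Im (fst (snd P)) - \<epsilon> * sg r"
        "Im (snd (snd P')) = Im (snd (snd P)) - \<epsilon> * sg m"
        by (simp_all add: P'_def Q_def dir_vec_def)
      have "Im (of_int n * fst P' + of_int r * fst (snd P') + of_int m * snd (snd P'))
          = Im (of_int n * fst P + of_int r * fst (snd P) + of_int m * snd (snd P)) - \<epsilon> * (real_of_int n * sg n + real_of_int r * sg r + real_of_int m * sg m)"
        by (simp add: im algebra_simps)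
      from this [unfolded sgn] show ?thesis
        unfolding monomial_def E_def prod.case norm_echar exp_add [symmetric]
        by (simp only:) (simp add: algebra_simps)
    qed
    then have "norm (a (n, r, m) * monomial (n, r, m) P) = norm (a (n, r, m) * monomial (n, r, m) P') * E"
      by (simp add: norm_mult)
    also have "\<dots> \<le> BB * E"
      using bound [OF P't, of "(n, r, m)"] BBge [of n r m] unfolding P'_def E_def
      by (intro mult_right_mono) auto
    finally show ?thesis by (simp add: E_def)
  qed
  have e: "(\<lambda>n::int. exp (- (2 * pi * \<epsilon> * real_of_int \<bar>n\<bar>))) summable_on UNIV"
    using summable_on_exp_abs_int [of "2 * pi * \<epsilon>"] \<epsilon> by simp
  have e2: "(\<lambda>p. exp (- (2 * pi * \<epsilon> * real_of_int \<bar>fst p\<bar>)) * exp (- (2 * pi * \<epsilon> * real_of_int \<bar>snd p\<bar>))) summable_on (UNIV \<times> UNIV)"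
    using summable_on_product [OF e e exp_ge_zero exp_ge_zero] by (simp add: case_prod_unfold)
  have "(\<lambda>T. exp (- (2 * pi * \<epsilon> * real_of_int \<bar>fst T\<bar>)) * (exp (- (2 * pi * \<epsilon> * real_of_int \<bar>fst (snd T)\<bar>)) * exp (- (2 * pi * \<epsilon> * real_of_int \<bar>snd (snd T)\<bar>)))) summable_on (UNIV \<times> UNIV \<times> UNIV)"
    using summable_on_product [OF e e2 exp_ge_zero mult_nonneg_nonneg [OF exp_ge_zero exp_ge_zero]] by (simp add: case_prod_unfold)
  then have "(\<lambda>T. BB * (exp (- (2 * pi * \<epsilon> * real_of_int \<bar>fst T\<bar>)) * (exp (- (2 * pi * \<epsilon> * real_of_int \<bar>fst (snd T)\<bar>)) * exp (- (2 * pi * \<epsilon> * real_of_int \<bar>snd (snd T)\<bar>))))) summable_on UNIV"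
    by (intro summable_on_cmult_right) simp
  then have "(\<lambda>T. norm (a T * monomial T P)) summable_on UNIV"
    by (rule Infinite_Sum.abs_summable_on_comparison_test') (use le in auto)
  then show ?thesis by (rule Infinite_Sum.abs_summable_summable)
qed

text \<open>
  Taking the Fourier coefficients in the three coordinates successively leaves a function that is
  constant along all slices. The iterated sum of the three expansions is a sum over triples since the
  terms are bounded by the supremum of \<open>\<phi>\<close> over a real period cell.
\<close>

theorem fourier_expansion_tube:
  assumes \<phi>: "periodic_holomorphic \<phi>"
  obtains a where
    "\<And>P. P \<in> tube \<Longrightarrow> ((\<lambda>T. a T * monomial T P) has_sum \<phi> P) UNIV"
proof -
  define A where "A T = fourier_part 2 (snd (snd T)) (fourier_part 1 (fst (snd T)) (fourier_part 0 (fst T) \<phi>))" for T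
  define a where "a T = A T (\<i>, 0, \<i>)" for T
  have PH: "periodic_holomorphic (A T)" for T
    unfolding A_def by (intro periodic_holomorphic_fourier_part \<phi>)
  have const: "const_along i (A T)" for i T
  proof -
    consider "i = 0" | "i = 1" | "i = 2" | "i \<ge> 3" by linarith
    then show ?thesis
    proof cases
      case 4
      then have "dir_vec i w = 0" for w by (simp add: dir_vec_def zero_prod_def)
      then show ?thesis by (simp add: const_along_def)
    qed (auto simp: A_def intro!: fourier_part_const_along fourier_part_preserves_const_along periodic_holomorphic_fourier_part \<phi>)
  qed
  have A_eq: "A T P = a T" if P: "P \<in> tube" for T P
    unfolding a_def using const_along_constant [OF const P] .
  have mono_split: "monomial (n, r, m) P = echar (of_int n * coord 0 P) * echar (of_int r * coord 1 P) * echar (of_int m * coord 2 P)" for n r m P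
    by (simp add: monomial_def coord_eq echar_add)
  define K :: "(real \<times> real \<times> real) set" where "K = {0..1} \<times> {0..1} \<times> {0..1}"
  define sh where "sh P x = P + dir_vec 0 (of_real (fst x)) + dir_vec 1 (of_real (fst (snd x))) + dir_vec 2 (of_real (snd (snd x)))"
    for P and x :: "real \<times> real \<times> real"
  define B where "B P = Sup ((\<lambda>x. norm (\<phi> (sh P x))) ` K)" for P
  have bound: "norm (a T * monomial T P) \<le> B P" if P: "P \<in> tube" for T P
  proof -
    obtain n r m where T: "T = (n, r, m)" by (cases T)
    have \<phi>B: "norm (\<phi> (P + dir_vec 0 (of_real x) + dir_vec 1 (of_real y) + dir_vec 2 (of_real z))) \<le> B P"
      if "x \<in> {0..1}" "y \<in> {0..1}" "z \<in> {0..1}" for x y z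
    proof -
      have "continuous_on K (sh P)"
        unfolding sh_def by (intro continuous_intros)
      moreover have "sh P x \<in> tube" for x
        using P by (simp add: sh_def tube_real_translate)
      ultimately have "continuous_on K (\<lambda>x. \<phi> (sh P x))"
        using \<phi> continuous_on_compose2 [of tube \<phi> K "sh P"] unfolding periodic_holomorphic_def by blast
      then have "compact ((\<lambda>x. norm (\<phi> (sh P x))) ` K)"
        unfolding K_def by (intro compact_continuous_image compact_Times continuous_on_norm) auto
      then have "bdd_above ((\<lambda>x. norm (\<phi> (sh P x))) ` K)"
        by (intro bounded_imp_bdd_above compact_imp_bounded)
      from cSUP_upper [OF _ this, of "(x, y, z)"] that show ?thesis by (simp add: B_def K_def sh_def)
    qed
    have s0: "norm (fourier_part 0 n \<phi> Q * echar (of_int n * coord 0 Q)) \<le> B P"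
      if "Q = P + dir_vec 1 (of_real y) + dir_vec 2 (of_real z)" "y \<in> {0..1}" "z \<in> {0..1}" for Q y z
    proof (rule norm_fourier_part_le [OF \<phi>])
      show "Q \<in> tube" using P that by (simp add: tube_real_translate)
      fix t :: real assume "t \<in> {0..1}"
      from \<phi>B [OF this that(2,3)] show "norm (\<phi> (Q + dir_vec 0 (of_real t))) \<le> B P"
        by (simp add: that(1) add_ac)
    qed
    have s1: "norm (fourier_part 1 r (fourier_part 0 n \<phi>) Q * echar (of_int n * coord 0 Q) * echar (of_int r * coord 1 Q)) \<le> B P"
      if "Q = P + dir_vec 2 (of_real z)" "z \<in> {0..1}" for Q z
    proof -
      have Q: "Q \<in> tube" using P that by (simp add: tube_real_translate)
      define e where "e = norm (echar (of_int n * coord 0 Q))"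
      have e: "e > 0" by (simp add: e_def)
      have "norm (fourier_part 1 r (fourier_part 0 n \<phi>) Q * echar (of_int r * coord 1 Q)) \<le> B P / e"
      proof (rule norm_fourier_part_le [OF periodic_holomorphic_fourier_part [OF \<phi>] Q])
        fix t :: real assume "t \<in> {0..1}"
        then have "norm (fourier_part 0 n \<phi> (Q + dir_vec 1 (of_real t)) * echar (of_int n * coord 0 (Q + dir_vec 1 (of_real t)))) \<le> B P"
          using that by (intro s0 [of _ t z]) (simp_all add: add_ac)
        moreover have "coord 0 (Q + dir_vec 1 (of_real t)) = coord 0 Q" by (rule coord_axis_other) simp
        ultimately show "norm (fourier_part 0 n \<phi> (Q + dir_vec 1 (of_real t))) \<le> B P / e"
          using e by (simp add: norm_mult e_def pos_le_divide_eq)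
      qed
      then show ?thesis using e unfolding e_def by (simp add: norm_mult field_simps)
    qed
    have "norm (A T P * echar (of_int n * coord 0 P) * echar (of_int r * coord 1 P) * echar (of_int m * coord 2 P)) \<le> B P"
    proof -
      define e where "e = norm (echar (of_int n * coord 0 P)) * norm (echar (of_int r * coord 1 P))"
      have e: "e > 0" by (simp add: e_def)
      have "norm (A T P * echar (of_int m * coord 2 P)) \<le> B P / e"
        unfolding A_def T fst_conv snd_conv
      proof (rule norm_fourier_part_le [OF periodic_holomorphic_fourier_part [OF periodic_holomorphic_fourier_part [OF \<phi>]] P])
        fix t :: real assume "t \<in> {0..1}"
        then have "norm (fourier_part 1 r (fourier_part 0 n \<phi>) (P + dir_vec 2 (of_real t)) *
            echar (of_int n * coord 0 (P + dir_vec 2 (of_real t))) * echar (of_int r * coord 1 (P + dir_vec 2 (of_real t)))) \<le> B P"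
          by (rule s1 [OF refl])
        moreover have "coord 0 (P + dir_vec 2 (of_real t)) = coord 0 P" "coord 1 (P + dir_vec 2 (of_real t)) = coord 1 P"
          by (rule coord_axis_other, simp)+
        ultimately show "norm (fourier_part 1 r (fourier_part 0 n \<phi>) (P + dir_vec 2 (of_real t))) \<le> B P / e"
          using e by (simp add: norm_mult e_def pos_le_divide_eq mult.assoc)
      qed
      then show ?thesis using e unfolding e_def by (simp add: norm_mult field_simps)
    qed
    then show ?thesis unfolding T mono_split using A_eq [OF P, of T] by (simp add: T mult.assoc)
  qed
  have abs: "(\<lambda>T. a T * monomial T P) summable_on UNIV" if P: "P \<in> tube" for P
    using bound P by (rule summable_from_tube_bounds)
  have "((\<lambda>T. a T * monomial T P) has_sum \<phi> P) UNIV" if P: "P \<in> tube" for P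
  proof -
    define e where "e i n = echar (of_int n * coord i P)" for i and n :: int
    define a1 where "a1 n = fourier_part 0 n \<phi>" for n
    define a2 where "a2 n r = fourier_part 1 r (a1 n)" for n r
    have PH1: "periodic_holomorphic (a1 n)" for n
      unfolding a1_def by (rule periodic_holomorphic_fourier_part [OF \<phi>])
    have PH2: "periodic_holomorphic (a2 n r)" for n r
      unfolding a2_def by (rule periodic_holomorphic_fourier_part [OF PH1])
    have 3: "((\<lambda>m. a (n, r, m) * monomial (n, r, m) P) has_sum a2 n r P * e 1 r * e 0 n) UNIV" for n r
    proof -
      have "((\<lambda>m. fourier_part 2 m (a2 n r) P * e 2 m * (e 1 r * e 0 n)) has_sum a2 n r P * (e 1 r * e 0 n)) UNIV"
        unfolding e_def by (intro has_sum_cmult_left fourier_part_has_sum [OF PH2 P]) auto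
      moreover have "fourier_part 2 m (a2 n r) P = a (n, r, m)" for m
        using A_eq [OF P, of "(n, r, m)"] by (simp add: A_def a2_def a1_def)
      ultimately show ?thesis unfolding mono_split e_def by (simp add: mult_ac)
    qed
    have 2: "((\<lambda>r. a2 n r P * e 1 r * e 0 n) has_sum a1 n P * e 0 n) UNIV" for n
      unfolding a2_def e_def by (intro has_sum_cmult_left fourier_part_has_sum [OF PH1 P]) auto
    have 1: "((\<lambda>n. a1 n P * e 0 n) has_sum \<phi> P) UNIV"
      unfolding a1_def e_def by (intro fourier_part_has_sum [OF \<phi> P]) auto
    define S where "S = (\<lambda>T. a T * monomial T P)"
    have S: "S summable_on UNIV" unfolding S_def by (rule abs [OF P])
    have S2: "(\<lambda>p. S (n, p)) summable_on UNIV" for n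
    proof -
      have "S summable_on (Pair n ` UNIV)" by (rule summable_on_subset_banach [OF S]) auto
      then show ?thesis by (subst (asm) summable_on_reindex) (auto simp: o_def inj_on_def)
    qed
    have "((\<lambda>p. S (n, p)) has_sum a1 n P * e 0 n) (Sigma UNIV (\<lambda>_. UNIV))" for n
      by (rule has_sum_SigmaI [where g = "\<lambda>r. a2 n r P * e 1 r * e 0 n"])
         (use 3 2 S2 in \<open>auto simp: S_def\<close>)
    then have "(S has_sum \<phi> P) (Sigma UNIV (\<lambda>_. UNIV))"
      by (intro has_sum_SigmaI [where g = "\<lambda>n. a1 n P * e 0 n"]) (use 1 S in auto)
    then show ?thesis by (simp add: S_def)
  qed
  with that show thesis by blast
qed

section \<open>Uniqueness of Fourier expansions and the Koecher principle\<close>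

text \<open>
  Partial sums converge uniformly to 0, so integrating them against one exponential makes the
  corresponding coefficient arbitrarily small.
\<close>

lemma trigonometric_series_unique_1:
  fixes c :: "int \<Rightarrow> complex"
  assumes sums: "\<And>x::real. ((\<lambda>n. c n * echar (of_int n * of_real x)) has_sum 0) UNIV"
  shows "c n0 = 0"
proof (rule ccontr)
  assume nz: "c n0 \<noteq> 0"
  define \<epsilon> where "\<epsilon> = norm (c n0) / 2"
  have \<epsilon>: "\<epsilon> > 0" "\<epsilon> < norm (c n0)" using nz by (auto simp: \<epsilon>_def)
  have "(\<lambda>n. c n) summable_on UNIV"
    using sums [of 0] by (auto simp: summable_on_def)
  then have abs: "(\<lambda>n. norm (c n)) summable_on UNIV"
    by (simp add: summable_on_iff_abs_summable_on_complex)
  have "uniform_limit UNIV (\<lambda>A x. \<Sum>n\<in>A. c n * echar (of_int n * of_real x)) (\<lambda>x::real. 0) (finite_subsets_at_top UNIV)"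
    by (rule Weierstrass_m_test_general' [OF _ sums abs]) (simp add: norm_mult norm_echar)
  then have "\<forall>\<^sub>F A in finite_subsets_at_top UNIV. \<forall>x::real\<in>UNIV. dist (\<Sum>n\<in>A. c n * echar (of_int n * of_real x)) 0 < \<epsilon>"
    using \<epsilon>(1) by (rule uniform_limitD)
  moreover have "\<forall>\<^sub>F A in finite_subsets_at_top (UNIV :: int set). finite A \<and> n0 \<in> A"
    unfolding eventually_finite_subsets_at_top by (rule exI [of _ "{n0}"]) auto
  ultimately have ev: "\<forall>\<^sub>F A in finite_subsets_at_top (UNIV :: int set). finite A \<and> n0 \<in> A \<and>
      (\<forall>x::real. norm (\<Sum>n\<in>A. c n * echar (of_int n * of_real x)) < \<epsilon>)"
    by eventually_elim auto
  obtain A where A: "finite A" "n0 \<in> A"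
    and small: "\<And>x::real. norm (\<Sum>n\<in>A. c n * echar (of_int n * of_real x)) < \<epsilon>"
    using eventually_happens [OF ev] by auto
  have "((\<lambda>t. c n * echar (of_int (n - n0) * of_real t)) has_integral (if n = n0 then c n0 else 0)) {0..1}" for n
  proof -
    have "(\<lambda>t. echar (of_int (n - n0) * of_real t)) integrable_on {0..1::real}"
      by (intro integrable_continuous_interval continuous_intros)
    then have "((\<lambda>t. echar (of_int (n - n0) * of_real t)) has_integral (if n = n0 then 1 else 0)) {0..1::real}"
      using unit_mean_echar [of "n - n0"] by (simp add: unit_mean_def has_integral_iff)
    from has_integral_mult_right [OF this, of "c n"] show ?thesis by (cases "n = n0") auto
  qed
  then have "((\<lambda>t. \<Sum>n\<in>A. c n * echar (of_int (n - n0) * of_real t)) has_integral (\<Sum>n\<in>A. if n = n0 then c n0 else 0)) {0..1::real}"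
    by (intro has_integral_sum A)
  moreover have "(\<Sum>n\<in>A. if n = n0 then c n0 else 0) = c n0" using A by (simp add: sum.delta)
  moreover have "norm (\<Sum>n\<in>A. c n * echar (of_int (n - n0) * of_real t)) \<le> \<epsilon>" for t :: real
  proof -
    have "(\<Sum>n\<in>A. c n * echar (of_int (n - n0) * of_real t)) = (\<Sum>n\<in>A. c n * echar (of_int n * of_real t)) * echar (- of_int n0 * of_real t)"
      unfolding sum_distrib_right
      by (intro sum.cong refl) (simp add: mult.assoc echar_add [symmetric] algebra_simps)
    then show ?thesis using small [of t] by (simp add: norm_mult norm_echar)
  qed
  moreover have "continuous_on {0..1} (\<lambda>t::real. \<Sum>n\<in>A. c n * echar (of_int (n - n0) * of_real t))"
    by (intro continuous_intros)
  ultimately have "norm (c n0) \<le> \<epsilon> * (1 - 0)"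
    using integral_bound [of 0 1 "\<lambda>t. \<Sum>n\<in>A. c n * echar (of_int (n - n0) * of_real t)" \<epsilon>]
    by (simp add: integral_unique)
  with \<epsilon> show False by simp
qed

lemma summable_on_pair_slice:
  fixes f :: "'a \<times> 'b \<Rightarrow> complex"
  assumes "f summable_on UNIV"
  shows "(\<lambda>y. f (x, y)) summable_on UNIV"
proof -
  have "f summable_on (Pair x ` UNIV)" by (rule summable_on_subset_banach [OF assms]) auto
  then show ?thesis by (subst (asm) summable_on_reindex) (auto simp: o_def inj_on_def)
qed

lemma fourier_coefficients_zero:
  assumes sums: "\<And>P. P \<in> tube \<Longrightarrow> ((\<lambda>T. c T * monomial T P) has_sum 0) UNIV"
  shows "c T = 0"
proof -
  define d where "d T = c T * monomial T (\<i>, 0, \<i>)" for T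
  have s: "((\<lambda>T. d T * (echar (of_int (fst T) * of_real x) * echar (of_int (fst (snd T)) * of_real y) * echar (of_int (snd (snd T)) * of_real z))) has_sum 0) UNIV"
    for x y z :: real
  proof -
    have "(\<i> + of_real x, of_real y, \<i> + of_real z) \<in> tube" by (simp add: tube_def)
    from sums [OF this] show ?thesis
      by (rule has_sum_cong [THEN iffD1, rotated])
         (auto simp: d_def monomial_def mult.assoc echar_add [symmetric] algebra_simps)
  qed
  have summ: "(\<lambda>T. d T * (echar (of_int (fst T) * of_real x) * echar (of_int (fst (snd T)) * of_real y) * echar (of_int (snd (snd T)) * of_real z))) summable_on UNIV"
    for x y z :: real
    using s summable_on_def by blast
  define e where "e n x = echar (of_int n * of_real x)" for n :: int and x :: real
  have 1: "((\<lambda>p. d (n, p) * (e (fst p) y * e (snd p) z)) has_sum 0) UNIV" for n y z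
  proof -
    have sm: "(\<lambda>p. d (n, p) * (e (fst p) y * e (snd p) z)) summable_on UNIV" for n
      using summable_on_pair_slice [OF summ [of 0 y z], of n] by (simp add: e_def mult.assoc)
    define g where "g n = (\<Sum>\<^sub>\<infinity>p. d (n, p) * (e (fst p) y * e (snd p) z))" for n
    have "((\<lambda>n. g n * e n x) has_sum 0) UNIV" for x
    proof (rule has_sum_SigmaD [where B = "\<lambda>_. UNIV" and f = "\<lambda>T. d T * (e (fst T) x * e (fst (snd T)) y * e (snd (snd T)) z)"])
      show "((\<lambda>T. d T * (e (fst T) x * e (fst (snd T)) y * e (snd (snd T)) z)) has_sum 0) (UNIV \<times> UNIV)"
        using s [of x y z] by (simp add: e_def)
      show "((\<lambda>p. d (n, p) * (e (fst (n, p)) x * e (fst (snd (n, p))) y * e (snd (snd (n, p))) z)) has_sum g n * e n x) UNIV" for n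
        using has_sum_cmult_left [OF has_sum_infsum [OF sm], of n "e n x"] by (simp add: g_def mult_ac)
    qed
    then have "g n = 0" by (intro trigonometric_series_unique_1) (simp add: e_def)
    then show ?thesis using has_sum_infsum [OF sm, of n] by (simp add: g_def)
  qed
  have 2: "((\<lambda>m. d (n, r, m) * e m z) has_sum 0) UNIV" for n r z
  proof -
    have sm: "(\<lambda>m. d (n, r, m) * e m z) summable_on UNIV" for r
      using summable_on_pair_slice [of "\<lambda>p. d (n, p) * (e (fst p) 0 * e (snd p) z)" r] 1 [of n 0 z] 
      by (auto simp: e_def summable_on_def)
    define g where "g r = (\<Sum>\<^sub>\<infinity>m. d (n, r, m) * e m z)" for r
    have "((\<lambda>r. g r * e r y) has_sum 0) UNIV" for y
    proof (rule has_sum_SigmaD [where B = "\<lambda>_. UNIV" and f = "\<lambda>p. d (n, p) * (e (fst p) y * e (snd p) z)"])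
      show "((\<lambda>p. d (n, p) * (e (fst p) y * e (snd p) z)) has_sum 0) (UNIV \<times> UNIV)"
        using 1 [of n y z] by simp
      show "((\<lambda>m. d (n, r, m) * (e (fst (r, m)) y * e (snd (r, m)) z)) has_sum g r * e r y) UNIV" for r
        using has_sum_cmult_left [OF has_sum_infsum [OF sm], of r "e r y"] by (simp add: g_def mult_ac)
    qed
    then have "g r = 0" by (intro trigonometric_series_unique_1) (simp add: e_def)
    then show ?thesis using has_sum_infsum [OF sm, of r] by (simp add: g_def)
  qed
  obtain n r m where T: "T = (n, r, m)" by (cases T)
  have "d (n, r, m) = 0"
    using trigonometric_series_unique_1 [of "\<lambda>m. d (n, r, m)"] 2 by (simp add: e_def)
  then show ?thesis unfolding T d_def by (simp add: monomial_def)
qed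

lemma has_sum_diff:
  fixes f g :: "'a \<Rightarrow> complex"
  assumes "(f has_sum a) A" "(g has_sum b) A"
  shows "((\<lambda>x. f x - g x) has_sum (a - b)) A"
  using has_sum_add [OF assms(1), of "\<lambda>x. - g x" "- b"] assms(2) by (simp add: has_sum_uminus)

corollary fourier_coefficients_unique:
  assumes "\<And>P. P \<in> tube \<Longrightarrow> ((\<lambda>T. a T * monomial T P) has_sum \<phi> P) UNIV"
    and "\<And>P. P \<in> tube \<Longrightarrow> ((\<lambda>T. b T * monomial T P) has_sum \<phi> P) UNIV"
  shows "a = b"
proof
  fix T
  have "((\<lambda>T. (a T - b T) * monomial T P) has_sum 0) UNIV" if "P \<in> tube" for P
    using has_sum_diff [OF assms(1,2) [OF that]] by (simp add: left_diff_distrib)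
  then have "a T - b T = 0" by (rule fourier_coefficients_zero)
  then show "a T = b T" by simp
qed

text \<open>
  The action \<open>Z \<mapsto> U Z U\<^sup>t\<close> of the matrix \<open>U\<close> with rows \<open>(p, q)\<close> and \<open>(u, v)\<close> on symmetric matrices.
\<close>

definition sl2_act :: "int \<Rightarrow> int \<Rightarrow> int \<Rightarrow> int \<Rightarrow> complex3 \<Rightarrow> complex3" where
  "sl2_act p q u v P = (case P of (t, z, s) \<Rightarrow>
     (of_int (p\<^sup>2) * t + of_int (2 * p * q) * z + of_int (q\<^sup>2) * s,
      of_int (p * u) * t + of_int (p * v + q * u) * z + of_int (q * v) * s,
      of_int (u\<^sup>2) * t + of_int (2 * u * v) * z + of_int (v\<^sup>2) * s))"

text \<open>
  The dual action \<open>T \<mapsto> U\<^sup>t T U\<close>, where \<open>(n, r, m)\<close> stands for the symmetric matrix with diagonal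
  \<open>n, m\<close> and off-diagonal entry \<open>r / 2\<close>.
\<close>

definition sl2_dual :: "int \<Rightarrow> int \<Rightarrow> int \<Rightarrow> int \<Rightarrow> int \<times> int \<times> int \<Rightarrow> int \<times> int \<times> int" where
  "sl2_dual p q u v T = (case T of (n, r, m) \<Rightarrow>
     (n * p\<^sup>2 + r * p * u + m * u\<^sup>2, 2 * n * p * q + r * (p * v + q * u) + 2 * m * u * v,
      n * q\<^sup>2 + r * q * v + m * v\<^sup>2))"

definition sl2_invariant :: "(complex3 \<Rightarrow> complex) \<Rightarrow> bool" where
  "sl2_invariant \<phi> \<longleftrightarrow> (\<forall>p q u v. p * v - q * u = 1 \<longrightarrow> (\<forall>P\<in>tube. \<phi> (sl2_act p q u v P) = \<phi> P))"

lemma sl2_act_tube: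
  assumes "p * v - q * u = 1" and P: "P \<in> tube"
  shows "sl2_act p q u v P \<in> tube"
proof -
  obtain t z s where P': "P = (t, z, s)" by (cases P)
  have q: "0 < x\<^sup>2 * Im t + 2 * x * y * Im z + y\<^sup>2 * Im s" if "(x, y) \<noteq> (0, 0)" for x y
    using P that unfolding P' tube_iff_quadratic_form by blast
  define p' q' u' v' where "p' = real_of_int p" "q' = real_of_int q" "u' = real_of_int u" "v' = real_of_int v"
  have det: "p' * v' - q' * u' = 1"
    using arg_cong [OF assms(1), of real_of_int] by (simp add: p'_q'_u'_v'_def)
  have "0 < x\<^sup>2 * Im (of_int (p\<^sup>2) * t + of_int (2 * p * q) * z + of_int (q\<^sup>2) * s)
      + 2 * x * y * Im (of_int (p * u) * t + of_int (p * v + q * u) * z + of_int (q * v) * s)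
      + y\<^sup>2 * Im (of_int (u\<^sup>2) * t + of_int (2 * u * v) * z + of_int (v\<^sup>2) * s)"
    if nz: "(x, y) \<noteq> (0, 0)" for x y
  proof -
    have "(x * p' + y * u', x * q' + y * v') \<noteq> (0, 0)"
    proof
      assume "(x * p' + y * u', x * q' + y * v') = (0, 0)"
      then have eq: "x * p' + y * u' = 0" "x * q' + y * v' = 0" by auto
      have "x = x * (p' * v' - q' * u')" using det by simp
      also have "\<dots> = v' * (x * p' + y * u') - u' * (x * q' + y * v')" by (simp add: algebra_simps)
      finally have "x = 0" using eq by simp
      have "y = y * (p' * v' - q' * u')" using det by simp
      also have "\<dots> = p' * (x * q' + y * v') - q' * (x * p' + y * u')" by (simp add: algebra_simps)
      finally have "y = 0" using eq by simp
      with \<open>x = 0\<close> nz show False by simp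
    qed
    from q [OF this] show ?thesis
      by (simp add: p'_q'_u'_v'_def power2_eq_square algebra_simps)
  qed
  then show ?thesis unfolding P' sl2_act_def prod.case tube_iff_quadratic_form by blast
qed

lemma monomial_sl2_act: "monomial T (sl2_act p q u v P) = monomial (sl2_dual p q u v T) P"
  by (cases T; cases P) (simp add: monomial_def sl2_act_def sl2_dual_def power2_eq_square algebra_simps)

lemma sl2_dual_inverse:
  assumes "p * v - q * u = 1"
  shows "sl2_dual v (- q) (- u) p (sl2_dual p q u v T) = T"
proof -
  obtain n r m where T: "T = (n, r, m)" by (cases T)
  have d: "p * v - q * u = 1" by fact
  have 1: "(n * p\<^sup>2 + r * p * u + m * u\<^sup>2) * v\<^sup>2 + (2 * n * p * q + r * (p * v + q * u) + 2 * m * u * v) * v * (- u)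
      + (n * q\<^sup>2 + r * q * v + m * v\<^sup>2) * (- u)\<^sup>2 = n * (p * v - q * u)\<^sup>2"
    by (simp add: power2_eq_square algebra_simps)
  have 2: "2 * (n * p\<^sup>2 + r * p * u + m * u\<^sup>2) * v * (- q) + (2 * n * p * q + r * (p * v + q * u) + 2 * m * u * v) * (v * p + (- q) * (- u))
      + 2 * (n * q\<^sup>2 + r * q * v + m * v\<^sup>2) * (- u) * p = r * (p * v - q * u)\<^sup>2"
    by (simp add: power2_eq_square algebra_simps)
  have 3: "(n * p\<^sup>2 + r * p * u + m * u\<^sup>2) * (- q)\<^sup>2 + (2 * n * p * q + r * (p * v + q * u) + 2 * m * u * v) * (- q) * p
      + (n * q\<^sup>2 + r * q * v + m * v\<^sup>2) * p\<^sup>2 = m * (p * v - q * u)\<^sup>2"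
    by (simp add: power2_eq_square algebra_simps)
  show ?thesis unfolding T sl2_dual_def prod.case 1 2 3 d by simp
qed

lemma fourier_coefficients_sl2_invariant:
  assumes inv: "sl2_invariant \<phi>" and det: "p * v - q * u = 1"
    and a: "\<And>P. P \<in> tube \<Longrightarrow> ((\<lambda>T. a T * monomial T P) has_sum \<phi> P) UNIV"
  shows "a (sl2_dual p q u v T) = a T"
proof -
  define \<sigma> \<tau> where "\<sigma> = sl2_dual p q u v" and "\<tau> = sl2_dual v (- q) (- u) p"
  have det': "v * p - (- q) * (- u) = 1" using det by (simp add: algebra_simps)
  have \<sigma>\<tau>: "\<tau> (\<sigma> T) = T" "\<sigma> (\<tau> T) = T" for T
    using sl2_dual_inverse [OF det] sl2_dual_inverse [OF det'] by (simp_all add: \<sigma>_def \<tau>_def)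
  have "((\<lambda>S. a (\<tau> S) * monomial S P) has_sum \<phi> P) UNIV" if P: "P \<in> tube" for P
  proof -
    have "\<phi> (sl2_act p q u v P) = \<phi> P" using inv det P by (auto simp: sl2_invariant_def)
    then have "((\<lambda>T. a T * monomial (\<sigma> T) P) has_sum \<phi> P) UNIV"
      using a [OF sl2_act_tube [OF det P]] by (simp add: monomial_sl2_act \<sigma>_def)
    then have "((\<lambda>T. a (\<tau> (\<sigma> T)) * monomial (\<sigma> T) P) has_sum \<phi> P) UNIV"
      by (simp add: \<sigma>\<tau>)
    moreover have "bij_betw \<sigma> UNIV UNIV"
      by (rule bij_betwI [where g = \<tau>]) (auto simp: \<sigma>\<tau>)
    ultimately show ?thesis
      using has_sum_reindex_bij_betw [of \<sigma> UNIV UNIV "\<lambda>S. a (\<tau> S) * monomial S P" "\<phi> P"] by simp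
  qed
  then have "(\<lambda>S. a (\<tau> S)) = a"
    by (intro fourier_coefficients_unique [OF _ a])
  then have "a (\<tau> (\<sigma> T)) = a (\<sigma> T)" by (rule fun_cong)
  then show ?thesis by (simp add: \<sigma>\<tau>) (simp add: \<sigma>_def)
qed

definition psd_index :: "int \<times> int \<times> int \<Rightarrow> bool" where
  "psd_index T = (case T of (n, r, m) \<Rightarrow> 0 \<le> n \<and> 0 \<le> m \<and> r\<^sup>2 \<le> 4 * n * m)"

lemma not_psd_index_witness:
  assumes "\<not> psd_index (n, r, m)"
  obtains x y :: int where "n * x\<^sup>2 + r * x * y + m * y\<^sup>2 < 0"
proof -
  consider "n < 0" | "m < 0" | "0 < n" "4 * n * m < r\<^sup>2" | "n = 0" "m \<ge> 0" "0 < r\<^sup>2"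
    using assms by (force simp: psd_index_def)
  then show thesis
  proof cases
    case 1
    then show ?thesis using that [of 1 0] by simp
  next
    case 2
    then show ?thesis using that [of 0 1] by simp
  next
    case 3
    \<comment> \<open>for fixed \<open>y = 2n\<close> the form takes its minimum at \<open>x = -r\<close>\<close>
    have "n * (- r)\<^sup>2 + r * (- r) * (2 * n) + m * (2 * n)\<^sup>2 = n * (4 * n * m - r\<^sup>2)"
      by (simp add: power2_eq_square algebra_simps)
    also have "\<dots> < 0" using 3 by (simp add: mult_pos_neg)
    finally show ?thesis by (rule that)
  next
    case 4
    then have "r \<noteq> 0" by auto
    \<comment> \<open>for \<open>n = 0\<close> the form is linear in \<open>x\<close>, and \<open>|x| = m + 1\<close> outweighs \<open>m y\<^sup>2\<close> at \<open>y = 1\<close>\<close>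
    have "n * (- sgn r * (m + 1))\<^sup>2 + r * (- sgn r * (m + 1)) * 1 + m * 1\<^sup>2 = - (\<bar>r\<bar> * (m + 1)) + m"
      using 4 by (simp add: abs_sgn algebra_simps)
    also have "\<dots> \<le> - (1 * (m + 1)) + m"
      using 4 \<open>r \<noteq> 0\<close> by (intro add_right_mono le_imp_neg_le mult_right_mono) auto
    also have "\<dots> < 0" by simp
    finally show ?thesis by (rule that)
  qed
qed

text \<open>
  If \<open>T[v] < 0\<close> for the integer vector \<open>v = (x, y)\<close>, put \<open>w = (-y, x)\<close>. The unipotent matrices
  \<open>U\<^sub>j = 1 + j v w\<^sup>t\<close> transform \<open>T\<close> into indices with the same coefficient and with trace
  \<open>tr T + j \<beta> + j\<^sup>2 \<gamma>\<close>, where \<open>\<gamma> = T[v] |v|\<^sup>2 < 0\<close>. At the point \<open>diag(i, i)\<close> the corresponding terms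
  grow without bound, which a convergent series excludes.
\<close>

theorem koecher_principle:
  assumes inv: "sl2_invariant \<phi>"
    and a: "\<And>P. P \<in> tube \<Longrightarrow> ((\<lambda>T. a T * monomial T P) has_sum \<phi> P) UNIV"
    and T: "\<not> psd_index T"
  shows "a T = 0"
proof (rule ccontr)
  assume nz: "a T \<noteq> 0"
  obtain n r m where T': "T = (n, r, m)" by (cases T)
  obtain x y where neg: "n * x\<^sup>2 + r * x * y + m * y\<^sup>2 < 0"
    using T not_psd_index_witness unfolding T' by blast
  define P :: complex3 where "P = (\<i>, 0, \<i>)"
  have P: "P \<in> tube" by (simp add: P_def tube_def)
  define \<gamma> where "\<gamma> = (n * x\<^sup>2 + r * x * y + m * y\<^sup>2) * (x\<^sup>2 + y\<^sup>2)"
  define \<beta> where "\<beta> = 2 * x * y * (m - n) + r * (x\<^sup>2 - y\<^sup>2)"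
  have "x \<noteq> 0 \<or> y \<noteq> 0" using neg by auto
  then have "x\<^sup>2 + y\<^sup>2 > 0" by (simp add: sum_power2_gt_zero_iff)
  then have \<gamma>: "\<gamma> < 0" using neg by (simp add: \<gamma>_def mult_neg_pos)
  define Tj where "Tj j = sl2_dual (1 - j * x * y) (j * x\<^sup>2) (- (j * y\<^sup>2)) (1 + j * x * y) T" for j
  have aTj: "a (Tj j) = a T" for j
    unfolding Tj_def
    by (rule fourier_coefficients_sl2_invariant [OF inv _ a]) (simp_all add: power2_eq_square algebra_simps)
  have tr: "fst (Tj j) + snd (snd (Tj j)) = n + m + j * \<beta> + j\<^sup>2 * \<gamma>" for j
    unfolding Tj_def T' sl2_dual_def prod.case fst_conv snd_conv \<beta>_def \<gamma>_def
    by (simp add: power2_eq_square algebra_simps)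
  have "(\<lambda>T. norm (a T * monomial T P)) summable_on UNIV"
    using a [OF P] by (simp add: summable_on_iff_abs_summable_on_complex [symmetric] summable_on_def) blast
  then obtain M where M: "\<And>S. norm (a S * monomial S P) \<le> M"
  proof -
    assume s: "(\<lambda>T. norm (a T * monomial T P)) summable_on UNIV" and th: "\<And>M. (\<And>S. norm (a S * monomial S P) \<le> M) \<Longrightarrow> thesis"
    have "norm (a S * monomial S P) \<le> infsum (\<lambda>T. norm (a T * monomial T P)) UNIV" for S
      using finite_sum_le_infsum [OF s, of "{S}"] by simp
    then show thesis by (rule th)
  qed
  have nm: "norm (monomial S P) = exp (- (2 * pi * real_of_int (fst S + snd (snd S))))" for S
    by (cases S) (simp add: monomial_def P_def norm_echar)
  have big: "norm (a T) * (1 - 2 * pi * real_of_int (n + m + j * \<beta> + j\<^sup>2 * \<gamma>)) \<le> M" for j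
  proof -
    have "norm (a T) * (1 - 2 * pi * real_of_int (n + m + j * \<beta> + j\<^sup>2 * \<gamma>)) \<le>
        norm (a T) * exp (- (2 * pi * real_of_int (n + m + j * \<beta> + j\<^sup>2 * \<gamma>)))"
      using exp_ge_add_one_self [of "- (2 * pi * real_of_int (n + m + j * \<beta> + j\<^sup>2 * \<gamma>))"]
      by (intro mult_left_mono) (auto simp: algebra_simps)
    also have "\<dots> \<le> M"
      using M [of "Tj j"] unfolding norm_mult aTj nm tr .
    finally show ?thesis .
  qed
  define L where "L = M / norm (a T) + 2 * pi * \<bar>real_of_int (n + m)\<bar>"
  \<comment> \<open>beyond \<open>|\<beta>|\<close> the quadratic term wins by at least \<open>j\<close>, and \<open>j > |L|\<close> exceeds the bound\<close>
  define j :: int where "j = \<bar>\<beta>\<bar> + 1 + \<lceil>\<bar>L\<bar>\<rceil>"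
  have j: "j \<ge> 1 + \<bar>\<beta>\<bar>" "real_of_int j > \<bar>L\<bar>"
    by (auto simp: j_def) (smt (verit) le_of_int_ceiling of_int_abs of_int_nonneg abs_ge_zero)
  have "j * \<beta> + j\<^sup>2 * \<gamma> \<le> j * \<bar>\<beta>\<bar> + j\<^sup>2 * (- 1)"
    using j \<gamma> by (intro add_mono mult_left_mono) auto
  also have "\<dots> = j * (\<bar>\<beta>\<bar> - j)" by (simp add: power2_eq_square algebra_simps)
  also have "\<dots> \<le> j * (- 1)" using j by (intro mult_left_mono) auto
  finally have "real_of_int (j * \<beta> + j\<^sup>2 * \<gamma>) \<le> - real_of_int j" by linarith
  then have "real_of_int (j * \<beta> + j\<^sup>2 * \<gamma>) \<le> - \<bar>L\<bar>" using j by linarith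
  then have "2 * pi * real_of_int (j * \<beta> + j\<^sup>2 * \<gamma>) \<le> 2 * pi * (- \<bar>L\<bar>)"
    by (intro mult_left_mono) auto
  also have "\<dots> \<le> 1 * (- \<bar>L\<bar>)"
    using pi_gt3 by (intro mult_right_mono_neg) auto
  finally have 1: "2 * pi * real_of_int (j * \<beta> + j\<^sup>2 * \<gamma>) \<le> - L" by linarith
  have 2: "2 * pi * real_of_int (n + m) \<le> 2 * pi * \<bar>real_of_int (n + m)\<bar>"
    by (intro mult_left_mono) auto
  have "2 * pi * real_of_int (n + m + j * \<beta> + j\<^sup>2 * \<gamma>) = 2 * pi * real_of_int (n + m) + 2 * pi * real_of_int (j * \<beta> + j\<^sup>2 * \<gamma>)"
    by (simp add: algebra_simps)
  then have "M / norm (a T) < 1 - 2 * pi * real_of_int (n + m + j * \<beta> + j\<^sup>2 * \<gamma>)"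
    using 1 2 unfolding L_def by linarith
  then have "M < norm (a T) * (1 - 2 * pi * real_of_int (n + m + j * \<beta> + j\<^sup>2 * \<gamma>))"
    using nz by (simp add: pos_divide_less_eq mult.commute)
  with big [of j] show False by simp
qed

text \<open>
  A nonzero semi-definite index has trace at least 1, so its term shrinks at least by the factor
  \<open>e\<^sup>-\<^sup>2\<^sup>\<pi>\<^sup>(\<^sup>u\<^sup>-\<^sup>1\<^sup>)\<close> when the point moves from \<open>diag(i, i)\<close> to \<open>diag(it, is)\<close>.
\<close>

lemma constant_coefficient_limit:
  assumes a: "\<And>P. P \<in> tube \<Longrightarrow> ((\<lambda>T. a T * monomial T P) has_sum \<phi> P) UNIV"
    and psd: "\<And>T. \<not> psd_index T \<Longrightarrow> a T = 0"
  obtains C where "\<And>u t s. 1 \<le> u \<Longrightarrow> u \<le> t \<Longrightarrow> u \<le> s \<Longrightarrow>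
    norm (\<phi> (\<i> * of_real t, 0, \<i> * of_real s) - a (0, 0, 0)) \<le> C * exp (- (2 * pi * (u - 1)))"
proof -
  define P :: complex3 where "P = (\<i>, 0, \<i>)"
  have P: "P \<in> tube" by (simp add: P_def tube_def)
  have abs: "(\<lambda>T. norm (a T * monomial T P)) summable_on UNIV"
    using a [OF P] by (simp add: summable_on_iff_abs_summable_on_complex [symmetric] summable_on_def) blast
  show thesis
  proof (rule that [of "infsum (\<lambda>T. norm (a T * monomial T P)) UNIV"])
    fix u t s :: real assume u: "1 \<le> u" and t: "u \<le> t" and s: "u \<le> s"
    define Q :: complex3 where "Q = (\<i> * of_real t, 0, \<i> * of_real s)"
    have Q: "Q \<in> tube" using u t s by (simp add: Q_def tube_def)
    have "((\<lambda>T. if T = (0, 0, 0) then a (0, 0, 0) else 0) has_sum a (0, 0, 0)) UNIV"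
      by (rule has_sum_finite_neutralI [of "{(0, 0, 0)}"]) auto
    from has_sum_diff [OF a [OF Q] this]
    have h: "((\<lambda>T. a T * monomial T Q - (if T = (0, 0, 0) then a (0, 0, 0) else 0)) has_sum (\<phi> Q - a (0, 0, 0))) UNIV" .
    have g: "((\<lambda>T. norm (a T * monomial T P) * exp (- (2 * pi * (u - 1)))) has_sum
        (infsum (\<lambda>T. norm (a T * monomial T P)) UNIV * exp (- (2 * pi * (u - 1))))) UNIV"
      by (intro has_sum_cmult_left has_sum_infsum abs)
    have "norm (\<phi> Q - a (0, 0, 0)) \<le> infsum (\<lambda>T. norm (a T * monomial T P)) UNIV * exp (- (2 * pi * (u - 1)))"
    proof (rule norm_infsum_le [OF h g])
      fix T :: "int \<times> int \<times> int"
      obtain n r m where T: "T = (n, r, m)" by (cases T)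
      show "norm (a T * monomial T Q - (if T = (0, 0, 0) then a (0, 0, 0) else 0)) \<le> norm (a T * monomial T P) * exp (- (2 * pi * (u - 1)))"
      proof (cases "T = (0, 0, 0) \<or> \<not> psd_index T")
        case True
        then have "a T * monomial T Q - (if T = (0, 0, 0) then a (0, 0, 0) else 0) = 0"
          using psd [of T] by (cases "T = (0, 0, 0)") (auto simp: monomial_def)
        then show ?thesis by simp
      next
        case False
        then have nm: "0 \<le> n" "0 \<le> m" "r\<^sup>2 \<le> 4 * n * m" and nz: "(n, r, m) \<noteq> (0, 0, 0)" by (auto simp: T psd_index_def)
        have "n + m \<ge> 1"
        proof (rule ccontr)
          assume "\<not> n + m \<ge> 1"
          then have "n = 0" "m = 0" using nm by auto
          then show False using nm nz by simp
        qed
        then have nm1: "real_of_int n + real_of_int m \<ge> 1" by linarith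
        have "(real_of_int n + real_of_int m) * 1 + 1 * (u - 1) \<le> (real_of_int n + real_of_int m) * 1 + (real_of_int n + real_of_int m) * (u - 1)"
          using nm1 u by (intro add_left_mono mult_right_mono) auto
        also have "\<dots> = real_of_int n * u + real_of_int m * u" by (simp add: algebra_simps)
        also have "\<dots> \<le> real_of_int n * t + real_of_int m * s"
          using nm t s by (intro add_mono mult_left_mono) auto
        finally have le: "(real_of_int n + real_of_int m) + (u - 1) \<le> real_of_int n * t + real_of_int m * s" by simp
        have "norm (monomial T Q) = exp (- (2 * pi * (real_of_int n * t + real_of_int m * s)))"
          by (simp add: T monomial_def Q_def norm_echar)
        also have "\<dots> \<le> exp (- (2 * pi * ((real_of_int n + real_of_int m) + (u - 1))))"
          using le by simp
        also have "\<dots> = norm (monomial T P) * exp (- (2 * pi * (u - 1)))"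
          by (simp add: T monomial_def P_def norm_echar exp_add [symmetric] algebra_simps)
        finally have "norm (monomial T Q) \<le> norm (monomial T P) * exp (- (2 * pi * (u - 1)))" .
        then have "norm (a T) * norm (monomial T Q) \<le> norm (a T) * (norm (monomial T P) * exp (- (2 * pi * (u - 1))))"
          by (rule mult_left_mono) simp
        then show ?thesis using False by (simp add: norm_mult mult.assoc)
      qed
    qed
    then show "norm (\<phi> (\<i> * of_real t, 0, \<i> * of_real s) - a (0, 0, 0)) \<le> infsum (\<lambda>T. norm (a T * monomial T P)) UNIV * exp (- (2 * pi * (u - 1)))"
      by (simp add: Q_def)
  qed
qed

section \<open>Modular forms as functions on the tube domain\<close>

\<comment> \<open>\<open>$\<close> shall denote vector components only\<close>
no_notation fps_nth (infixl "$" 75)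

definition to_matrix :: "complex3 \<Rightarrow> cmat2" where
  "to_matrix P = (\<chi> i j. if i = 1 \<and> j = 1 then fst P else if i = 2 \<and> j = 2 then snd (snd P) else fst (snd P))"

definition index_matrix :: "int \<times> int \<times> int \<Rightarrow> real^2^2" where
  "index_matrix T = (\<chi> i j. if i = 1 \<and> j = 1 then of_int (fst T) else if i = 2 \<and> j = 2 then of_int (snd (snd T))
     else of_int (fst (snd T)) / 2)"

lemma to_matrix_nth [simp]:
  "to_matrix P $ 1 $ 1 = fst P" "to_matrix P $ 1 $ 2 = fst (snd P)"
  "to_matrix P $ 2 $ 1 = fst (snd P)" "to_matrix P $ 2 $ 2 = snd (snd P)"
  by (simp_all add: to_matrix_def)

lemma index_matrix_nth [simp]:
  "index_matrix T $ 1 $ 1 = of_int (fst T)" "index_matrix T $ 1 $ 2 = of_int (fst (snd T)) / 2"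
  "index_matrix T $ 2 $ 1 = of_int (fst (snd T)) / 2" "index_matrix T $ 2 $ 2 = of_int (snd (snd T))"
  by (simp_all add: index_matrix_def)

lemma mat2_eq_iff:
  "(A :: 'a^2^2) = B \<longleftrightarrow> A $ 1 $ 1 = B $ 1 $ 1 \<and> A $ 1 $ 2 = B $ 1 $ 2 \<and> A $ 2 $ 1 = B $ 2 $ 1 \<and> A $ 2 $ 2 = B $ 2 $ 2"
  by (auto simp: vec_eq_iff forall_2)

lemma matrix_mult_2_nth: "((A :: 'a::semiring_1^2^2) ** B) $ i $ j = A $ i $ 1 * B $ 1 $ j + A $ i $ 2 * B $ 2 $ j"
  by (simp add: matrix_matrix_mult_def sum_2)

lemma quadratic_form_2:
  "v \<bullet> (M *v v) = (v $ 1)\<^sup>2 * M $ 1 $ 1 + v $ 1 * v $ 2 * (M $ 1 $ 2 + M $ 2 $ 1) + (v $ 2)\<^sup>2 * M $ 2 $ 2"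
  for M :: "real^2^2"
  by (simp add: inner_vec_def matrix_vector_mult_def sum_2 power2_eq_square algebra_simps)

lemma symmetric_2_iff: "transpose A = A \<longleftrightarrow> A $ 1 $ 2 = A $ 2 $ 1" for A :: "'a^2^2"
  by (auto simp: mat2_eq_iff transpose_def)

lemma H2_eq: "H2 = to_matrix ` tube"
proof (intro equalityI subsetI)
  fix Z assume Z: "Z \<in> H2"
  define P where "P = (Z $ 1 $ 1, Z $ 1 $ 2, Z $ 2 $ 2)"
  have sym: "Z $ 2 $ 1 = Z $ 1 $ 2" using Z by (simp add: H2_def symmetric_2_iff)
  then have "Z = to_matrix P" by (simp add: mat2_eq_iff P_def)
  moreover have "P \<in> tube"
    unfolding P_def tube_iff_quadratic_form
  proof (intro allI impI)
    fix x y :: real assume nz: "(x, y) \<noteq> (0, 0)"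
    have "(vector [x, y] :: real^2) \<noteq> 0" using nz by (auto simp: vec_eq_iff forall_2)
    then have "0 < vector [x, y] \<bullet> (map_matrix Im Z *v (vector [x, y] :: real^2))"
      using Z by (auto simp: H2_def)
    then show "0 < x\<^sup>2 * Im (Z $ 1 $ 1) + 2 * x * y * Im (Z $ 1 $ 2) + y\<^sup>2 * Im (Z $ 2 $ 2)"
      by (simp add: quadratic_form_2 sym algebra_simps)
  qed
  ultimately show "Z \<in> to_matrix ` tube" by blast
next
  fix Z assume "Z \<in> to_matrix ` tube"
  then obtain t z s where Z: "Z = to_matrix (t, z, s)" and P: "(t, z, s) \<in> tube" by auto
  have "0 < v \<bullet> (map_matrix Im Z *v v)" if v: "v \<noteq> 0" for v :: "real^2"
  proof -
    have "(v $ 1, v $ 2) \<noteq> (0, 0)" using v by (auto simp: vec_eq_iff forall_2)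
    then have "0 < (v $ 1)\<^sup>2 * Im t + 2 * (v $ 1) * (v $ 2) * Im z + (v $ 2)\<^sup>2 * Im s"
      using P unfolding tube_iff_quadratic_form by blast
    then show ?thesis by (simp add: quadratic_form_2 Z algebra_simps)
  qed
  then show "Z \<in> H2" by (auto simp: H2_def symmetric_2_iff Z)
qed

lemma q_exp_eq_monomial: "q_exp (index_matrix T) (to_matrix P) = monomial T P"
  by (cases T; cases P)
     (simp add: q_exp_def monomial_def echar_def trace_def sum_2 matrix_mult_2_nth algebra_simps)

lemma half_integral_psd_eq: "half_integral_psd = index_matrix ` {T. psd_index T}"
proof (intro equalityI subsetI)
  fix T assume T: "T \<in> half_integral_psd"
  then obtain n m where nm: "T $ 1 $ 1 = of_int n" "T $ 2 $ 2 = of_int m"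
    unfolding half_integral_psd_def by (metis (mono_tags, lifting) Ints_cases mem_Collect_eq)
  have "2 * T $ 1 $ 2 \<in> \<int>" using T by (simp add: half_integral_psd_def)
  then obtain r where r: "2 * T $ 1 $ 2 = of_int r" by (rule Ints_cases)
  have sym: "T $ 2 $ 1 = T $ 1 $ 2" using T by (simp add: half_integral_psd_def symmetric_2_iff)
  have eq: "T = index_matrix (n, r, m)" using nm r sym by (simp add: mat2_eq_iff)
  have q: "0 \<le> v \<bullet> (T *v v)" for v using T by (simp add: half_integral_psd_def)
  have "psd_index (n, r, m)"
  proof (rule ccontr)
    assume "\<not> psd_index (n, r, m)"
    then obtain x y where xy: "n * x\<^sup>2 + r * x * y + m * y\<^sup>2 < 0" by (rule not_psd_index_witness)
    have "vector [of_int x, of_int y] \<bullet> (T *v vector [of_int x, of_int y]) = real_of_int (n * x\<^sup>2 + r * x * y + m * y\<^sup>2)"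
      by (simp add: quadratic_form_2 eq algebra_simps)
    then show False using q [of "vector [of_int x, of_int y]"] xy by (simp del: of_int_add of_int_mult)
  qed
  then show "T \<in> index_matrix ` {T. psd_index T}" using eq by blast
next
  fix T assume "T \<in> index_matrix ` {T. psd_index T}"
  then obtain n r m where T: "T = index_matrix (n, r, m)" and psd: "0 \<le> n" "0 \<le> m" "r\<^sup>2 \<le> 4 * n * m"
    by (auto simp: psd_index_def)
  have "0 \<le> v \<bullet> (T *v v)" for v
  proof -
    define x y where "x = v $ 1" and "y = v $ 2"
    have v: "v \<bullet> (T *v v) = x\<^sup>2 * of_int n + x * y * of_int r + y\<^sup>2 * of_int m"
      by (simp add: quadratic_form_2 T x_def y_def)
    have rr: "(real_of_int r)\<^sup>2 \<le> 4 * of_int n * of_int m"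
      using psd(3) by (metis (mono_tags, lifting) of_int_le_iff of_int_mult of_int_numeral of_int_power)
    show ?thesis
    proof (cases "n = 0")
      case True
      then have "r = 0" using psd by simp
      then show ?thesis using True psd by (simp add: v)
    next
      case False
      have "4 * of_int n * (x\<^sup>2 * of_int n + x * y * of_int r + y\<^sup>2 * of_int m)
          = (2 * of_int n * x + of_int r * y)\<^sup>2 + y\<^sup>2 * (4 * of_int n * of_int m - (real_of_int r)\<^sup>2)"
        by (simp add: power2_eq_square algebra_simps)
      also have "\<dots> \<ge> 0" using rr by simp
      finally show ?thesis unfolding v using False psd by (simp add: zero_le_mult_iff)
    qed
  qed
  moreover have "T $ i $ i \<in> \<int>" for i using exhaust_2 [of i] by (auto simp: T)
  moreover have "2 * T $ i $ j \<in> \<int>" for i j using exhaust_2 [of i] exhaust_2 [of j] by (auto simp: T)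
  ultimately show "T \<in> half_integral_psd"
    by (auto simp: half_integral_psd_def symmetric_2_iff T)
qed

lemma inj_index_matrix: "inj index_matrix"
  by (rule injI) (auto simp: mat2_eq_iff prod_eq_iff)

text \<open>
  Existence of an expansion together with its uniqueness evaluates the definite description.
\<close>

lemma fourier_coeff_eqI:
  assumes a: "\<And>P. P \<in> tube \<Longrightarrow> ((\<lambda>T. a T * monomial T P) has_sum F (to_matrix P)) UNIV"
    and psd: "\<And>T. \<not> psd_index T \<Longrightarrow> a T = 0"
  shows "fourier_coeff F (index_matrix T) = a T"
proof -
  define A where "A S = (if S \<in> half_integral_psd then a (inv_into UNIV index_matrix S) else 0)" for S
  have A_index: "A (index_matrix T) = a T" for T
    using psd inj_index_matrix by (auto simp: A_def half_integral_psd_eq inj_image_mem_iff)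
  have reindex: "((\<lambda>S. B S * q_exp S (to_matrix P)) has_sum c) half_integral_psd \<longleftrightarrow>
      ((\<lambda>T. B (index_matrix T) * monomial T P) has_sum c) {T. psd_index T}" for B P c
    unfolding half_integral_psd_eq
    by (subst has_sum_reindex) (use inj_index_matrix in \<open>auto simp: o_def q_exp_eq_monomial intro: inj_on_subset\<close>)
  have neutral: "((\<lambda>T. b T * monomial T P) has_sum c) {T. psd_index T} \<longleftrightarrow> ((\<lambda>T. b T * monomial T P) has_sum c) UNIV"
    if "\<And>T. \<not> psd_index T \<Longrightarrow> b T = 0" for b c P
    by (rule has_sum_cong_neutral) (use that in auto)
  have "fourier_coeff F = A"
    unfolding fourier_coeff_def
  proof (rule the_equality, intro conjI allI impI ballI)
    fix Z assume "Z \<in> H2"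
    then obtain P where P: "P \<in> tube" "Z = to_matrix P" by (auto simp: H2_eq)
    show "((\<lambda>T. A T * q_exp T Z) has_sum F Z) half_integral_psd"
      unfolding P reindex A_index using a [OF P(1)] neutral [of a] psd by blast
  next
    fix B assume B: "(\<forall>T. T \<notin> half_integral_psd \<longrightarrow> B T = 0) \<and>
        (\<forall>Z\<in>H2. ((\<lambda>T. B T * q_exp T Z) has_sum F Z) half_integral_psd)"
    define b where "b T = (if psd_index T then B (index_matrix T) else 0)" for T
    have "((\<lambda>T. b T * monomial T P) has_sum F (to_matrix P)) UNIV" if P: "P \<in> tube" for P
    proof -
      have "((\<lambda>T. B (index_matrix T) * monomial T P) has_sum F (to_matrix P)) {T. psd_index T}"
        using B P by (auto simp: H2_eq reindex [symmetric])
      then have "((\<lambda>T. b T * monomial T P) has_sum F (to_matrix P)) {T. psd_index T}"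
        by (rule has_sum_cong [THEN iffD1, rotated]) (simp add: b_def)
      then show ?thesis using neutral [of b] by (simp add: b_def)
    qed
    then have "b = a" using a by (rule fourier_coefficients_unique)
    show "B = A"
    proof
      fix S show "B S = A S"
      proof (cases "S \<in> half_integral_psd")
        case True
        then obtain T where "psd_index T" "S = index_matrix T" by (auto simp: half_integral_psd_eq)
        then show ?thesis using A_index [of T] \<open>b = a\<close> b_def by metis
      next
        case False
        then show ?thesis using B by (simp add: A_def)
      qed
    qed
  qed (simp add: A_def)
  then show ?thesis by (simp add: A_index)
qed

theorem constant_fourier_coeff:
  assumes "periodic_holomorphic (\<lambda>P. F (to_matrix P))" "sl2_invariant (\<lambda>P. F (to_matrix P))"
  obtains C where "\<And>u t s. 1 \<le> u \<Longrightarrow> u \<le> t \<Longrightarrow> u \<le> s \<Longrightarrow>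
    norm (F (to_matrix (\<i> * of_real t, 0, \<i> * of_real s)) - fourier_coeff F 0) \<le> C * exp (- (2 * pi * (u - 1)))"
proof -
  obtain a where a: "\<And>P. P \<in> tube \<Longrightarrow> ((\<lambda>T. a T * monomial T P) has_sum F (to_matrix P)) UNIV"
    using fourier_expansion_tube [OF assms(1)] by blast
  have psd: "a T = 0" if "\<not> psd_index T" for T
    by (rule koecher_principle [OF assms(2) a that])
  have "index_matrix (0, 0, 0) = 0" by (simp add: mat2_eq_iff)
  then have "fourier_coeff F 0 = a (0, 0, 0)"
    using fourier_coeff_eqI [of a F "(0, 0, 0)", OF a psd] by simp
  then show thesis using constant_coefficient_limit [OF a psd] that by metis
qed

lemma linear_to_matrix: "linear to_matrix"
  by (rule linearI) (simp_all add: mat2_eq_iff)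

lemma to_matrix_axis: "to_matrix (dir_vec i w) = map_matrix ((*) w) (to_matrix (dir_vec i 1))"
  by (simp add: mat2_eq_iff dir_vec_def)

lemma to_matrix_add: "to_matrix (P + Q) = to_matrix P + to_matrix Q"
  by (simp add: mat2_eq_iff)

text \<open>
  Along a coordinate direction the complex linear Frechet derivative is multiplication by a number.
\<close>

lemma holomorphic_H2_slices:
  assumes F: "holomorphic_H2 F"
  shows "continuous_on tube (\<lambda>P. F (to_matrix P))"
    and "(\<lambda>w. F (to_matrix (P + dir_vec i w))) holomorphic_on slice i P"
proof -
  have "continuous_on H2 F"
    using F unfolding holomorphic_H2_def continuous_on_eq_continuous_within
    by (blast intro: has_derivative_continuous)
  moreover have "continuous_on tube to_matrix"
    using linear_to_matrix by (intro linear_continuous_on) (simp add: linear_conv_bounded_linear)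
  ultimately show "continuous_on tube (\<lambda>P. F (to_matrix P))"
    by (rule continuous_on_compose2) (simp add: H2_eq)
  show "(\<lambda>w. F (to_matrix (P + dir_vec i w))) holomorphic_on slice i P"
    unfolding holomorphic_on_def
  proof
    fix w0 assume w0: "w0 \<in> slice i P"
    define f where "f w = to_matrix (P + dir_vec i w)" for w
    have f: "f w \<in> H2" if "w \<in> slice i P" for w using that by (simp add: f_def slice_def H2_eq)
    obtain L where L: "(F has_derivative L) (at (f w0) within H2)" "\<And>c W. L (map_matrix ((*) c) W) = c * L W"
      using F f [OF w0] unfolding holomorphic_H2_def by blast
    have "bounded_linear (dir_vec i)"
      by (simp add: linear_conv_bounded_linear [symmetric] linear_iff dir_vec_def)
    then have bl: "bounded_linear (\<lambda>w. to_matrix (dir_vec i w))"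
      using bounded_linear_compose linear_to_matrix linear_conv_bounded_linear by blast
    have "((\<lambda>w. to_matrix P + to_matrix (dir_vec i w)) has_derivative (\<lambda>w. 0 + to_matrix (dir_vec i w))) (at w0 within slice i P)"
      by (intro has_derivative_add has_derivative_const bounded_linear_imp_has_derivative bl)
    then have df: "(f has_derivative (\<lambda>w. to_matrix (dir_vec i w))) (at w0 within slice i P)"
      by (simp add: f_def [abs_def] to_matrix_add)
    have "(F has_derivative L) (at (f w0) within f ` slice i P)"
      by (rule has_derivative_subset [OF L(1)]) (use f in auto)
    from has_derivative_in_compose [OF df this]
    have "((\<lambda>w. F (f w)) has_derivative (\<lambda>w. L (to_matrix (dir_vec i w)))) (at w0 within slice i P)" .
    moreover have "(\<lambda>w. L (to_matrix (dir_vec i w))) = (*) (L (to_matrix (dir_vec i 1)))"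
      by (subst to_matrix_axis) (simp add: L(2) mult.commute fun_eq_iff)
    ultimately have "((\<lambda>w. F (f w)) has_field_derivative L (to_matrix (dir_vec i 1))) (at w0 within slice i P)"
      by (simp add: has_field_derivative_def)
    then show "(\<lambda>w. F (to_matrix (P + dir_vec i w))) field_differentiable (at w0 within slice i P)"
      unfolding field_differentiable_def f_def by blast
  qed
qed

lemma sum_UNIV_Plus: "(\<Sum>k\<in>UNIV. f k) = (\<Sum>a\<in>UNIV. f (Inl a)) + (\<Sum>b\<in>UNIV. f (Inr b))"
  for f :: "'a::finite + 'b::finite \<Rightarrow> 'c::comm_monoid_add"
  using sum.Plus [of UNIV UNIV f] by (simp add: o_def)

lemma mat4_mult_nth:
  "((g :: mat4) ** h) $ k $ l = g $ k $ Inl 1 * h $ Inl 1 $ l + g $ k $ Inl 2 * h $ Inl 2 $ l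
     + (g $ k $ Inr 1 * h $ Inr 1 $ l + g $ k $ Inr 2 * h $ Inr 2 $ l)"
  by (simp add: matrix_matrix_mult_def sum_UNIV_Plus sum_2 add.assoc)

lemma forall_2_Plus_2: "(\<forall>k :: 2 + 2. Q k) \<longleftrightarrow> Q (Inl 1) \<and> Q (Inl 2) \<and> Q (Inr 1) \<and> Q (Inr 2)"
proof
  assume *: "Q (Inl 1) \<and> Q (Inl 2) \<and> Q (Inr 1) \<and> Q (Inr 2)"
  show "\<forall>k. Q k"
  proof
    fix k :: "2 + 2" show "Q k"
      using * by (cases k) (metis exhaust_2)+
  qed
qed auto

lemma J4_nth [simp]:
  "J4 $ Inl a $ Inl b = 0" "J4 $ Inr a $ Inr b = 0"
  "J4 $ Inl a $ Inr b = (if a = b then 1 else 0)" "J4 $ Inr a $ Inl b = (if a = b then - 1 else 0)"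
  by (simp_all add: J4_def)

lemma transpose_J4_mult_nth:
  "(transpose (g :: mat4) ** J4 ** g) $ k $ l =
     (g $ Inl 1 $ k * g $ Inr 1 $ l - g $ Inr 1 $ k * g $ Inl 1 $ l) +
     (g $ Inl 2 $ k * g $ Inr 2 $ l - g $ Inr 2 $ k * g $ Inl 2 $ l)"
  by (simp add: mat4_mult_nth transpose_def)

definition block_matrix :: "rat^2^2 \<Rightarrow> rat^2^2 \<Rightarrow> rat^2^2 \<Rightarrow> mat4" where
  "block_matrix A B D = (\<chi> k l. case k of
      Inl i \<Rightarrow> (case l of Inl j \<Rightarrow> A $ i $ j | Inr j \<Rightarrow> B $ i $ j)
    | Inr i \<Rightarrow> (case l of Inl j \<Rightarrow> 0 | Inr j \<Rightarrow> D $ i $ j))"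

lemma block_matrix_nth [simp]:
  "block_matrix A B D $ Inl i $ Inl j = A $ i $ j" "block_matrix A B D $ Inl i $ Inr j = B $ i $ j"
  "block_matrix A B D $ Inr i $ Inl j = 0" "block_matrix A B D $ Inr i $ Inr j = D $ i $ j"
  by (simp_all add: block_matrix_def)

definition mat2 :: "'a \<Rightarrow> 'a \<Rightarrow> 'a \<Rightarrow> 'a \<Rightarrow> 'a^2^2" where
  "mat2 p q u v = (\<chi> i j. if i = 1 then (if j = 1 then p else q) else (if j = 1 then u else v))"

lemma mat2_nth [simp]:
  "mat2 p q u v $ 1 $ 1 = p" "mat2 p q u v $ 1 $ 2 = q" "mat2 p q u v $ 2 $ 1 = u" "mat2 p q u v $ 2 $ 2 = v"
  by (simp_all add: mat2_def)

text \<open>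
  \<open>Z \<mapsto> Z + S\<close> for an integral symmetric matrix \<open>S\<close>.
\<close>

definition translation :: "int \<Rightarrow> int \<Rightarrow> int \<Rightarrow> mat4" where
  "translation x y w = block_matrix (mat 1) (mat2 (of_int x) (of_int y) (of_int y) (of_int w)) (mat 1)"

text \<open>
  \<open>Z \<mapsto> U Z U\<^sup>t\<close> for \<open>U\<close> with rows \<open>(p, q)\<close> and \<open>(u, v)\<close> of determinant 1; the last block is the
  inverse transpose of \<open>U\<close>.
\<close>

definition unimodular :: "int \<Rightarrow> int \<Rightarrow> int \<Rightarrow> int \<Rightarrow> mat4" where
  "unimodular p q u v = block_matrix (mat2 (of_int p) (of_int q) (of_int u) (of_int v)) 0
     (mat2 (of_int v) (of_int (- u)) (of_int (- q)) (of_int p))"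

lemma mat_1_nth_2 [simp]:
  "(mat 1 :: 'a::zero_neq_one^2^2) $ 1 $ 1 = 1" "(mat 1 :: 'a^2^2) $ 1 $ 2 = 0"
  "(mat 1 :: 'a^2^2) $ 2 $ 1 = 0" "(mat 1 :: 'a^2^2) $ 2 $ 2 = 1"
  by (simp_all add: mat_def)

lemma translation_Gamma_inf: "translation x y w \<in> Gamma_inf"
  unfolding Gamma_inf_def Sp4_Z_def
  by (auto simp: vec_eq_iff forall_2_Plus_2 transpose_J4_mult_nth translation_def block_C_def mat_def forall_2)

lemma unimodular_Gamma_inf:
  assumes "p * v - q * u = 1"
  shows "unimodular p q u v \<in> Gamma_inf"
proof -
  have "of_int p * of_int v - of_int q * of_int u = (1 :: rat)"
    using arg_cong [OF assms, of "of_int :: int \<Rightarrow> rat"] by simp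
  then show ?thesis
    unfolding Gamma_inf_def Sp4_Z_def
    by (auto simp: vec_eq_iff forall_2_Plus_2 transpose_J4_mult_nth unimodular_def block_C_def forall_2 algebra_simps)
qed

lemma matrix_inv_eqI:
  fixes A B :: "complex^'n^'n"
  assumes "A ** B = mat 1"
  shows "matrix_inv A = B"
proof -
  have BA: "B ** A = mat 1" using assms matrix_left_right_inverse by blast
  have "A ** matrix_inv A = mat 1 \<and> matrix_inv A ** A = mat 1"
    unfolding matrix_inv_def by (rule someI_ex) (use assms BA in blast)
  then have "matrix_inv A = matrix_inv A ** (A ** B)" by (simp add: assms)
  also have "\<dots> = B" using \<open>A ** matrix_inv A = mat 1 \<and> matrix_inv A ** A = mat 1\<close>
    by (simp add: matrix_mul_assoc)
  finally show ?thesis .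
qed

lemma act_translation:
  "act (translation x y w) (to_matrix (t, z, s)) = to_matrix (t + of_int x, z + of_int y, s + of_int w)"
proof -
  have "block_C (translation x y w) ** to_matrix (t, z, s) + block_D (translation x y w) = mat 1"
    by (simp add: mat2_eq_iff matrix_mult_2_nth block_C_def block_D_def translation_def)
  moreover have "matrix_inv (mat 1 :: cmat2) = mat 1" by (rule matrix_inv_eqI) simp
  ultimately show ?thesis
    by (simp add: act_def) (simp add: mat2_eq_iff matrix_mult_2_nth block_A_def block_B_def translation_def)
qed

lemma j_factor_translation: "j_factor (translation x y w) Z = 1"
  by (simp add: j_factor_def det_2 matrix_mult_2_nth block_C_def block_D_def translation_def)

lemma act_unimodular:
  assumes "p * v - q * u = 1"
  shows "act (unimodular p q u v) (to_matrix P) = to_matrix (sl2_act p q u v P)"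
proof -
  have d: "of_int p * of_int v - of_int q * of_int u = (1 :: complex)"
    using arg_cong [OF assms, of "of_int :: int \<Rightarrow> complex"] by simp
  define D where "D = block_C (unimodular p q u v) ** to_matrix P + block_D (unimodular p q u v)"
  have "matrix_inv D = mat2 (of_int p) (of_int u) (of_int q) (of_int v)"
    by (rule matrix_inv_eqI)
       (use d in \<open>simp add: mat2_eq_iff matrix_mult_2_nth D_def block_C_def block_D_def unimodular_def of_rat_minus algebra_simps\<close>)
  then show ?thesis
    unfolding act_def D_def [symmetric]
    by (cases P) (simp add: mat2_eq_iff matrix_mult_2_nth block_A_def block_B_def unimodular_def
        sl2_act_def power2_eq_square algebra_simps)
qed

lemma j_factor_unimodular:
  assumes "p * v - q * u = 1"
  shows "j_factor (unimodular p q u v) Z = 1"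
proof -
  have d: "of_int p * of_int v - of_int q * of_int u = (1 :: complex)"
    using arg_cong [OF assms, of "of_int :: int \<Rightarrow> complex"] by simp
  then show ?thesis
    by (simp add: j_factor_def det_2 matrix_mult_2_nth block_C_def block_D_def unimodular_def of_rat_minus algebra_simps)
qed

lemma translation_axis:
  obtains x y w where "\<And>P. act (translation x y w) (to_matrix P) = to_matrix (P + dir_vec i 1)"
proof -
  have "act (translation (if i = 0 then 1 else 0) (if i = 1 then 1 else 0) (if i = 2 then 1 else 0)) (to_matrix P)
      = to_matrix (P + dir_vec i 1)" for P
    by (cases P) (simp only: act_translation, simp add: dir_vec_def)
  then show thesis by (rule that)
qed

lemma parabolic_invariance:
  assumes inv: "\<And>g Z. g \<in> Gamma_inf \<Longrightarrow> (\<And>Z. j_factor g Z = 1) \<Longrightarrow> Z \<in> H2 \<Longrightarrow> F (act g Z) = F Z"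
  shows "P \<in> tube \<Longrightarrow> F (to_matrix (P + dir_vec i 1)) = F (to_matrix P)"
    and "sl2_invariant (\<lambda>P. F (to_matrix P))"
proof -
  show "F (to_matrix (P + dir_vec i 1)) = F (to_matrix P)" if "P \<in> tube"
  proof -
    obtain x y w where "\<And>P. act (translation x y w) (to_matrix P) = to_matrix (P + dir_vec i 1)"
      using translation_axis by blast
    then show ?thesis
      using inv [OF translation_Gamma_inf j_factor_translation, of "to_matrix P" x y w] that by (simp add: H2_eq)
  qed
  show "sl2_invariant (\<lambda>P. F (to_matrix P))"
    unfolding sl2_invariant_def
  proof (intro allI impI ballI)
    fix p q u v and P assume det: "p * v - q * u = (1::int)" and P: "P \<in> tube"
    show "F (to_matrix (sl2_act p q u v P)) = F (to_matrix P)"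
      using inv [OF unimodular_Gamma_inf [OF det] j_factor_unimodular [OF det], of "to_matrix P"] P
      by (simp add: H2_eq act_unimodular [OF det])
  qed
qed

lemma modular_form_properties:
  assumes F: "siegel_modular_form k F"
  shows "periodic_holomorphic (\<lambda>P. F (to_matrix P))" and "sl2_invariant (\<lambda>P. F (to_matrix P))"
proof -
  have inv: "F (act g Z) = F Z" if "g \<in> Gamma_inf" "\<And>Z. j_factor g Z = 1" "Z \<in> H2" for g Z
    using F that by (simp add: siegel_modular_form_def Gamma_inf_def)
  have hol: "holomorphic_H2 F" using F by (simp add: siegel_modular_form_def)
  show "periodic_holomorphic (\<lambda>P. F (to_matrix P))"
    unfolding periodic_holomorphic_def
    using holomorphic_H2_slices [OF hol] parabolic_invariance(1) [of F, OF inv] by blast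
  show "sl2_invariant (\<lambda>P. F (to_matrix P))"
    using parabolic_invariance(2) [of F, OF inv] by blast
qed

lemma diag2_eq_to_matrix: "diag2 a b = to_matrix (a, 0, b)"
  by (simp add: mat2_eq_iff diag2_def)

text \<open>
  The constant coefficient is approximated by \<open>F(diag(iu, is))\<close> with an error uniform in \<open>s \<ge> u\<close>,
  and for fixed \<open>u\<close> these values tend to 0 with \<open>s\<close>.
\<close>

theorem cusp_form_constant_coeff:
  assumes F: "siegel_cusp_form k F"
  shows "fourier_coeff F 0 = 0"
proof -
  have mf: "siegel_modular_form k F" using F by (simp add: siegel_cusp_form_def)
  obtain C where C: "\<And>u t s. 1 \<le> u \<Longrightarrow> u \<le> t \<Longrightarrow> u \<le> s \<Longrightarrow>
      norm (F (to_matrix (\<i> * of_real t, 0, \<i> * of_real s)) - fourier_coeff F 0) \<le> C * exp (- (2 * pi * (u - 1)))"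
    using constant_fourier_coeff [of F, OF modular_form_properties [OF mf]] by blast
  have le: "norm (fourier_coeff F 0) \<le> C * exp (- (2 * pi * (u - 1)))" if u: "1 \<le> u" for u
  proof -
    have "((\<lambda>s::real. F (diag2 (\<i> * of_real u) (\<i> * of_real s))) \<longlongrightarrow> 0) at_top"
      using F u by (simp add: siegel_cusp_form_def)
    then have "((\<lambda>s::real. norm (F (diag2 (\<i> * of_real u) (\<i> * of_real s)) - fourier_coeff F 0)) \<longlongrightarrow> norm (0 - fourier_coeff F 0)) at_top"
      by (intro tendsto_intros)
    moreover have "\<forall>\<^sub>F s in at_top. norm (F (diag2 (\<i> * of_real u) (\<i> * of_real s)) - fourier_coeff F 0) \<le> C * exp (- (2 * pi * (u - 1)))"
      using eventually_ge_at_top [of u] by eventually_elim (use C [of u u] u in \<open>auto simp: diag2_eq_to_matrix\<close>)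
    ultimately show ?thesis
      using tendsto_upperbound by fastforce
  qed
  have "((\<lambda>u. C * exp (- (2 * pi * (u - 1)))) \<longlongrightarrow> C * 0) at_top"
    by (intro tendsto_intros) real_asymp
  then have "norm (fourier_coeff F 0) \<le> C * 0"
  proof (rule tendsto_lowerbound)
    show "\<forall>\<^sub>F u in at_top. norm (fourier_coeff F 0) \<le> C * exp (- (2 * pi * (u - 1)))"
      using eventually_ge_at_top [of 1] by eventually_elim (rule le)
  qed simp
  then show ?thesis by simp
qed

section \<open>Integer points on the isotropic cone\<close>

type_synonym int5 = "int \<times> int \<times> int \<times> int \<times> int"
type_synonym real5 = "real \<times> real \<times> real \<times> real \<times> real"

text \<open>
  Where the product of \<open>1 + |x|\<close> over five coordinates is at most a multiple of the cube of a norm, the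
  product of the weights bounds the inverse fourth power of this norm; the exponent is below -1, so
  the weights are summable.
\<close>

definition weight :: "int \<Rightarrow> real" where
  "weight x = (1 + \<bar>real_of_int x\<bar>) powr (- 4 / 3)"

definition weight5 :: "int5 \<Rightarrow> real" where
  "weight5 = (\<lambda>(x1, x2, x3, x4, x5). weight x1 * (weight x2 * (weight x3 * (weight x4 * weight x5))))"

lemma weight_nonneg: "weight x \<ge> 0" by (simp add: weight_def)

lemma summable_weight: "weight summable_on UNIV"
proof -
  have "summable (\<lambda>n. real (Suc n) powr (- 4 / 3))"
    by (subst summable_Suc_iff) (simp add: summable_real_powr_iff)
  from summable_on_int_abs [OF this] show ?thesis
    by (simp add: weight_def [abs_def])
qed

lemma summable_weight5: "weight5 summable_on UNIV"
proof -
  note w = summable_weight weight_nonneg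
  have 2: "(\<lambda>(x4, x5). weight x4 * weight x5) summable_on UNIV \<times> UNIV"
    by (rule summable_on_product [OF w(1) w(1) w(2) w(2)])
  have 3: "(\<lambda>(x3, p). weight x3 * (case p of (x4, x5) \<Rightarrow> weight x4 * weight x5)) summable_on UNIV \<times> UNIV"
    by (rule summable_on_product [OF w(1) 2 [simplified] w(2)]) (auto simp: w(2))
  have 4: "(\<lambda>(x2, q). weight x2 * (case q of (x3, p) \<Rightarrow> weight x3 * (case p of (x4, x5) \<Rightarrow> weight x4 * weight x5))) summable_on UNIV \<times> UNIV"
    by (rule summable_on_product [OF w(1) 3 [simplified] w(2)]) (auto simp: w(2))
  have 5: "(\<lambda>(x1, r). weight x1 * (case r of (x2, q) \<Rightarrow> weight x2 * (case q of (x3, p) \<Rightarrow> weight x3 * (case p of (x4, x5) \<Rightarrow> weight x4 * weight x5)))) summable_on UNIV \<times> UNIV"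
    by (rule summable_on_product [OF w(1) 4 [simplified] w(2)]) (auto simp: w(2))
  show ?thesis using 5 by (simp add: weight5_def case_prod_unfold)
qed

lemma weight5_ge:
  assumes N: "N \<ge> 1" and C: "C > 0"
    and le: "(1 + \<bar>real_of_int x1\<bar>) * ((1 + \<bar>real_of_int x2\<bar>) * ((1 + \<bar>real_of_int x3\<bar>) * ((1 + \<bar>real_of_int x4\<bar>) * (1 + \<bar>real_of_int x5\<bar>)))) \<le> C * N ^ 3"
  shows "1 / N ^ 4 \<le> C powr (4 / 3) * weight5 (x1, x2, x3, x4, x5)"
proof -
  define Q where "Q = (1 + \<bar>real_of_int x1\<bar>) * ((1 + \<bar>real_of_int x2\<bar>) * ((1 + \<bar>real_of_int x3\<bar>) * ((1 + \<bar>real_of_int x4\<bar>) * (1 + \<bar>real_of_int x5\<bar>))))"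
  have Q: "Q > 0" unfolding Q_def by (intro mult_pos_pos) auto
  have "weight5 (x1, x2, x3, x4, x5) = Q powr (- 4 / 3)"
    by (simp add: weight5_def weight_def Q_def powr_mult)
  also have "\<dots> \<ge> (C * N ^ 3) powr (- 4 / 3)"
    using le Q unfolding Q_def [symmetric] by (intro powr_mono2') auto
  finally have "(C * N ^ 3) powr (- 4 / 3) \<le> weight5 (x1, x2, x3, x4, x5)" .
  moreover have "(C * N ^ 3) powr (- 4 / 3) = C powr (- 4 / 3) * (1 / N ^ 4)"
  proof -
    have "(N ^ 3) powr (- 4 / 3) = (N powr 3) powr (- 4 / 3)" using N by simp
    also have "\<dots> = N powr (- 4)" unfolding powr_powr by simp
    also have "\<dots> = 1 / N ^ 4" using N by (simp add: powr_minus_divide)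
    finally show ?thesis using N C by (simp add: powr_mult)
  qed
  ultimately have "C powr (4 / 3) * (C powr (- 4 / 3) * (1 / N ^ 4)) \<le> C powr (4 / 3) * weight5 (x1, x2, x3, x4, x5)"
    by (intro mult_left_mono) auto
  moreover have "C powr (4 / 3) * C powr (- 4 / 3) = 1" using C by (simp add: powr_add [symmetric])
  ultimately show ?thesis by (simp add: mult.assoc [symmetric])
qed

definition real5_of :: "int5 \<Rightarrow> real5" where
  "real5_of = (\<lambda>(a, b, c, d, e). (of_int a, of_int b, of_int c, of_int d, of_int e))"

definition int_cone :: "int5 set" where
  "int_cone = {(a, b, c, d, e). a * e = b * d - c\<^sup>2 \<and> (a, b, c, d, e) \<noteq> (0, 0, 0, 0, 0)}"

lemma abs_le_norm5:
  "\<bar>a\<bar> \<le> norm (a, b, c, d, e)" "\<bar>b\<bar> \<le> norm (a, b, c, d, e)" "\<bar>c\<bar> \<le> norm (a, b, c, d, e)"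
  "\<bar>d\<bar> \<le> norm (a, b, c, d, e)" "\<bar>e\<bar> \<le> norm (a, b, c, d, e :: real)"
  using norm_fst_le [of a "(b, c, d, e)"] norm_snd_le [of "(b, c, d, e)" a]
    norm_fst_le [of b "(c, d, e)"] norm_snd_le [of "(c, d, e)" b]
    norm_fst_le [of c "(d, e)"] norm_snd_le [of "(d, e)" c] norm_fst_le [of d e] norm_snd_le [of e d]
  by auto

lemma norm_real5_of_ge:
  "\<bar>real_of_int a\<bar> \<le> norm (real5_of (a, b, c, d, e))" "\<bar>real_of_int b\<bar> \<le> norm (real5_of (a, b, c, d, e))"
  "\<bar>real_of_int c\<bar> \<le> norm (real5_of (a, b, c, d, e))" "\<bar>real_of_int d\<bar> \<le> norm (real5_of (a, b, c, d, e))"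
  "\<bar>real_of_int e\<bar> \<le> norm (real5_of (a, b, c, d, e))"
  unfolding real5_of_def prod.case by (rule abs_le_norm5)+

lemma norm_real5_of_ge_1:
  assumes "p \<noteq> 0"
  shows "norm (real5_of p) \<ge> 1"
proof -
  obtain a b c d e where p: "p = (a, b, c, d, e)" by (cases p)
  then have "a \<noteq> 0 \<or> b \<noteq> 0 \<or> c \<noteq> 0 \<or> d \<noteq> 0 \<or> e \<noteq> 0" using assms by (auto simp: zero_prod_def)
  then have "1 \<le> \<bar>real_of_int a\<bar> \<or> 1 \<le> \<bar>real_of_int b\<bar> \<or> 1 \<le> \<bar>real_of_int c\<bar> \<or> 1 \<le> \<bar>real_of_int d\<bar> \<or> 1 \<le> \<bar>real_of_int e\<bar>"
    by linarith
  then show ?thesis using norm_real5_of_ge [where a=a and b=b and c=c and d=d and e=e] unfolding p by linarith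
qed

lemma summable_on_via_injection:
  fixes f :: "'a \<Rightarrow> real" and g :: "'b \<Rightarrow> real"
  assumes "g summable_on UNIV" "inj_on h A" "\<And>x. x \<in> A \<Longrightarrow> 0 \<le> f x \<and> f x \<le> C * g (h x)"
  shows "f summable_on A"
proof -
  have "g summable_on (h ` A)" by (rule summable_on_subset_banach [OF assms(1)]) auto
  then have "(\<lambda>x. g (h x)) summable_on A" using assms(2) by (simp add: summable_on_reindex o_def)
  then have "(\<lambda>x. C * g (h x)) summable_on A" by (rule summable_on_cmult_right)
  then show ?thesis by (rule summable_on_comparison_test) (use assms in auto)
qed

text \<open>
  For \<open>a \<noteq> 0\<close> let \<open>g = gcd a b\<close>, \<open>a = g a'\<close> and \<open>b = g b'\<close>. The equation of the cone determines
  \<open>d\<close> modulo \<open>a'\<close>, so the point is determined by \<open>(g, a', b', c, t)\<close> with \<open>t = d div a'\<close>. Up to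
  constants, the norm bounds each of \<open>g (1 + |b'|)\<close>, \<open>|a'| (1 + |t|)\<close> and \<open>1 + |c|\<close>, and the fourth
  power of the norm therefore bounds the product of all five numbers to the power 4/3.
\<close>

lemma summable_cone_nondegenerate:
  "(\<lambda>p. 1 / norm (real5_of p) ^ 4) summable_on {p \<in> int_cone. fst p \<noteq> 0}"
proof (rule summable_on_via_injection [OF summable_weight5])
  define h :: "int5 \<Rightarrow> int5" where "h = (\<lambda>(a, b, c, d, e). (gcd a b, a div gcd a b, b div gcd a b, c, d div (a div gcd a b)))"
  show "inj_on h {p \<in> int_cone. fst p \<noteq> 0}"
  proof (rule inj_onI)
    fix p p' assume p: "p \<in> {p \<in> int_cone. fst p \<noteq> 0}" and p': "p' \<in> {p \<in> int_cone. fst p \<noteq> 0}" and eq: "h p = h p'"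
    obtain a b c d e where P: "p = (a, b, c, d, e)" by (cases p)
    obtain a2 b2 c2 d2 e2 where P': "p' = (a2, b2, c2, d2, e2)" by (cases p')
    define g where "g = gcd a b"
    define a' b' where "a' = a div g" and "b' = b div g"
    have a0: "a \<noteq> 0" using p by (simp add: P)
    then have g: "g \<noteq> 0" by (simp add: g_def)
    have ab: "a = g * a'" "b = g * b'" by (simp_all add: a'_def b'_def g_def)
    have cop: "coprime a' b'" unfolding a'_def b'_def g_def using a0 by (intro div_gcd_coprime) auto
    have h: "gcd a2 b2 = g" "a2 div g = a'" "b2 div g = b'" "c2 = c" "d2 div a' = d div a'"
      using eq unfolding P P' h_def prod.case a'_def b'_def g_def by auto
    have "g dvd a2" "g dvd b2" unfolding h(1) [symmetric] by auto
    then have "a2 = a" "b2 = b" using h ab by auto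
    have e1: "a * e = b * d - c\<^sup>2" using p by (simp add: P int_cone_def)
    have e2: "a * e2 = b * d2 - c\<^sup>2" using p' \<open>a2 = a\<close> \<open>b2 = b\<close> h(4) by (simp add: P' int_cone_def)
    have "g * (a' * (e - e2)) = g * (b' * (d - d2))"
      using e1 e2 ab by (simp add: algebra_simps)
    then have "a' * (e - e2) = b' * (d - d2)" using g by simp
    then have "a' dvd b' * (d - d2)" by (metis dvd_triv_left)
    then have "a' dvd d - d2" using cop coprime_dvd_mult_right_iff by blast
    then have "d mod a' = d2 mod a'" by (simp add: mod_eq_dvd_iff)
    then have "d = d2" using h(5) by (metis div_mult_mod_eq)
    then have "a * e = a * e2" using e1 e2 by simp
    then have "e = e2" using a0 by simp
    show "p = p'" unfolding P P' using \<open>a2 = a\<close> \<open>b2 = b\<close> h(4) \<open>d = d2\<close> \<open>e = e2\<close> by simp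
  qed
  fix p assume p: "p \<in> {p \<in> int_cone. fst p \<noteq> 0}"
  obtain a b c d e where P: "p = (a, b, c, d, e)" by (cases p)
  define N where "N = norm (real5_of p)"
  have a0: "a \<noteq> 0" using p by (simp add: P)
  have "p \<noteq> 0" using a0 by (simp add: P zero_prod_def)
  then have N: "N \<ge> 1" unfolding N_def by (rule norm_real5_of_ge_1)
  have le: "\<bar>real_of_int a\<bar> \<le> N" "\<bar>real_of_int b\<bar> \<le> N" "\<bar>real_of_int c\<bar> \<le> N" "\<bar>real_of_int d\<bar> \<le> N"
    unfolding N_def P by (rule norm_real5_of_ge)+
  define g where "g = gcd a b"
  define a' b' where "a' = a div g" and "b' = b div g"
  define t where "t = d div a'"
  have g: "g \<ge> 1" using a0 by (simp add: g_def) (metis gcd_pos_int int_one_le_iff_zero_less)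
  have ab: "a = g * a'" "b = g * b'" by (simp_all add: a'_def b'_def g_def)
  have a'0: "a' \<noteq> 0" using a0 ab by auto
  have g_le: "g \<le> \<bar>a\<bar>" using ab a'0 g by (simp add: abs_mult)
  have a'_le: "\<bar>a'\<bar> \<le> \<bar>a\<bar>" using ab g by (simp add: abs_mult mult_le_cancel_right1)
  have "1 * \<bar>b'\<bar> \<le> g * \<bar>b'\<bar>" using g by (intro mult_right_mono) auto
  moreover have "(1 + g) * (1 + \<bar>b'\<bar>) = 1 + g + \<bar>b'\<bar> + g * \<bar>b'\<bar>" by (simp add: algebra_simps)
  ultimately have "(1 + g) * (1 + \<bar>b'\<bar>) \<le> 2 * g + 2 * (g * \<bar>b'\<bar>)" using g by linarith
  also have "g * \<bar>b'\<bar> = \<bar>b\<bar>" using ab g by (simp add: abs_mult)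
  finally have "(1 + g) * (1 + \<bar>b'\<bar>) \<le> 2 * \<bar>a\<bar> + 2 * \<bar>b\<bar>" using g_le by linarith
  then have "real_of_int ((1 + g) * (1 + \<bar>b'\<bar>)) \<le> real_of_int (2 * \<bar>a\<bar> + 2 * \<bar>b\<bar>)" by (simp only: of_int_le_iff)
  then have 1: "(1 + \<bar>real_of_int g\<bar>) * (1 + \<bar>real_of_int b'\<bar>) \<le> 4 * N" using le g by simp
  have "\<bar>a' * t\<bar> \<le> \<bar>d\<bar> + \<bar>a'\<bar>"
  proof -
    have "a' * t = d - d mod a'" by (simp add: t_def minus_mod_eq_mult_div)
    moreover have "\<bar>d mod a'\<bar> \<le> \<bar>a'\<bar>" using a'0 abs_mod_less [of a' d] by linarith
    ultimately show ?thesis by linarith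
  qed
  then have "\<bar>a'\<bar> * \<bar>t\<bar> \<le> \<bar>d\<bar> + \<bar>a\<bar>" using a'_le by (simp add: abs_mult)
  moreover have "(1 + \<bar>a'\<bar>) * (1 + \<bar>t\<bar>) \<le> (2 * \<bar>a'\<bar>) * (1 + \<bar>t\<bar>)"
    using a'0 by (intro mult_right_mono) auto
  ultimately have "(1 + \<bar>a'\<bar>) * (1 + \<bar>t\<bar>) \<le> 2 * \<bar>a\<bar> + 2 * (\<bar>d\<bar> + \<bar>a\<bar>)" using a'_le by (simp add: algebra_simps)
  then have "real_of_int ((1 + \<bar>a'\<bar>) * (1 + \<bar>t\<bar>)) \<le> real_of_int (2 * \<bar>a\<bar> + 2 * (\<bar>d\<bar> + \<bar>a\<bar>))" by (simp only: of_int_le_iff)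
  then have 2: "(1 + \<bar>real_of_int a'\<bar>) * (1 + \<bar>real_of_int t\<bar>) \<le> 6 * N" using le by simp
  have 3: "1 + \<bar>real_of_int c\<bar> \<le> 2 * N" using le N by simp
  have "((1 + \<bar>real_of_int g\<bar>) * (1 + \<bar>real_of_int b'\<bar>)) * ((1 + \<bar>real_of_int a'\<bar>) * (1 + \<bar>real_of_int t\<bar>)) * (1 + \<bar>real_of_int c\<bar>)
      \<le> (4 * N) * (6 * N) * (2 * N)"
    using N by (intro mult_mono 1 2 3) auto
  then have "(1 + \<bar>real_of_int g\<bar>) * ((1 + \<bar>real_of_int a'\<bar>) * ((1 + \<bar>real_of_int b'\<bar>) * ((1 + \<bar>real_of_int c\<bar>) * (1 + \<bar>real_of_int t\<bar>)))) \<le> 48 * N ^ 3"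
    by (simp add: power3_eq_cube mult_ac)
  from weight5_ge [OF N _ this] have "1 / N ^ 4 \<le> 48 powr (4 / 3) * weight5 (g, a', b', c, t)" by simp
  moreover have "h p = (g, a', b', c, t)" by (simp add: h_def P g_def a'_def b'_def t_def)
  ultimately show "0 \<le> 1 / norm (real5_of p) ^ 4 \<and> 1 / norm (real5_of p) ^ 4 \<le> 48 powr (4 / 3) * weight5 (h p)"
    by (simp add: N_def)
qed

text \<open>
  For \<open>a = 0\<close> the equation \<open>c\<^sup>2 = b d\<close> leaves only the sign of \<open>c\<close> open once \<open>b\<close> and \<open>d\<close> are given,
  while \<open>e\<close> is free.
\<close>

lemma summable_cone_degenerate:
  "(\<lambda>p. 1 / norm (real5_of p) ^ 4) summable_on {p \<in> int_cone. fst p = 0}"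
proof (rule summable_on_via_injection [OF summable_weight5])
  define h where "h = (\<lambda>(a::int, b::int, c::int, d::int, e::int). (b, d, e, sgn c, 0::int))"
  show "inj_on h {p \<in> int_cone. fst p = 0}"
  proof (rule inj_onI)
    fix p p' assume p: "p \<in> {p \<in> int_cone. fst p = 0}" and p': "p' \<in> {p \<in> int_cone. fst p = 0}" and eq: "h p = h p'"
    obtain a b c d e where P: "p = (a, b, c, d, e)" by (cases p)
    obtain a2 b2 c2 d2 e2 where P': "p' = (a2, b2, c2, d2, e2)" by (cases p')
    have h: "b2 = b" "d2 = d" "e2 = e" "sgn c2 = sgn c" "a = 0" "a2 = 0" using eq p p' by (auto simp: h_def P P')
    have "c\<^sup>2 = b * d" "c2\<^sup>2 = b * d" using p p' h by (auto simp: P P' int_cone_def)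
    then have "\<bar>c2\<bar> = \<bar>c\<bar>" by (metis power2_eq_iff abs_eq_iff)
    then have "c2 = c" using h(4) by (metis mult_sgn_abs)
    then show "p = p'" using h by (simp add: P P')
  qed
  fix p assume p: "p \<in> {p \<in> int_cone. fst p = 0}"
  obtain a b c d e where P: "p = (a, b, c, d, e)" by (cases p)
  define N where "N = norm (real5_of p)"
  have "p \<noteq> 0" using p by (auto simp: int_cone_def zero_prod_def)
  then have N: "N \<ge> 1" unfolding N_def by (rule norm_real5_of_ge_1)
  have "\<bar>real_of_int b\<bar> \<le> N" "\<bar>real_of_int d\<bar> \<le> N" "\<bar>real_of_int e\<bar> \<le> N"
    unfolding N_def P by (rule norm_real5_of_ge)+
  then have le: "1 + \<bar>real_of_int b\<bar> \<le> 2 * N" "1 + \<bar>real_of_int d\<bar> \<le> 2 * N" "1 + \<bar>real_of_int e\<bar> \<le> 2 * N"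
    using N by auto
  have s: "1 + \<bar>real_of_int (sgn c)\<bar> \<le> 2" by (simp add: sgn_if)
  have "(1 + \<bar>real_of_int b\<bar>) * ((1 + \<bar>real_of_int d\<bar>) * ((1 + \<bar>real_of_int e\<bar>) * ((1 + \<bar>real_of_int (sgn c)\<bar>) * (1 + \<bar>real_of_int 0\<bar>))))
      \<le> 2 * N * (2 * N * (2 * N * (2 * 1)))"
    using N by (intro mult_mono le s) auto
  also have "\<dots> = 16 * N ^ 3" by (simp add: power3_eq_cube)
  finally have "1 / N ^ 4 \<le> 16 powr (4 / 3) * weight5 (b, d, e, sgn c, 0)"
    by (intro weight5_ge [OF N]) auto
  moreover have "h p = (b, d, e, sgn c, 0)" by (simp add: h_def P)
  ultimately show "0 \<le> 1 / norm (real5_of p) ^ 4 \<and> 1 / norm (real5_of p) ^ 4 \<le> 16 powr (4 / 3) * weight5 (h p)"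
    by (simp add: N_def)
qed

theorem summable_int_cone:
  assumes "k \<ge> 4"
  shows "(\<lambda>p. 1 / norm (real5_of p) ^ k) summable_on int_cone"
proof -
  have "int_cone = {p \<in> int_cone. fst p \<noteq> 0} \<union> {p \<in> int_cone. fst p = 0}" by auto
  then have 4: "(\<lambda>p. 1 / norm (real5_of p) ^ 4) summable_on int_cone"
    using summable_on_union [OF summable_cone_nondegenerate summable_cone_degenerate] by simp
  show ?thesis
  proof (rule summable_on_comparison_test [OF 4])
    fix p assume "p \<in> int_cone"
    then have "p \<noteq> 0" by (auto simp: int_cone_def zero_prod_def)
    then have N: "norm (real5_of p) \<ge> 1" by (rule norm_real5_of_ge_1)
    then show "1 / norm (real5_of p) ^ k \<le> 1 / norm (real5_of p) ^ 4"
      using assms by (intro divide_left_mono power_increasing mult_pos_pos zero_less_power) auto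
  qed auto
qed

section \<open>Series over the isotropic cone\<close>

definition real_cone :: "real5 set" where
  "real_cone = {(a, b, c, d, e). a * e = b * d - c\<^sup>2}"

text \<open>
  The determinant \<open>det (C Z + D)\<close> written in Pluecker coordinates of \<open>(C, D)\<close>.
\<close>

definition cone_form :: "real5 \<Rightarrow> complex3 \<Rightarrow> complex" where
  "cone_form p P = (case p of (a, b, c, d, e) \<Rightarrow> case P of (t, z, s) \<Rightarrow>
     of_real a * (t * s - z\<^sup>2) + of_real b * t - 2 * of_real c * z + of_real d * s + of_real e)"

lemma det_tube_nonzero:
  assumes "(t, z, s) \<in> tube"
  shows "t * s - z\<^sup>2 \<noteq> 0"
proof
  assume eq: "t * s - z\<^sup>2 = 0"
  obtain x y where t: "t = Complex x y" by (cases t)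
  obtain u v where z: "z = Complex u v" by (cases z)
  obtain x' y' where s: "s = Complex x' y'" by (cases s)
  have pos: "0 < y" "0 < y'" "v\<^sup>2 < y * y'" using assms by (auto simp: tube_def t z s)
  have re: "x * x' - y * y' = u\<^sup>2 - v\<^sup>2" and im: "x * y' + y * x' = 2 * u * v"
    using eq by (auto simp: t z s complex_eq_iff power2_eq_square algebra_simps)
  \<comment> \<open>eliminating the real part of the third coordinate leaves a positive quantity equal to minus a square\<close>
  have "y\<^sup>2 * (y * y' - v\<^sup>2) + x\<^sup>2 * (y * y' - v\<^sup>2) = - (v * x - u * y)\<^sup>2"
  proof -
    have "x * (x * y' + y * x') - y * (x * x' - y * y') = x * (2 * u * v) - y * (u\<^sup>2 - v\<^sup>2)"
      by (simp only: re im)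
    then have "y' * (x\<^sup>2 + y\<^sup>2) = 2 * u * v * x - y * u\<^sup>2 + y * v\<^sup>2" by (simp add: power2_eq_square algebra_simps)
    then have "y * (y' * (x\<^sup>2 + y\<^sup>2)) = y * (2 * u * v * x - y * u\<^sup>2 + y * v\<^sup>2)" by simp
    then show ?thesis by (simp add: power2_eq_square algebra_simps)
  qed
  moreover have "0 < y\<^sup>2 * (y * y' - v\<^sup>2)" using pos by simp
  moreover have "0 \<le> x\<^sup>2 * (y * y' - v\<^sup>2)" using pos by simp
  ultimately show False by (smt (verit) zero_le_power2)
qed

text \<open>
  On the cone the form is \<open>a det (Z + R)\<close> for a real symmetric matrix \<open>R\<close> if \<open>a \<noteq> 0\<close>. If
  \<open>a = 0\<close>, its imaginary part pairs \<open>Im Z\<close> with a semi-definite matrix of rank at most 1, which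
  gives 0 only if that matrix is 0; then just the constant \<open>e\<close> is left.
\<close>

lemma cone_form_nonzero:
  assumes p: "p \<in> real_cone" "p \<noteq> 0" and P: "P \<in> tube"
  shows "cone_form p P \<noteq> 0"
proof -
  obtain a b c d e where p': "p = (a, b, c, d, e)" by (cases p)
  obtain t z s where P': "P = (t, z, s)" by (cases P)
  have eq: "a * e = b * d - c\<^sup>2" using p by (simp add: real_cone_def p')
  have pos: "0 < Im t" "0 < Im s" "(Im z)\<^sup>2 < Im t * Im s" using P by (auto simp: P' tube_def)
  show ?thesis
  proof (cases "a = 0")
    case False
    define x y w where "x = d / a" and "y = b / a" and "w = c / a"
    have dbc: "d = a * x" "b = a * y" "c = a * w" using False by (simp_all add: x_def y_def w_def)
    have "a * e = a * (a * (y * x) - a * w\<^sup>2)"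
      using eq unfolding dbc by (simp add: power2_eq_square algebra_simps)
    then have e: "e = a * (y * x) - a * w\<^sup>2" using False by simp
    have "(t + of_real x, z + of_real w, s + of_real y) \<in> tube" using pos by (simp add: tube_def)
    then have "(t + of_real x) * (s + of_real y) - (z + of_real w)\<^sup>2 \<noteq> 0" by (rule det_tube_nonzero)
    moreover have "cone_form p P = of_real a * ((t + of_real x) * (s + of_real y) - (z + of_real w)\<^sup>2)"
      unfolding cone_form_def p' P' prod.case dbc e by (simp add: power2_eq_square algebra_simps)
    ultimately show ?thesis using False by simp
  next
    case a: True
    show ?thesis
    proof (cases "b = 0")
      case False
      have bd: "b * d = c\<^sup>2" using eq a by simp
      have "b * Im (cone_form p P) = b\<^sup>2 * Im t + 2 * b * (- c) * Im z + (b * d) * Im s"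
        by (simp add: cone_form_def p' P' a power2_eq_square algebra_simps)
      also have "\<dots> = b\<^sup>2 * Im t + 2 * b * (- c) * Im z + (- c)\<^sup>2 * Im s" by (simp add: bd)
      also have "\<dots> > 0" using P False unfolding P' tube_iff_quadratic_form by blast
      finally show ?thesis by auto
    next
      case True
      then have c: "c = 0" using eq a by simp
      show ?thesis
      proof (cases "d = 0")
        case False
        then have "Im (cone_form p P) \<noteq> 0" using pos by (simp add: cone_form_def p' P' a True c)
        then show ?thesis by auto
      next
        case d: True
        then have "e \<noteq> 0" using p a True c by (simp add: p' zero_prod_def)
        then show ?thesis by (simp add: cone_form_def p' P' a True c d)
      qed
    qed
  qed
qed

lemma continuous_cone_form [continuous_intros]:
  "continuous_on A f \<Longrightarrow> continuous_on A g \<Longrightarrow> continuous_on A (\<lambda>x. cone_form (f x) (g x))"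
  unfolding cone_form_def case_prod_unfold by (intro continuous_intros)

lemma cone_form_scaleR: "cone_form (r *\<^sub>R p) P = of_real r * cone_form p P"
  by (cases p; cases P) (simp add: cone_form_def algebra_simps)

text \<open>
  The form is linear in \<open>p\<close>, so the bound is a minimum over the compact set of unit vectors of the cone.
\<close>

lemma cone_form_lower_bound:
  assumes K: "compact K" "K \<subseteq> tube"
  obtains \<delta> where "\<delta> > 0" "\<And>p P. p \<in> real_cone \<Longrightarrow> P \<in> K \<Longrightarrow> \<delta> * norm p \<le> norm (cone_form p P)"
proof (cases "K = {}")
  case True
  then show ?thesis using that [of 1] by simp
next
  case False
  define S where "S = sphere 0 1 \<inter> real_cone"
  have cone_eq: "real_cone = {p. fst p * snd (snd (snd (snd p))) = fst (snd p) * fst (snd (snd (snd p))) - (fst (snd (snd p)))\<^sup>2}"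
    by (auto simp: real_cone_def)
  have "closed real_cone" unfolding cone_eq by (intro closed_Collect_eq continuous_intros)
  then have "compact S" unfolding S_def by (intro compact_Int_closed compact_sphere)
  then have cS: "compact (S \<times> K)" using K by (intro compact_Times)
  have "(0, 0, 0, 0, 1) \<in> S" by (simp add: S_def real_cone_def norm_Pair)
  then have "S \<times> K \<noteq> {}" using False by auto
  moreover have "continuous_on (S \<times> K) (\<lambda>x. norm (cone_form (fst x) (snd x)))"
    by (intro continuous_intros)
  ultimately obtain x0 where x0: "x0 \<in> S \<times> K"
    and min: "\<And>x. x \<in> S \<times> K \<Longrightarrow> norm (cone_form (fst x0) (snd x0)) \<le> norm (cone_form (fst x) (snd x))"
    using continuous_attains_inf [OF cS, of "\<lambda>x. norm (cone_form (fst x) (snd x))"] by blast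
  define \<delta> where "\<delta> = norm (cone_form (fst x0) (snd x0))"
  have "cone_form (fst x0) (snd x0) \<noteq> 0"
  proof (rule cone_form_nonzero)
    show "fst x0 \<in> real_cone" using x0 by (auto simp: S_def)
    show "fst x0 \<noteq> 0" using x0 unfolding S_def by force
    show "snd x0 \<in> tube" using x0 K by auto
  qed
  then have "\<delta> > 0" by (simp add: \<delta>_def)
  moreover have "\<delta> * norm p \<le> norm (cone_form p P)" if p: "p \<in> real_cone" and P: "P \<in> K" for p P
  proof (cases "p = 0")
    case False
    then have n: "norm p > 0" by simp
    have "(1 / norm p) *\<^sub>R p \<in> real_cone"
    proof -
      obtain a b c d e where p': "p = (a, b, c, d, e)" by (cases p)
      define r where "r = 1 / norm p"
      have "a * e = b * d - c\<^sup>2" using p by (simp add: p' real_cone_def)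
      then have "r * a * (r * e) = r * b * (r * d) - (r * c)\<^sup>2"
        by (simp add: power2_eq_square) (metis (no_types, opaque_lifting) mult.assoc mult.left_commute right_diff_distrib')
      then show ?thesis unfolding r_def [symmetric] by (simp add: p' real_cone_def)
    qed
    then have "((1 / norm p) *\<^sub>R p, P) \<in> S \<times> K" using P n by (simp add: S_def)
    from min [OF this] have "\<delta> \<le> norm (cone_form p P) / norm p"
      using n by (simp add: cone_form_scaleR norm_mult norm_divide \<delta>_def)
    then show ?thesis using n by (simp add: pos_le_divide_eq)
  qed simp
  ultimately show ?thesis by (rule that)
qed

lemma real5_of_cone: "p \<in> int_cone \<Longrightarrow> real5_of p \<in> real_cone \<and> real5_of p \<noteq> 0"
proof -
  assume p: "p \<in> int_cone"
  obtain a b c d e where p': "p = (a, b, c, d, e)" by (cases p)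
  have "real_of_int (a * e) = real_of_int (b * d - c\<^sup>2)" using p by (simp add: int_cone_def p')
  moreover have "p \<noteq> 0" using p by (auto simp: int_cone_def zero_prod_def)
  then have "norm (real5_of p) \<ge> 1" by (rule norm_real5_of_ge_1)
  ultimately show ?thesis by (auto simp: real_cone_def real5_of_def p')
qed

text \<open>
  The terms of the Eisenstein series are indexed by cosets; all that matters about them is an
  injective map to integer points of the cone.
\<close>

locale cone_series =
  fixes I :: "'i set" and pl :: "'i \<Rightarrow> int5" and k :: nat
  assumes k: "k \<ge> 4" and inj: "inj_on pl I" and pl: "pl ` I \<subseteq> int_cone"
begin

definition cone_sum :: "complex3 \<Rightarrow> complex" where
  "cone_sum P = (\<Sum>\<^sub>\<infinity>i\<in>I. 1 / cone_form (real5_of (pl i)) P ^ k)"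

lemma summable_norm: "(\<lambda>i. 1 / norm (real5_of (pl i)) ^ k) summable_on I"
proof -
  have "(\<lambda>p. 1 / norm (real5_of p) ^ k) summable_on pl ` I"
    by (rule summable_on_subset_banach [OF summable_int_cone [OF k] pl])
  then show ?thesis using inj by (simp add: summable_on_reindex o_def)
qed

lemma uniform_convergence:
  assumes K: "compact K" "K \<subseteq> tube"
  shows "uniform_limit K (\<lambda>Y P. \<Sum>i\<in>Y. 1 / cone_form (real5_of (pl i)) P ^ k) cone_sum (finite_subsets_at_top I)"
proof -
  obtain \<delta> where \<delta>: "\<delta> > 0" "\<And>p P. p \<in> real_cone \<Longrightarrow> P \<in> K \<Longrightarrow> \<delta> * norm p \<le> norm (cone_form p P)"
    using cone_form_lower_bound [OF K] by metis
  show ?thesis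
    unfolding cone_sum_def
  proof (rule Weierstrass_m_test_general)
    show "(\<lambda>i. 1 / \<delta> ^ k * (1 / norm (real5_of (pl i)) ^ k)) summable_on I"
      by (intro summable_on_cmult_right summable_norm)
    fix i P assume i: "i \<in> I" and P: "P \<in> K"
    have c: "real5_of (pl i) \<in> real_cone" "norm (real5_of (pl i)) > 0" using real5_of_cone [of "pl i"] pl i by auto
    have "norm (1 / cone_form (real5_of (pl i)) P ^ k) = 1 / norm (cone_form (real5_of (pl i)) P) ^ k"
      by (simp add: norm_divide norm_power)
    also have "\<dots> \<le> 1 / (\<delta> * norm (real5_of (pl i))) ^ k"
    proof -
      have "(\<delta> * norm (real5_of (pl i))) ^ k \<le> norm (cone_form (real5_of (pl i)) P) ^ k"
        using \<delta> c P by (intro power_mono) auto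
      moreover have "0 < (\<delta> * norm (real5_of (pl i))) ^ k" using \<delta> c by simp
      ultimately show ?thesis by (simp add: frac_le)
    qed
    also have "\<dots> = 1 / \<delta> ^ k * (1 / norm (real5_of (pl i)) ^ k)" by (simp add: power_mult_distrib)
    finally show "norm (1 / cone_form (real5_of (pl i)) P ^ k) \<le> 1 / \<delta> ^ k * (1 / norm (real5_of (pl i)) ^ k)" .
  qed
qed

lemma term_nonzero: "i \<in> I \<Longrightarrow> P \<in> tube \<Longrightarrow> cone_form (real5_of (pl i)) P \<noteq> 0"
  using real5_of_cone [of "pl i"] pl by (intro cone_form_nonzero) auto

lemma eventually_subset: "\<forall>\<^sub>F Y in finite_subsets_at_top I. Y \<subseteq> I"
  by (simp add: eventually_finite_subsets_at_top_weakI)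

lemma continuous: "continuous_on tube cone_sum"
proof -
  have "isCont cone_sum P" if P: "P \<in> tube" for P
  proof -
    obtain r where r: "r > 0" "cball P r \<subseteq> tube" using open_tube P open_contains_cball by blast
    have "continuous_on (cball P r) cone_sum"
    proof (rule uniform_limit_theorem [OF _ uniform_convergence])
      show "\<forall>\<^sub>F Y in finite_subsets_at_top I. continuous_on (cball P r) (\<lambda>P. \<Sum>i\<in>Y. 1 / cone_form (real5_of (pl i)) P ^ k)"
        using eventually_subset
      proof eventually_elim
        case (elim Y)
        then show ?case
          by (intro continuous_intros) (use r term_nonzero in \<open>auto simp: subset_iff\<close>)
      qed
    qed (use r in auto)
    then have "continuous_on (ball P r) cone_sum" using ball_subset_cball continuous_on_subset by blast
    then show ?thesis using r by (simp add: continuous_on_eq_continuous_at)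
  qed
  then show ?thesis by (simp add: continuous_at_imp_continuous_on)
qed

lemma holomorphic: "(\<lambda>w. cone_sum (P + dir_vec j w)) holomorphic_on slice j P"
proof -
  have op: "open (slice j P)" using strip_slice by (simp add: strip_def)
  have "\<exists>f'. ((\<lambda>w. cone_sum (P + dir_vec j w)) has_field_derivative f') (at w0)" if w0: "w0 \<in> slice j P" for w0
  proof -
    obtain r where r: "r > 0" "cball w0 r \<subseteq> slice j P" using op w0 open_contains_cball by blast
    define K where "K = (\<lambda>w. P + dir_vec j w) ` cball w0 r"
    have K: "compact K" "K \<subseteq> tube" unfolding K_def
      using r by (auto intro!: compact_continuous_image continuous_intros simp: slice_def)
    have ul: "uniform_limit (cball w0 r) (\<lambda>Y w. \<Sum>i\<in>Y. 1 / cone_form (real5_of (pl i)) (P + dir_vec j w) ^ k)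
        (\<lambda>w. cone_sum (P + dir_vec j w)) (finite_subsets_at_top I)"
      using uniform_convergence [OF K] unfolding uniform_limit_iff K_def by simp
    have hol1: "(\<lambda>w. cone_form p (P + dir_vec j w)) holomorphic_on UNIV" for p
    proof -
      obtain t z s where "P = (t, z, s)" by (cases P)
      moreover obtain a b c d e where "p = (a, b, c, d, e)" by (cases p)
      moreover have "(\<lambda>w. if i' = j then w else 0) holomorphic_on UNIV" for i' :: nat
        by (cases "i' = j") (auto intro: holomorphic_intros)
      ultimately show ?thesis
        unfolding cone_form_def dir_vec_def
        by (cases "j = 0"; cases "j = 1"; cases "j = 2") (auto intro!: holomorphic_intros)
    qed
    have ev: "\<forall>\<^sub>F Y in finite_subsets_at_top I.
        continuous_on (cball w0 r) (\<lambda>w. \<Sum>i\<in>Y. 1 / cone_form (real5_of (pl i)) (P + dir_vec j w) ^ k) \<and>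
        (\<lambda>w. \<Sum>i\<in>Y. 1 / cone_form (real5_of (pl i)) (P + dir_vec j w) ^ k) holomorphic_on ball w0 r"
      using eventually_subset
    proof eventually_elim
      case (elim Y)
      have "(\<lambda>w. \<Sum>i\<in>Y. 1 / cone_form (real5_of (pl i)) (P + dir_vec j w) ^ k) holomorphic_on cball w0 r"
      proof (intro holomorphic_intros)
        fix i w assume i: "i \<in> Y" and w: "w \<in> cball w0 r"
        have "P + dir_vec j w \<in> tube" using w r by (auto simp: slice_def)
        then have "cone_form (real5_of (pl i)) (P + dir_vec j w) \<noteq> 0" using elim i by (intro term_nonzero) auto
        then show "cone_form (real5_of (pl i)) (P + dir_vec j w) ^ k \<noteq> 0" by simp
      qed (use hol1 holomorphic_on_subset in blast)
      then show ?case
        using holomorphic_on_imp_continuous_on holomorphic_on_subset ball_subset_cball by blast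
    qed
    have "(\<lambda>w. cone_sum (P + dir_vec j w)) holomorphic_on ball w0 r"
      by (rule holomorphic_uniform_limit [OF ev ul]) auto
    then show ?thesis using r holomorphic_on_open [of "ball w0 r"] by auto
  qed
  then show ?thesis using holomorphic_on_open [OF op] by blast
qed

text \<open>
  The equation of the cone turns the mixed terms into squares, so the absolute value increases
  with \<open>u\<close>; at \<open>u = 1\<close> it dominates the norm.
\<close>

lemma norm_sq_on_imaginary_axis:
  assumes "p \<in> int_cone"
  shows "(norm (cone_form (real5_of p) (\<i> * of_real u, 0, \<i> * of_real u)))\<^sup>2 =
    (case p of (a, b, c, d, e) \<Rightarrow> of_int (e\<^sup>2) + u\<^sup>2 * u\<^sup>2 * of_int (a\<^sup>2) + u\<^sup>2 * of_int (b\<^sup>2 + d\<^sup>2 + 2 * c\<^sup>2))"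
proof -
  obtain a b c d e where p: "p = (a, b, c, d, e)" by (cases p)
  have "real_of_int (a * e) = real_of_int (b * d - c\<^sup>2)" using assms by (simp add: int_cone_def p)
  then have ae: "real_of_int a * real_of_int e = of_int b * of_int d - (of_int c)\<^sup>2" by simp
  have "cone_form (real5_of p) (\<i> * of_real u, 0, \<i> * of_real u) = Complex (of_int e - of_int a * u\<^sup>2) (u * (of_int b + of_int d))"
    by (simp add: cone_form_def real5_of_def p complex_eq_iff power2_eq_square algebra_simps)
  then have "(norm (cone_form (real5_of p) (\<i> * of_real u, 0, \<i> * of_real u)))\<^sup>2
      = (of_int e - of_int a * u\<^sup>2)\<^sup>2 + (u * (of_int b + of_int d))\<^sup>2"
    by (simp add: cmod_def)
  also have "\<dots> = (of_int e)\<^sup>2 + u\<^sup>2 * u\<^sup>2 * (of_int a)\<^sup>2 - 2 * u\<^sup>2 * (real_of_int a * real_of_int e)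
      + u\<^sup>2 * ((of_int b)\<^sup>2 + (of_int d)\<^sup>2 + 2 * of_int b * of_int d)"
    by (simp add: power2_eq_square algebra_simps)
  also have "\<dots> = (of_int e)\<^sup>2 + u\<^sup>2 * u\<^sup>2 * (of_int a)\<^sup>2 + u\<^sup>2 * ((of_int b)\<^sup>2 + (of_int d)\<^sup>2 + 2 * (of_int c)\<^sup>2)"
    unfolding ae by (simp add: power2_eq_square algebra_simps)
  finally show ?thesis by (simp add: p)
qed

lemma term_lower_bound_1:
  assumes p: "p \<in> int_cone" and u: "u \<ge> 1"
  shows "norm (real5_of p) \<le> norm (cone_form (real5_of p) (\<i> * of_real u, 0, \<i> * of_real u))"
proof (rule power2_le_imp_le)
  obtain a b c d e where p': "p = (a, b, c, d, e)" by (cases p)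
  have u2: "1 \<le> u\<^sup>2" using u by (simp add: one_le_power)
  then have u4: "1 \<le> u\<^sup>2 * u\<^sup>2" using mult_mono [OF u2 u2] by simp
  have "(norm (real5_of p))\<^sup>2 = of_int (e\<^sup>2) + 1 * of_int (a\<^sup>2) + 1 * real_of_int (b\<^sup>2 + d\<^sup>2 + c\<^sup>2)"
    by (simp add: real5_of_def p' norm_Pair)
  also have "\<dots> \<le> of_int (e\<^sup>2) + u\<^sup>2 * u\<^sup>2 * of_int (a\<^sup>2) + u\<^sup>2 * of_int (b\<^sup>2 + d\<^sup>2 + 2 * c\<^sup>2)"
    using u2 u4 by (intro add_mono mult_mono) auto
  finally show "(norm (real5_of p))\<^sup>2 \<le> (norm (cone_form (real5_of p) (\<i> * of_real u, 0, \<i> * of_real u)))\<^sup>2"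
    unfolding norm_sq_on_imaginary_axis [OF p] by (simp add: p')
qed simp

lemma term_lower_bound_2:
  assumes p: "p \<in> int_cone" and nz: "fst p \<noteq> 0 \<or> fst (snd p) \<noteq> 0 \<or> fst (snd (snd p)) \<noteq> 0 \<or> fst (snd (snd (snd p))) \<noteq> 0"
    and u: "u \<ge> 1"
  shows "u \<le> norm (cone_form (real5_of p) (\<i> * of_real u, 0, \<i> * of_real u))"
proof (rule power2_le_imp_le)
  obtain a b c d e where p': "p = (a, b, c, d, e)" by (cases p)
  have u2: "1 \<le> u\<^sup>2" using u by (simp add: one_le_power)
  have "a\<^sup>2 > 0 \<or> b\<^sup>2 + d\<^sup>2 + 2 * c\<^sup>2 > 0"
    using nz by (auto simp: p' add_pos_nonneg add_nonneg_pos)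
  then have "1 \<le> a\<^sup>2 + (b\<^sup>2 + d\<^sup>2 + 2 * c\<^sup>2)"
    using zero_le_power2 [of a] zero_le_power2 [of b] zero_le_power2 [of c] zero_le_power2 [of d] by linarith
  then have "1 \<le> real_of_int (a\<^sup>2 + (b\<^sup>2 + d\<^sup>2 + 2 * c\<^sup>2))" by linarith
  then have "u\<^sup>2 * 1 \<le> u\<^sup>2 * real_of_int (a\<^sup>2 + (b\<^sup>2 + d\<^sup>2 + 2 * c\<^sup>2))" by (intro mult_left_mono) auto
  also have "\<dots> = 0 + 1 * (u\<^sup>2 * of_int (a\<^sup>2)) + u\<^sup>2 * of_int (b\<^sup>2 + d\<^sup>2 + 2 * c\<^sup>2)" by (simp add: algebra_simps)
  also have "\<dots> \<le> of_int (e\<^sup>2) + u\<^sup>2 * (u\<^sup>2 * of_int (a\<^sup>2)) + u\<^sup>2 * of_int (b\<^sup>2 + d\<^sup>2 + 2 * c\<^sup>2)"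
    using u2 by (intro add_mono mult_right_mono) auto
  finally show "u\<^sup>2 \<le> (norm (cone_form (real5_of p) (\<i> * of_real u, 0, \<i> * of_real u)))\<^sup>2"
    unfolding norm_sq_on_imaginary_axis [OF p] by (simp add: p' mult.assoc)
qed simp

text \<open>
  By dominated convergence the limit may be taken term by term, and outside the line
  \<open>a = b = c = d = 0\<close> the form is at least \<open>u\<close> in absolute value at \<open>diag(iu, iu)\<close>.
\<close>

lemma limit_at_cusp:
  assumes i0: "i0 \<in> I" and pl0: "pl i0 = (0, 0, 0, 0, e0)" "e0 = 1 \<or> e0 = - 1" and ev: "even k"
    and others: "\<And>i e. i \<in> I \<Longrightarrow> pl i = (0, 0, 0, 0, e) \<Longrightarrow> i = i0"
  shows "((\<lambda>u. cone_sum (\<i> * of_real u, 0, \<i> * of_real u)) \<longlongrightarrow> 1) at_top"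
proof (rule tendstoI)
  fix \<epsilon> :: real assume \<epsilon>: "\<epsilon> > 0"
  define \<tau> where "\<tau> i u = 1 / cone_form (real5_of (pl i)) (\<i> * of_real u, 0, \<i> * of_real u) ^ k" for i and u :: real
  have \<tau>0: "\<tau> i0 u = 1" for u
    using pl0 ev by (auto simp: \<tau>_def cone_form_def real5_of_def)
  have "uniform_limit {1..} (\<lambda>Y u. \<Sum>i\<in>Y. \<tau> i u) (\<lambda>u. cone_sum (\<i> * of_real u, 0, \<i> * of_real u)) (finite_subsets_at_top I)"
    unfolding cone_sum_def \<tau>_def
  proof (rule Weierstrass_m_test_general [OF _ summable_norm])
    fix i and u :: real assume i: "i \<in> I" and u: "u \<in> {1..}"
    have p: "pl i \<in> int_cone" using pl i by blast
    have "norm (real5_of (pl i)) > 0" using real5_of_cone [OF p] by simp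
    moreover have "norm (real5_of (pl i)) ^ k \<le> norm (cone_form (real5_of (pl i)) (\<i> * of_real u, 0, \<i> * of_real u)) ^ k"
      using term_lower_bound_1 [OF p] u by (intro power_mono) auto
    ultimately show "norm (1 / cone_form (real5_of (pl i)) (\<i> * of_real u, 0, \<i> * of_real u) ^ k) \<le> 1 / norm (real5_of (pl i)) ^ k"
      by (simp add: norm_divide norm_power frac_le)
  qed
  then have "\<forall>\<^sub>F Y in finite_subsets_at_top I. \<forall>u\<in>{1..}. dist (\<Sum>i\<in>Y. \<tau> i u) (cone_sum (\<i> * of_real u, 0, \<i> * of_real u)) < \<epsilon> / 2"
    using \<epsilon> by (intro uniform_limitD) auto
  then have "\<forall>\<^sub>F Y in finite_subsets_at_top I. (\<forall>u\<in>{1..}. dist (\<Sum>i\<in>Y. \<tau> i u) (cone_sum (\<i> * of_real u, 0, \<i> * of_real u)) < \<epsilon> / 2)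
      \<and> finite Y \<and> i0 \<in> Y \<and> Y \<subseteq> I"
    by (rule eventually_conj)
       (use i0 in \<open>auto simp: eventually_finite_subsets_at_top intro!: exI [of _ "{i0}"]\<close>)
  from eventually_happens [OF this]
  obtain Y where Y: "finite Y" "i0 \<in> Y" "Y \<subseteq> I"
    and d: "\<And>u. u \<ge> 1 \<Longrightarrow> dist (\<Sum>i\<in>Y. \<tau> i u) (cone_sum (\<i> * of_real u, 0, \<i> * of_real u)) < \<epsilon> / 2" by auto
  have t0: "((\<lambda>u. \<tau> i u) \<longlongrightarrow> 0) at_top" if i: "i \<in> Y - {i0}" for i
  proof (rule Lim_null_comparison)
    show "((\<lambda>u::real. 1 / u ^ k) \<longlongrightarrow> 0) at_top"
      using k by (intro tendsto_divide_0 [OF tendsto_const] filterlim_at_top_imp_at_infinity filterlim_pow_at_top filterlim_ident) auto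
    have p: "pl i \<in> int_cone" using pl i Y by blast
    obtain a b c d e where p': "pl i = (a, b, c, d, e)" by (cases "pl i")
    have nz: "fst (pl i) \<noteq> 0 \<or> fst (snd (pl i)) \<noteq> 0 \<or> fst (snd (snd (pl i))) \<noteq> 0 \<or> fst (snd (snd (snd (pl i)))) \<noteq> 0"
      using others [of i e] i Y by (auto simp: p')
    show "\<forall>\<^sub>F u in at_top. norm (\<tau> i u) \<le> 1 / u ^ k"
      using eventually_ge_at_top [of 1]
    proof eventually_elim
      case (elim u)
      have "u ^ k \<le> norm (cone_form (real5_of (pl i)) (\<i> * of_real u, 0, \<i> * of_real u)) ^ k"
        using term_lower_bound_2 [OF p nz elim] elim by (intro power_mono) auto
      then show ?case using elim by (simp add: \<tau>_def norm_divide norm_power frac_le)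
    qed
  qed
  have "((\<lambda>u. \<tau> i0 u + (\<Sum>i\<in>Y - {i0}. \<tau> i u)) \<longlongrightarrow> 1 + (\<Sum>i\<in>Y - {i0}. 0)) at_top"
    unfolding \<tau>0 by (intro tendsto_intros t0)
  then have "((\<lambda>u. \<Sum>i\<in>Y. \<tau> i u) \<longlongrightarrow> 1) at_top"
    using Y by (simp add: sum.remove [of Y i0])
  then have "\<forall>\<^sub>F u in at_top. dist (\<Sum>i\<in>Y. \<tau> i u) 1 < \<epsilon> / 2" using \<epsilon> by (intro tendstoD) auto
  then show "\<forall>\<^sub>F u in at_top. dist (cone_sum (\<i> * of_real u, 0, \<i> * of_real u)) 1 < \<epsilon>"
    using eventually_ge_at_top [of 1]
  proof eventually_elim
    case (elim u)
    show ?case using d [OF elim(2)] elim(1) by (metis dist_commute dist_triangle_half_l)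
  qed
qed

end

section \<open>Siegel Eisenstein series\<close>

text \<open>
  The blocks of the inverse of a symplectic matrix are \<open>D\<^sup>t, -B\<^sup>t, -C\<^sup>t, A\<^sup>t\<close>.
\<close>

definition symp_inv :: "mat4 \<Rightarrow> mat4" where
  "symp_inv g = (\<chi> k l. case k of
      Inl i \<Rightarrow> (case l of Inl j \<Rightarrow> g $ Inr j $ Inr i | Inr j \<Rightarrow> - (g $ Inl j $ Inr i))
    | Inr i \<Rightarrow> (case l of Inl j \<Rightarrow> - (g $ Inr j $ Inl i) | Inr j \<Rightarrow> g $ Inl j $ Inl i))"

lemma symp_inv_nth [simp]:
  "symp_inv g $ Inl i $ Inl j = g $ Inr j $ Inr i" "symp_inv g $ Inl i $ Inr j = - (g $ Inl j $ Inr i)"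
  "symp_inv g $ Inr i $ Inl j = - (g $ Inr j $ Inl i)" "symp_inv g $ Inr i $ Inr j = g $ Inl j $ Inl i"
  by (simp_all add: symp_inv_def)

lemma mat4_eq_iff: "(g :: mat4) = h \<longleftrightarrow> (\<forall>k l. g $ k $ l = h $ k $ l)"
  by (simp add: vec_eq_iff)

lemma symp_inv_mult:
  assumes "transpose g ** J4 ** g = J4"
  shows "symp_inv g ** g = mat 1" "g ** symp_inv g = mat 1"
proof -
  have e: "(g $ Inl 1 $ k * g $ Inr 1 $ l - g $ Inr 1 $ k * g $ Inl 1 $ l) +
     (g $ Inl 2 $ k * g $ Inr 2 $ l - g $ Inr 2 $ k * g $ Inl 2 $ l) = J4 $ k $ l" for k l
    using transpose_J4_mult_nth [of g k l] assms by simp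
  show *: "symp_inv g ** g = mat 1"
    unfolding mat4_eq_iff forall_2_Plus_2
    using e [of "Inr 1" "Inl 1"] e [of "Inr 1" "Inl 2"] e [of "Inr 1" "Inr 1"] e [of "Inr 1" "Inr 2"]
      e [of "Inr 2" "Inl 1"] e [of "Inr 2" "Inl 2"] e [of "Inr 2" "Inr 1"] e [of "Inr 2" "Inr 2"]
      e [of "Inl 1" "Inl 1"] e [of "Inl 1" "Inl 2"] e [of "Inl 1" "Inr 1"] e [of "Inl 1" "Inr 2"]
      e [of "Inl 2" "Inl 1"] e [of "Inl 2" "Inl 2"] e [of "Inl 2" "Inr 1"] e [of "Inl 2" "Inr 2"]
    unfolding mat4_mult_nth by (simp add: mat_def algebra_simps)
  then show "g ** symp_inv g = mat 1" using matrix_left_right_inverse by blast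
qed

lemma Sp4_Z_D: "g \<in> Sp4_Z \<Longrightarrow> transpose g ** J4 ** g = J4"
  by (simp add: Sp4_Z_def)

lemma Sp4_Z_int: "g \<in> Sp4_Z \<Longrightarrow> g $ k $ l \<in> \<int>"
  by (simp add: Sp4_Z_def)

lemma Sp4_Z_one: "mat 1 \<in> Sp4_Z"
proof -
  have "(mat 1 :: mat4) $ k $ l \<in> \<int>" for k l by (simp add: mat_def)
  then show ?thesis by (simp add: Sp4_Z_def)
qed

lemma Sp4_Z_mult:
  assumes "g \<in> Sp4_Z" "h \<in> Sp4_Z"
  shows "g ** h \<in> Sp4_Z"
proof -
  have "transpose (g ** h) ** J4 ** (g ** h) = transpose h ** (transpose g ** J4 ** g) ** h"
    by (simp add: matrix_transpose_mul matrix_mul_assoc)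
  also have "\<dots> = J4" using assms by (simp add: Sp4_Z_def)
  finally have "transpose (g ** h) ** J4 ** (g ** h) = J4" .
  moreover have "(g ** h) $ k $ l \<in> \<int>" for k l
    unfolding mat4_mult_nth using assms by (intro Ints_add Ints_mult Sp4_Z_int)
  ultimately show ?thesis by (simp add: Sp4_Z_def)
qed

lemma Sp4_Z_inv:
  assumes g: "g \<in> Sp4_Z"
  shows "symp_inv g \<in> Sp4_Z"
proof -
  note inv = symp_inv_mult [OF Sp4_Z_D [OF g]]
  have "transpose (symp_inv g) ** transpose g = mat 1"
    using arg_cong [OF inv(2), of transpose] by (simp add: matrix_transpose_mul)
  moreover have "transpose (symp_inv g) ** (transpose g ** J4 ** g) ** symp_inv g
      = (transpose (symp_inv g) ** transpose g) ** J4 ** (g ** symp_inv g)"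
    by (simp only: matrix_mul_assoc)
  ultimately have "transpose (symp_inv g) ** J4 ** symp_inv g = J4" using inv(2) Sp4_Z_D [OF g] by simp
  moreover have "\<forall>k l. symp_inv g $ k $ l \<in> \<int>"
    unfolding forall_2_Plus_2 using Sp4_Z_int [OF g] by simp
  ultimately show ?thesis by (simp add: Sp4_Z_def)
qed

lemma Gamma_inf_iff: "g \<in> Gamma_inf \<longleftrightarrow> g \<in> Sp4_Z \<and> (\<forall>i j. g $ Inr i $ Inl j = 0)"
  by (auto simp: Gamma_inf_def block_C_def vec_eq_iff)

lemma Gamma_inf_one: "mat 1 \<in> Gamma_inf"
  by (simp add: Gamma_inf_iff Sp4_Z_one) (simp add: mat_def)

lemma Gamma_inf_mult: "g \<in> Gamma_inf \<Longrightarrow> h \<in> Gamma_inf \<Longrightarrow> g ** h \<in> Gamma_inf"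
  by (simp add: Gamma_inf_iff Sp4_Z_mult mat4_mult_nth)

lemma Gamma_inf_inv: "g \<in> Gamma_inf \<Longrightarrow> symp_inv g \<in> Gamma_inf"
  by (simp add: Gamma_inf_iff Sp4_Z_inv)

lemma block_mult:
  "block_A (g ** h) = block_A g ** block_A h + block_B g ** block_C h"
  "block_B (g ** h) = block_A g ** block_B h + block_B g ** block_D h"
  "block_C (g ** h) = block_C g ** block_A h + block_D g ** block_C h"
  "block_D (g ** h) = block_C g ** block_B h + block_D g ** block_D h"
  by (simp_all add: mat2_eq_iff matrix_mult_2_nth mat4_mult_nth block_A_def block_B_def block_C_def block_D_def
      of_rat_add of_rat_mult)

lemma matrix_add_rdistrib: "(A + B) ** C = A ** C + B ** C"
  for A B :: "'a::semiring_1^'n^'m"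
  by (simp add: matrix_matrix_mult_def vec_eq_iff distrib_right sum.distrib)

lemma j_factor_cocycle:
  assumes "j_factor h Z \<noteq> 0"
  shows "j_factor (g ** h) Z = j_factor g (act h Z) * j_factor h Z"
proof -
  define M where "M = block_C h ** Z + block_D h"
  have "invertible M" using assms by (simp add: M_def j_factor_def invertible_det_nz)
  then obtain M' where M': "M ** M' = mat 1" "M' ** M = mat 1" unfolding invertible_def by blast
  have "(block_C g ** act h Z + block_D g) ** M
      = block_C g ** ((block_A h ** Z + block_B h) ** (M' ** M)) + block_D g ** M"
    unfolding act_def M_def [symmetric] matrix_inv_eqI [OF M'(1)]
    by (simp only: matrix_add_rdistrib matrix_add_ldistrib matrix_mul_assoc)
  also have "\<dots> = block_C g ** (block_A h ** Z + block_B h) + block_D g ** M"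
    by (simp add: M')
  also have "\<dots> = block_C (g ** h) ** Z + block_D (g ** h)"
    unfolding M_def block_mult
    by (simp add: matrix_add_ldistrib matrix_add_rdistrib matrix_mul_assoc add_ac)
  finally show ?thesis
    using arg_cong [of _ _ det] unfolding j_factor_def M_def [symmetric] det_mul [symmetric] by simp
qed

text \<open>
  For \<open>C = 0\<close> the blocks satisfy \<open>D A\<^sup>t = 1\<close>, so both determinants are integral units.
\<close>

lemma Gamma_inf_det_sign:
  assumes "h \<in> Gamma_inf"
  shows "det (block_D h) = 1 \<or> det (block_D h) = - 1"
proof -
  have h: "h \<in> Sp4_Z" and C: "\<And>i j. h $ Inr i $ Inl j = 0" using assms by (auto simp: Gamma_inf_iff)
  have "(h ** symp_inv h) $ Inr i $ Inr j = (mat 1 :: mat4) $ Inr i $ Inr j" for i j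
    using symp_inv_mult [OF Sp4_Z_D [OF h]] by simp
  then have e: "h $ Inr i $ Inr 1 * h $ Inl j $ Inl 1 + h $ Inr i $ Inr 2 * h $ Inl j $ Inl 2 = (if i = j then 1 else 0)" for i j
    unfolding mat4_mult_nth by (simp add: C mat_def)
  define x where "x = h $ Inr 1 $ Inr 1 * h $ Inr 2 $ Inr 2 - h $ Inr 1 $ Inr 2 * h $ Inr 2 $ Inr 1"
  define y where "y = h $ Inl 1 $ Inl 1 * h $ Inl 2 $ Inl 2 - h $ Inl 1 $ Inl 2 * h $ Inl 2 $ Inl 1"
  have "x * y = (h $ Inr 1 $ Inr 1 * h $ Inl 1 $ Inl 1 + h $ Inr 1 $ Inr 2 * h $ Inl 1 $ Inl 2) *
      (h $ Inr 2 $ Inr 1 * h $ Inl 2 $ Inl 1 + h $ Inr 2 $ Inr 2 * h $ Inl 2 $ Inl 2)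
      - (h $ Inr 1 $ Inr 1 * h $ Inl 2 $ Inl 1 + h $ Inr 1 $ Inr 2 * h $ Inl 2 $ Inl 2) *
      (h $ Inr 2 $ Inr 1 * h $ Inl 1 $ Inl 1 + h $ Inr 2 $ Inr 2 * h $ Inl 1 $ Inl 2)"
    unfolding x_def y_def by (simp add: algebra_simps)
  then have xy: "x * y = 1" unfolding e by simp
  have "x \<in> \<int>" "y \<in> \<int>" unfolding x_def y_def by (intro Ints_diff Ints_mult Sp4_Z_int h)+
  then obtain m n :: int where mn: "x = of_int m" "y = of_int n" by (auto elim!: Ints_cases)
  then have "of_int (m * n) = (1 :: rat)" using xy by simp
  then have "m * n = 1" by (simp only: of_int_eq_1_iff)
  then have "x = 1 \<or> x = - 1" unfolding mn using zmult_eq_1_iff by auto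
  moreover have "det (block_D h) = of_rat x"
    by (simp add: det_2 block_D_def x_def of_rat_diff of_rat_mult)
  ultimately show ?thesis by (auto simp: of_rat_minus)
qed

lemma j_factor_Gamma_inf_mult:
  assumes h: "h \<in> Gamma_inf"
  shows "j_factor (h ** g) Z = det (block_D h) * j_factor g Z"
proof -
  have "block_C h = 0" using h by (simp add: Gamma_inf_def)
  then have "block_C (h ** g) ** Z + block_D (h ** g) = block_D h ** (block_C g ** Z + block_D g)"
    unfolding block_mult by (simp add: matrix_add_ldistrib matrix_mul_assoc)
  then show ?thesis unfolding j_factor_def by (simp add: det_mul)
qed

definition inf_coset :: "mat4 \<Rightarrow> mat4 set" where
  "inf_coset a = (\<lambda>h. h ** a) ` Gamma_inf"

lemma rcosets_eq: "rcosets\<^bsub>GSp4_plus\<lparr>carrier := Sp4_Z\<rparr>\<^esub> Gamma_inf = inf_coset ` Sp4_Z"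
  by (auto simp: RCOSETS_def r_coset_def GSp4_plus_def inf_coset_def)

definition coset_rep :: "mat4 set \<Rightarrow> mat4" where
  "coset_rep c = (SOME g. g \<in> c)"

lemma coset_eqI:
  assumes a: "a \<in> Sp4_Z" and \<gamma>: "\<gamma> \<in> Gamma_inf"
  shows "inf_coset (\<gamma> ** a) = inf_coset a"
proof (intro equalityI subsetI)
  fix x assume "x \<in> inf_coset (\<gamma> ** a)"
  then obtain h where "h \<in> Gamma_inf" "x = h ** \<gamma> ** a" by (auto simp: inf_coset_def matrix_mul_assoc)
  then show "x \<in> inf_coset a" using Gamma_inf_mult \<gamma> by (auto simp: inf_coset_def)
next
  fix x assume "x \<in> inf_coset a"
  then obtain h where h: "h \<in> Gamma_inf" "x = h ** a" by (auto simp: inf_coset_def)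
  have "symp_inv \<gamma> ** \<gamma> = mat 1" using \<gamma> by (intro symp_inv_mult Sp4_Z_D) (simp add: Gamma_inf_iff)
  moreover have "h ** symp_inv \<gamma> ** (\<gamma> ** a) = h ** (symp_inv \<gamma> ** \<gamma>) ** a"
    by (simp only: matrix_mul_assoc)
  ultimately have "x = h ** symp_inv \<gamma> ** (\<gamma> ** a)"
    using h by simp
  then show "x \<in> inf_coset (\<gamma> ** a)" using h Gamma_inf_mult Gamma_inf_inv [OF \<gamma>] by (auto simp: inf_coset_def)
qed

lemma rep_coset:
  assumes a: "a \<in> Sp4_Z"
  obtains \<gamma> where "\<gamma> \<in> Gamma_inf" "coset_rep (inf_coset a) = \<gamma> ** a"
proof -
  have "mat 1 ** a \<in> inf_coset a" unfolding inf_coset_def using Gamma_inf_one by blast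
  then have "coset_rep (inf_coset a) \<in> inf_coset a" unfolding coset_rep_def by (rule someI)
  then show thesis using that by (auto simp: inf_coset_def)
qed

lemma rep_coset_props:
  assumes a: "a \<in> Sp4_Z"
  shows "coset_rep (inf_coset a) \<in> Sp4_Z" "inf_coset (coset_rep (inf_coset a)) = inf_coset a"
proof -
  obtain \<gamma> where \<gamma>: "\<gamma> \<in> Gamma_inf" "coset_rep (inf_coset a) = \<gamma> ** a" using rep_coset [OF a] .
  then show "coset_rep (inf_coset a) \<in> Sp4_Z" using a Sp4_Z_mult by (auto simp: Gamma_inf_iff)
  show "inf_coset (coset_rep (inf_coset a)) = inf_coset a" unfolding \<gamma>(2) by (rule coset_eqI [OF a \<gamma>(1)])
qed

lemma j_factor_rep_power:
  assumes "a \<in> Sp4_Z" "even k"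
  shows "j_factor (coset_rep (inf_coset a)) Z ^ k = j_factor a Z ^ k"
proof -
  obtain \<gamma> where \<gamma>: "\<gamma> \<in> Gamma_inf" "coset_rep (inf_coset a) = \<gamma> ** a" using rep_coset [OF assms(1)] .
  have "det (block_D \<gamma>) ^ k = 1" using Gamma_inf_det_sign [OF \<gamma>(1)] assms(2) by auto
  then show ?thesis unfolding \<gamma>(2) j_factor_Gamma_inf_mult [OF \<gamma>(1)] by (simp add: power_mult_distrib)
qed

lemma coset_right_mult_bij:
  assumes g: "g \<in> Sp4_Z"
  shows "bij_betw (\<lambda>c. (\<lambda>a. a ** g) ` c) (inf_coset ` Sp4_Z) (inf_coset ` Sp4_Z)"
proof (rule bij_betwI [where g = "\<lambda>c. (\<lambda>a. a ** symp_inv g) ` c"])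
  have im: "(\<lambda>a. a ** x) ` inf_coset a = inf_coset (a ** x)" for a x
    by (auto simp: inf_coset_def image_image matrix_mul_assoc)
  note inv = symp_inv_mult [OF Sp4_Z_D [OF g]]
  show "(\<lambda>c. (\<lambda>a. a ** g) ` c) \<in> inf_coset ` Sp4_Z \<rightarrow> inf_coset ` Sp4_Z"
    using g by (auto simp: im intro!: Sp4_Z_mult)
  show "(\<lambda>c. (\<lambda>a. a ** symp_inv g) ` c) \<in> inf_coset ` Sp4_Z \<rightarrow> inf_coset ` Sp4_Z"
    using Sp4_Z_inv [OF g] by (auto simp: im intro!: Sp4_Z_mult)
  show "(\<lambda>a. a ** symp_inv g) ` (\<lambda>a. a ** g) ` c = c" for c
    using inv by (simp add: image_image matrix_mul_assoc [symmetric])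
  show "(\<lambda>a. a ** g) ` (\<lambda>a. a ** symp_inv g) ` c = c" for c
    using inv by (simp add: image_image matrix_mul_assoc [symmetric])
qed

lemma siegel_E_eq: "siegel_E k Z = (\<Sum>\<^sub>\<infinity>c\<in>inf_coset ` Sp4_Z. 1 / j_factor (coset_rep c) Z ^ k)"
  by (simp add: siegel_E_def rcosets_eq coset_rep_def)

text \<open>
  Right multiplication by \<open>g\<close> permutes the cosets, and the cocycle relation compares their terms.
\<close>

lemma siegel_E_invariant:
  assumes g: "g \<in> Gamma_inf" and j: "j_factor g Z = 1" and k: "even k"
  shows "siegel_E k (act g Z) = siegel_E k Z"
proof -
  have gS: "g \<in> Sp4_Z" using g by (simp add: Gamma_inf_iff)
  define \<Phi> :: "mat4 set \<Rightarrow> mat4 set" where "\<Phi> = (\<lambda>c. (\<lambda>a. a ** g) ` c)"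
  have eq: "1 / j_factor (coset_rep c) (act g Z) ^ k = 1 / j_factor (coset_rep (\<Phi> c)) Z ^ k" if "c \<in> inf_coset ` Sp4_Z" for c
  proof -
    from that obtain a where a: "c = inf_coset a" "a \<in> Sp4_Z" by (rule imageE)
    have "\<Phi> c = inf_coset (a ** g)" by (auto simp: \<Phi>_def a inf_coset_def image_image matrix_mul_assoc)
    then have "j_factor (coset_rep (\<Phi> c)) Z ^ k = j_factor (a ** g) Z ^ k"
      using j_factor_rep_power [OF Sp4_Z_mult [OF a(2) gS] k] by simp
    also have "\<dots> = j_factor a (act g Z) ^ k" using j by (simp add: j_factor_cocycle)
    also have "\<dots> = j_factor (coset_rep c) (act g Z) ^ k" using j_factor_rep_power [OF a(2) k] by (simp add: a)
    finally show ?thesis by simp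
  qed
  have "siegel_E k (act g Z) = (\<Sum>\<^sub>\<infinity>c\<in>inf_coset ` Sp4_Z. 1 / j_factor (coset_rep (\<Phi> c)) Z ^ k)"
    unfolding siegel_E_eq by (rule infsum_cong) (rule eq)
  also have "\<dots> = siegel_E k Z"
    unfolding siegel_E_eq using coset_right_mult_bij [OF gS] unfolding \<Phi>_def [symmetric]
    by (rule infsum_reindex_bij_betw)
  finally show ?thesis .
qed

definition bottom_minor :: "mat4 \<Rightarrow> 2 + 2 \<Rightarrow> 2 + 2 \<Rightarrow> rat" where
  "bottom_minor g k l = g $ Inr 1 $ k * g $ Inr 2 $ l - g $ Inr 1 $ l * g $ Inr 2 $ k"

text \<open>
  The order of the columns in the fourth minor gives the sign for which the Pluecker relation reads
  \<open>ae = bd - c\<^sup>2\<close>. The sixth minor is the negative of the third because the rows are isotropic.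
\<close>

definition plucker :: "mat4 \<Rightarrow> int5" where
  "plucker g = (\<lfloor>bottom_minor g (Inl 1) (Inl 2)\<rfloor>, \<lfloor>bottom_minor g (Inl 1) (Inr 2)\<rfloor>, \<lfloor>bottom_minor g (Inl 1) (Inr 1)\<rfloor>,
     \<lfloor>bottom_minor g (Inr 1) (Inl 2)\<rfloor>, \<lfloor>bottom_minor g (Inr 1) (Inr 2)\<rfloor>)"

lemma minor_int: "g \<in> Sp4_Z \<Longrightarrow> of_int \<lfloor>bottom_minor g k l\<rfloor> = bottom_minor g k l"
proof -
  assume "g \<in> Sp4_Z"
  then have "bottom_minor g k l \<in> \<int>" unfolding bottom_minor_def by (intro Ints_diff Ints_mult Sp4_Z_int)
  then show ?thesis by (auto elim: Ints_cases)
qed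

lemma minor_swap: "bottom_minor g l k = - bottom_minor g k l" and minor_self: "bottom_minor g k k = 0"
  by (simp_all add: bottom_minor_def)

lemma bottom_rows_isotropic:
  assumes g: "g \<in> Sp4_Z"
  shows "g $ Inr i $ Inl 1 * g $ Inr j $ Inr 1 + g $ Inr i $ Inl 2 * g $ Inr j $ Inr 2 =
    g $ Inr i $ Inr 1 * g $ Inr j $ Inl 1 + g $ Inr i $ Inr 2 * g $ Inr j $ Inl 2"
proof -
  have "(g ** symp_inv g) $ Inr i $ Inl j = (mat 1 :: mat4) $ Inr i $ Inl j"
    using symp_inv_mult [OF Sp4_Z_D [OF g]] by simp
  then show ?thesis unfolding mat4_mult_nth by (simp add: mat_def)
qed

lemma minor_relation: "g \<in> Sp4_Z \<Longrightarrow> bottom_minor g (Inl 2) (Inr 2) = - bottom_minor g (Inl 1) (Inr 1)"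
  using bottom_rows_isotropic [of g 1 2] by (simp add: bottom_minor_def algebra_simps)

lemma minor_nonzero:
  assumes g: "g \<in> Sp4_Z"
  obtains k l where "bottom_minor g k l \<noteq> 0"
proof (rule ccontr)
  assume "\<not> thesis"
  then have 0: "bottom_minor g k l = 0" for k l using that by blast
  have e: "(g ** symp_inv g) $ Inr i $ Inr j = (mat 1 :: mat4) $ Inr i $ Inr j" for i j
    using symp_inv_mult [OF Sp4_Z_D [OF g]] by simp
  have s: "g $ Inr 1 $ k * g $ Inr 2 $ l = g $ Inr 2 $ k * g $ Inr 1 $ l" for k l
    using 0 [of k l] by (simp add: bottom_minor_def mult.commute)
  have r1: "g $ Inr 1 $ k = 0" for k
  proof -
    have "g $ Inr 1 $ k = g $ Inr 1 $ k * (g ** symp_inv g) $ Inr 2 $ Inr 2"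
      unfolding e by (simp add: mat_def)
    also have "\<dots> = g $ Inr 2 $ k * (g ** symp_inv g) $ Inr 1 $ Inr 2"
      unfolding mat4_mult_nth distrib_left mult.assoc [symmetric] s by simp
    also have "\<dots> = 0" unfolding e by (simp add: mat_def)
    finally show ?thesis .
  qed
  have "(g ** symp_inv g) $ Inr 1 $ Inr 1 = 0" unfolding mat4_mult_nth by (simp add: r1)
  then show False unfolding e by (simp add: mat_def)
qed

lemma minors_determined:
  assumes g: "g \<in> Sp4_Z" and h: "h \<in> Sp4_Z" and eq: "plucker g = plucker h"
  shows "bottom_minor g k l = bottom_minor h k l"
proof -
  note i = minor_int [OF g, symmetric] minor_int [OF h, symmetric]
  have *: "bottom_minor g (Inl 1) (Inl 2) = bottom_minor h (Inl 1) (Inl 2)" "bottom_minor g (Inl 1) (Inr 2) = bottom_minor h (Inl 1) (Inr 2)"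
    "bottom_minor g (Inl 1) (Inr 1) = bottom_minor h (Inl 1) (Inr 1)" "bottom_minor g (Inr 1) (Inl 2) = bottom_minor h (Inr 1) (Inl 2)"
    "bottom_minor g (Inr 1) (Inr 2) = bottom_minor h (Inr 1) (Inr 2)"
    using eq unfolding plucker_def by (metis (no_types, lifting) i prod.inject)+
  have "\<forall>k l. bottom_minor g k l = bottom_minor h k l"
    unfolding forall_2_Plus_2
    using * minor_relation [OF g] minor_relation [OF h]
      minor_swap [of g "Inl 1" "Inl 2"] minor_swap [of h "Inl 1" "Inl 2"]
      minor_swap [of g "Inl 1" "Inr 2"] minor_swap [of h "Inl 1" "Inr 2"]
      minor_swap [of g "Inl 1" "Inr 1"] minor_swap [of h "Inl 1" "Inr 1"]
      minor_swap [of g "Inr 1" "Inl 2"] minor_swap [of h "Inr 1" "Inl 2"]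
      minor_swap [of g "Inr 1" "Inr 2"] minor_swap [of h "Inr 1" "Inr 2"]
      minor_swap [of g "Inl 2" "Inr 2"] minor_swap [of h "Inl 2" "Inr 2"]
    by (simp add: minor_self)
  then show ?thesis by blast
qed

text \<open>
  The wedge product of a row with the two-vector of both rows vanishes.
\<close>

lemma row_in_span:
  assumes "i = 1 \<or> i = (2 :: 2)"
  shows "bottom_minor g k l * g $ Inr i $ m = bottom_minor g k m * g $ Inr i $ l - bottom_minor g l m * g $ Inr i $ k"
  using assms by (auto simp: bottom_minor_def algebra_simps)

text \<open>
  With equal minors, each lower row of \<open>h\<close> lies in the span of the lower rows of \<open>g\<close>, on which the
  symplectic form vanishes. The values of that form are the entries of the lower left block of
  \<open>h g\<^sup>-\<^sup>1\<close>, so this matrix lies in \<open>Gamma_inf\<close>.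
\<close>

lemma plucker_eq_imp_coset_eq:
  assumes g: "g \<in> Sp4_Z" and h: "h \<in> Sp4_Z" and eq: "plucker g = plucker h"
  shows "inf_coset g = inf_coset h"
proof -
  obtain k l where kl: "bottom_minor g k l \<noteq> 0" using minor_nonzero [OF g] .
  define D where "D = h ** symp_inv g"
  have "D $ Inr i $ Inl j = 0" for i j
  proof -
    define v where "v m = h $ Inr i $ m" for m
    define w where "w m = g $ Inr j $ m" for m
    have v: "bottom_minor g k l * v m = (v l * g $ Inr 1 $ k - v k * g $ Inr 1 $ l) * g $ Inr 2 $ m
        + (v k * g $ Inr 2 $ l - v l * g $ Inr 2 $ k) * g $ Inr 1 $ m" for m
    proof -
      have "bottom_minor h k l * v m = bottom_minor h k m * v l - bottom_minor h l m * v k"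
        unfolding v_def by (rule row_in_span) (use exhaust_2 in blast)
      then have "bottom_minor g k l * v m = bottom_minor g k m * v l - bottom_minor g l m * v k"
        by (simp add: minors_determined [OF g h eq])
      also have "\<dots> = (v l * g $ Inr 1 $ k - v k * g $ Inr 1 $ l) * g $ Inr 2 $ m
        + (v k * g $ Inr 2 $ l - v l * g $ Inr 2 $ k) * g $ Inr 1 $ m"
        by (simp add: bottom_minor_def algebra_simps)
      finally show ?thesis .
    qed
    define x y where "x = v l * g $ Inr 1 $ k - v k * g $ Inr 1 $ l" and "y = v k * g $ Inr 2 $ l - v l * g $ Inr 2 $ k"
    have Dij: "D $ Inr i $ Inl j = v (Inl 1) * w (Inr 1) + v (Inl 2) * w (Inr 2) - v (Inr 1) * w (Inl 1) - v (Inr 2) * w (Inl 2)"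
      by (simp add: D_def mat4_mult_nth v_def w_def)
    have "bottom_minor g k l * D $ Inr i $ Inl j = (bottom_minor g k l * v (Inl 1)) * w (Inr 1) + (bottom_minor g k l * v (Inl 2)) * w (Inr 2)
        - (bottom_minor g k l * v (Inr 1)) * w (Inl 1) - (bottom_minor g k l * v (Inr 2)) * w (Inl 2)"
      unfolding Dij by (simp add: algebra_simps)
    also have "\<dots> = x * ((g $ Inr 2 $ Inl 1 * w (Inr 1) + g $ Inr 2 $ Inl 2 * w (Inr 2)) - (g $ Inr 2 $ Inr 1 * w (Inl 1) + g $ Inr 2 $ Inr 2 * w (Inl 2)))
        + y * ((g $ Inr 1 $ Inl 1 * w (Inr 1) + g $ Inr 1 $ Inl 2 * w (Inr 2)) - (g $ Inr 1 $ Inr 1 * w (Inl 1) + g $ Inr 1 $ Inr 2 * w (Inl 2)))"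
      unfolding v x_def [symmetric] y_def [symmetric] by (simp add: algebra_simps)
    also have "\<dots> = 0"
      unfolding w_def using bottom_rows_isotropic [OF g, of 1 j] bottom_rows_isotropic [OF g, of 2 j] by simp
    finally show ?thesis using kl by simp
  qed
  then have "D \<in> Gamma_inf" unfolding Gamma_inf_iff D_def using Sp4_Z_mult [OF h Sp4_Z_inv [OF g]] by simp
  then have "inf_coset (D ** g) = inf_coset g" by (rule coset_eqI [OF g])
  moreover have "D ** g = h"
    unfolding D_def using symp_inv_mult(1) [OF Sp4_Z_D [OF g]] by (simp add: matrix_mul_assoc [symmetric])
  ultimately show ?thesis by simp
qed

lemma plucker_int_cone:
  assumes g: "g \<in> Sp4_Z"
  shows "plucker g \<in> int_cone"
proof -
  obtain a b c d e where p: "plucker g = (a, b, c, d, e)" by (cases "plucker g")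
  have abc: "of_int a = bottom_minor g (Inl 1) (Inl 2)" "of_int b = bottom_minor g (Inl 1) (Inr 2)" "of_int c = bottom_minor g (Inl 1) (Inr 1)"
    "of_int d = bottom_minor g (Inr 1) (Inl 2)" "of_int e = bottom_minor g (Inr 1) (Inr 2)"
    using p minor_int [OF g] by (auto simp: plucker_def)
  have "bottom_minor g (Inl 1) (Inl 2) * bottom_minor g (Inr 1) (Inr 2) =
      bottom_minor g (Inl 1) (Inr 2) * bottom_minor g (Inr 1) (Inl 2) + bottom_minor g (Inl 1) (Inr 1) * bottom_minor g (Inl 2) (Inr 2)"
    by (simp add: bottom_minor_def algebra_simps)
  then have "of_int (a * e) = (of_int (b * d - c\<^sup>2) :: rat)"
    by (simp add: abc minor_relation [OF g] power2_eq_square)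
  then have "a * e = b * d - c\<^sup>2" by (simp only: of_int_eq_iff)
  moreover have "(a, b, c, d, e) \<noteq> (0, 0, 0, 0, 0)"
  proof
    assume "(a, b, c, d, e) = (0, 0, 0, 0, 0)"
    then have z: "bottom_minor g (Inl 1) (Inl 2) = 0" "bottom_minor g (Inl 1) (Inr 2) = 0" "bottom_minor g (Inl 1) (Inr 1) = 0"
      "bottom_minor g (Inr 1) (Inl 2) = 0" "bottom_minor g (Inr 1) (Inr 2) = 0"
      using abc by auto
    have "\<forall>k l. bottom_minor g k l = 0"
      unfolding forall_2_Plus_2
      using z minor_relation [OF g] minor_swap [of g "Inl 1" "Inl 2"] minor_swap [of g "Inl 1" "Inr 2"]
        minor_swap [of g "Inl 1" "Inr 1"] minor_swap [of g "Inr 1" "Inl 2"] minor_swap [of g "Inr 1" "Inr 2"]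
        minor_swap [of g "Inl 2" "Inr 2"]
      by (simp add: minor_self)
    then show False using minor_nonzero [OF g] by metis
  qed
  ultimately show ?thesis by (simp add: p int_cone_def)
qed

lemma j_factor_eq_cone_form:
  assumes g: "g \<in> Sp4_Z"
  shows "j_factor g (to_matrix P) = cone_form (real5_of (plucker g)) P"
proof -
  obtain t z s where P: "P = (t, z, s)" by (cases P)
  have m: "of_real (real_of_int \<lfloor>bottom_minor g k l\<rfloor>) = (of_rat (bottom_minor g k l) :: complex)" for k l
    using minor_int [OF g, of k l] by (metis of_rat_of_int_eq of_real_of_int_eq)
  have "j_factor g (to_matrix P) = of_rat (bottom_minor g (Inl 1) (Inl 2)) * (t * s - z\<^sup>2) + of_rat (bottom_minor g (Inl 1) (Inr 2)) * t
      + (of_rat (bottom_minor g (Inl 2) (Inr 2)) - of_rat (bottom_minor g (Inl 1) (Inr 1))) * z + of_rat (bottom_minor g (Inr 1) (Inl 2)) * s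
      + of_rat (bottom_minor g (Inr 1) (Inr 2))"
    by (simp add: j_factor_def det_2 matrix_mult_2_nth block_C_def block_D_def P bottom_minor_def of_rat_diff of_rat_mult
        power2_eq_square algebra_simps)
  also have "\<dots> = cone_form (real5_of (plucker g)) P"
    unfolding minor_relation [OF g]
    by (simp add: cone_form_def real5_of_def plucker_def P m of_rat_minus algebra_simps del: of_real_of_int_eq)
  finally show ?thesis .
qed

lemma plucker_at_cusp:
  assumes g: "g \<in> Sp4_Z" and p: "plucker g = (0, 0, 0, 0, e)"
  shows "inf_coset g = inf_coset (mat 1)"
proof -
  have z: "bottom_minor g (Inl 1) (Inr 2) = 0" "bottom_minor g (Inl 1) (Inr 1) = 0"
      "bottom_minor g (Inr 1) (Inl 2) = 0"
    using p minor_int [OF g, of "Inl 1" "Inr 2"] minor_int [OF g, of "Inl 1" "Inr 1"]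
      minor_int [OF g, of "Inr 1" "Inl 2"] by (auto simp: plucker_def)
  then have z': "bottom_minor g (Inr 1) (Inl 1) = 0" "bottom_minor g (Inr 2) (Inl 1) = 0" "bottom_minor g (Inr 2) (Inl 2) = 0"
    using minor_relation [OF g] minor_swap [of g "Inl 1" "Inr 2"] minor_swap [of g "Inl 1" "Inr 1"]
      minor_swap [of g "Inl 2" "Inr 2"] by auto
  have "e \<noteq> 0" using plucker_int_cone [OF g] by (auto simp: p int_cone_def)
  then have e: "bottom_minor g (Inr 1) (Inr 2) \<noteq> 0" using p minor_int [OF g, of "Inr 1" "Inr 2"] by (auto simp: plucker_def)
  have "g $ Inr i $ Inl j = 0" for i j
  proof -
    have "bottom_minor g (Inr 1) (Inr 2) * g $ Inr i $ Inl j = 0"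
      unfolding row_in_span [OF exhaust_2, of g "Inr 1" "Inr 2" i "Inl j"]
      using exhaust_2 [of j] z z' by auto
    then show ?thesis using e by simp
  qed
  then have "g \<in> Gamma_inf" using g by (simp add: Gamma_inf_iff)
  from coset_eqI [OF Sp4_Z_one this] show ?thesis by simp
qed

lemma plucker_Gamma_inf:
  assumes "g \<in> Gamma_inf"
  obtains e where "plucker g = (0, 0, 0, 0, e)" "e = 1 \<or> e = - 1"
proof -
  have g: "g \<in> Sp4_Z" and C: "\<And>i j. g $ Inr i $ Inl j = 0" using assms by (auto simp: Gamma_inf_iff)
  have "det (block_D g) = of_rat (bottom_minor g (Inr 1) (Inr 2))"
    by (simp add: det_2 block_D_def bottom_minor_def of_rat_diff of_rat_mult)
  then have "of_rat (bottom_minor g (Inr 1) (Inr 2)) = (1::complex) \<or> of_rat (bottom_minor g (Inr 1) (Inr 2)) = (- 1 :: complex)"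
    using Gamma_inf_det_sign [OF assms] by simp
  then have "bottom_minor g (Inr 1) (Inr 2) = 1 \<or> bottom_minor g (Inr 1) (Inr 2) = - 1"
    by (metis of_rat_1 of_rat_eq_iff of_rat_minus)
  then have "bottom_minor g (Inr 1) (Inr 2) = of_int 1 \<or> bottom_minor g (Inr 1) (Inr 2) = of_int (- 1)" by simp
  then have "\<lfloor>bottom_minor g (Inr 1) (Inr 2)\<rfloor> = 1 \<or> \<lfloor>bottom_minor g (Inr 1) (Inr 2)\<rfloor> = - 1" by (metis floor_of_int)
  moreover have "plucker g = (0, 0, 0, 0, \<lfloor>bottom_minor g (Inr 1) (Inr 2)\<rfloor>)"
    by (simp add: plucker_def bottom_minor_def C)
  ultimately show thesis using that by blast
qed

theorem siegel_E_properties: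
  assumes k4: "k \<ge> 4" and even: "even k"
  shows "periodic_holomorphic (\<lambda>P. siegel_E k (to_matrix P))"
    and "sl2_invariant (\<lambda>P. siegel_E k (to_matrix P))"
    and "((\<lambda>u. siegel_E k (to_matrix (\<i> * of_real u, 0, \<i> * of_real u))) \<longlongrightarrow> 1) at_top"
proof -
  define C where "C = inf_coset ` Sp4_Z"
  have rep_C: "coset_rep c \<in> Sp4_Z" "inf_coset (coset_rep c) = c" if "c \<in> C" for c
    using that rep_coset_props by (auto simp: C_def)
  interpret cone_series C "\<lambda>c. plucker (coset_rep c)" k
  proof
    show "inj_on (\<lambda>c. plucker (coset_rep c)) C"
      by (rule inj_onI) (metis rep_C plucker_eq_imp_coset_eq)
    show "(\<lambda>c. plucker (coset_rep c)) ` C \<subseteq> int_cone"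
      using rep_C plucker_int_cone by auto
  qed (rule k4)
  have E_eq: "siegel_E k (to_matrix P) = cone_sum P" for P
    unfolding siegel_E_eq cone_sum_def C_def [symmetric]
    by (rule infsum_cong) (simp add: j_factor_eq_cone_form rep_C)
  have inv: "siegel_E k (act g Z) = siegel_E k Z" if "g \<in> Gamma_inf" "\<And>Z. j_factor g Z = 1" "Z \<in> H2" for g Z
    using siegel_E_invariant [OF that(1) that(2) even] .
  show "sl2_invariant (\<lambda>P. siegel_E k (to_matrix P))"
    by (rule parabolic_invariance(2)) (rule inv)
  have per: "siegel_E k (to_matrix (P + dir_vec i 1)) = siegel_E k (to_matrix P)" if "P \<in> tube" for P i
    using inv that by (rule parabolic_invariance(1))
  show "periodic_holomorphic (\<lambda>P. siegel_E k (to_matrix P))"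
    unfolding periodic_holomorphic_def using continuous holomorphic per unfolding E_eq by blast
  have c0: "inf_coset (mat 1) \<in> C" by (simp add: C_def Sp4_Z_one)
  obtain \<gamma> where \<gamma>: "\<gamma> \<in> Gamma_inf" "coset_rep (inf_coset (mat 1)) = \<gamma> ** mat 1" using rep_coset [OF Sp4_Z_one] .
  obtain e0 where e0: "plucker (coset_rep (inf_coset (mat 1))) = (0, 0, 0, 0, e0)" "e0 = 1 \<or> e0 = - 1"
    using plucker_Gamma_inf [OF \<gamma>(1)] \<gamma>(2) by auto
  have "((\<lambda>u. cone_sum (\<i> * of_real u, 0, \<i> * of_real u)) \<longlongrightarrow> 1) at_top"
    by (rule limit_at_cusp [OF c0 e0 even]) (metis rep_C plucker_at_cusp)
  then show "((\<lambda>u. siegel_E k (to_matrix (\<i> * of_real u, 0, \<i> * of_real u))) \<longlongrightarrow> 1) at_top"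
    by (simp add: E_eq)
qed

text \<open>
  Both the constant coefficient and \<open>\<kappa>\<close> are limits along \<open>diag(iu, iu)\<close>.
\<close>

theorem eisenstein_constant_coeff:
  assumes k: "k \<ge> 4" "even k"
  shows "fourier_coeff (\<lambda>Z. \<kappa> * siegel_E k Z) 0 = \<kappa>"
proof -
  note E = siegel_E_properties [OF k]
  have "periodic_holomorphic (\<lambda>P. \<kappa> * siegel_E k (to_matrix P))"
    using E(1) unfolding periodic_holomorphic_def by (auto intro!: continuous_intros holomorphic_intros)
  moreover have "sl2_invariant (\<lambda>P. \<kappa> * siegel_E k (to_matrix P))"
    using E(2) by (auto simp: sl2_invariant_def)
  ultimately obtain C where C: "\<And>u t s. 1 \<le> u \<Longrightarrow> u \<le> t \<Longrightarrow> u \<le> s \<Longrightarrow>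
      norm (\<kappa> * siegel_E k (to_matrix (\<i> * of_real t, 0, \<i> * of_real s)) - fourier_coeff (\<lambda>Z. \<kappa> * siegel_E k Z) 0)
        \<le> C * exp (- (2 * pi * (u - 1)))"
    by (rule constant_fourier_coeff) blast
  have "((\<lambda>u. \<kappa> * siegel_E k (to_matrix (\<i> * of_real u, 0, \<i> * of_real u)) - fourier_coeff (\<lambda>Z. \<kappa> * siegel_E k Z) 0) \<longlongrightarrow> 0) at_top"
  proof (rule Lim_null_comparison)
    show "\<forall>\<^sub>F u in at_top. norm (\<kappa> * siegel_E k (to_matrix (\<i> * of_real u, 0, \<i> * of_real u)) - fourier_coeff (\<lambda>Z. \<kappa> * siegel_E k Z) 0)
        \<le> C * exp (- (2 * pi * (u - 1)))"
      using eventually_ge_at_top [of 1] by eventually_elim (rule C, auto)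
    have "((\<lambda>u. C * exp (- (2 * pi * (u - 1)))) \<longlongrightarrow> C * 0) at_top"
      by (intro tendsto_intros) real_asymp
    then show "((\<lambda>u. C * exp (- (2 * pi * (u - 1)))) \<longlongrightarrow> 0) at_top" by simp
  qed
  moreover have "((\<lambda>u. \<kappa> * siegel_E k (to_matrix (\<i> * of_real u, 0, \<i> * of_real u)) - fourier_coeff (\<lambda>Z. \<kappa> * siegel_E k Z) 0)
      \<longlongrightarrow> \<kappa> * 1 - fourier_coeff (\<lambda>Z. \<kappa> * siegel_E k Z) 0) at_top"
    by (intro tendsto_intros E(3))
  ultimately have "\<kappa> * 1 - fourier_coeff (\<lambda>Z. \<kappa> * siegel_E k Z) 0 = 0"
    using tendsto_unique [OF trivial_limit_at_top_linorder] by fastforce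
  then show ?thesis by simp
qed

section \<open>The Riemann zeta function at negative integers\<close>

lemma norm_nat_powr: "norm (of_nat (Suc n) powr (s::complex)) = real (Suc n) powr Re s"
  using norm_powr_real_powr [of "of_nat (Suc n)" s] by simp

lemma holomorphic_dirichlet_type_series:
  fixes g :: "nat \<Rightarrow> complex \<Rightarrow> complex"
  assumes hol: "\<And>n. g n holomorphic_on UNIV"
    and C: "continuous_on UNIV C"
    and le: "\<And>n s. norm (g n s) \<le> C s * real (Suc n) powr - (Re s + a)"
  shows "\<And>s. Re s > 1 - a \<Longrightarrow> summable (\<lambda>n. g n s)"
    and "(\<lambda>s. \<Sum>n. g n s) holomorphic_on {s. Re s > 1 - a}"
proof -
  have sm: "summable (\<lambda>n. real (Suc n) powr - b)" if "b > 1" for b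
    by (subst summable_Suc_iff) (use that in \<open>simp add: summable_real_powr_iff\<close>)
  show "summable (\<lambda>n. g n s)" if "Re s > 1 - a" for s
  proof (rule summable_comparison_test' [OF _ le])
    show "summable (\<lambda>n. C s * real (Suc n) powr - (Re s + a))"
      by (intro summable_mult sm) (use that in simp)
  qed
  have op: "open {s. Re s > 1 - a}" by (simp add: open_halfspace_Re_gt)
  have "\<exists>f'. ((\<lambda>s. \<Sum>n. g n s) has_field_derivative f') (at s0)" if s0: "Re s0 > 1 - a" for s0
  proof -
    define r where "r = (Re s0 - (1 - a)) / 2"
    have r: "r > 0" using s0 by (simp add: r_def)
    define b where "b = 1 + r"
    have Re: "Re s + a \<ge> b" if "s \<in> cball s0 r" for s
    proof -
      have "\<bar>Re (s0 - s)\<bar> \<le> r" using that abs_Re_le_cmod [of "s0 - s"] by (simp add: dist_norm)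
      then have "Re s0 - r \<le> Re s" by (simp add: abs_le_iff)
      moreover have "Re s0 = 2 * r + 1 - a" by (simp add: r_def)
      ultimately show ?thesis unfolding b_def by linarith
    qed
    obtain B where B: "\<And>s. s \<in> cball s0 r \<Longrightarrow> \<bar>C s\<bar> \<le> B"
    proof -
      have "compact (C ` cball s0 r)" using C by (intro compact_continuous_image) (auto intro: continuous_on_subset)
      then have "\<exists>B. \<forall>s\<in>cball s0 r. \<bar>C s\<bar> \<le> B"
        by (auto dest!: compact_imp_bounded simp: bounded_iff)
      then show thesis using that by blast
    qed
    have B0: "B \<ge> 0" using B [of s0] r by force
    have ul: "uniform_limit (cball s0 r) (\<lambda>n s. \<Sum>i<n. g i s) (\<lambda>s. \<Sum>i. g i s) sequentially"
    proof (rule Weierstrass_m_test)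
      show "summable (\<lambda>n. B * real (Suc n) powr - b)" by (intro summable_mult sm) (use r in \<open>simp add: b_def\<close>)
      fix n s assume s: "s \<in> cball s0 r"
      have "norm (g n s) \<le> C s * real (Suc n) powr - (Re s + a)" by (rule le)
      also have "\<dots> \<le> B * real (Suc n) powr - b"
        using B [OF s] B0 Re [OF s] by (intro mult_mono powr_mono) auto
      finally show "norm (g n s) \<le> B * real (Suc n) powr - b" .
    qed
    have ev: "\<forall>\<^sub>F n in sequentially. continuous_on (cball s0 r) (\<lambda>s. \<Sum>i<n. g i s) \<and> (\<lambda>s. \<Sum>i<n. g i s) holomorphic_on ball s0 r"
      using hol by (intro always_eventually allI conjI holomorphic_on_imp_continuous_on holomorphic_intros)
        (auto intro: holomorphic_on_subset)
    have "(\<lambda>s. \<Sum>i. g i s) holomorphic_on ball s0 r"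
      by (rule holomorphic_uniform_limit [OF ev ul]) auto
    then show ?thesis using r holomorphic_on_open [of "ball s0 r"] by auto
  qed
  then show "(\<lambda>s. \<Sum>n. g n s) holomorphic_on {s. Re s > 1 - a}"
    using holomorphic_on_open [OF op] by blast
qed

text \<open>
  The falling factorial, so that \<open>ffact w i / i!\<close> is the generalised binomial coefficient.
\<close>

definition ffact :: "complex \<Rightarrow> nat \<Rightarrow> complex" where
  "ffact w i = (\<Prod>l<i. w - of_nat l)"

lemma ffact_0 [simp]: "ffact w 0 = 1" and ffact_Suc: "ffact w (Suc i) = ffact w i * (w - of_nat i)"
  by (simp_all add: ffact_def)

lemma ffact_of_nat: "ffact (of_nat m) i = (if i \<le> m then of_nat (fact m) / of_nat (fact (m - i)) else 0)"
proof (induction i)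
  case (Suc i)
  show ?case
  proof (cases "Suc i \<le> m")
    case True
    then have "m - i = Suc (m - Suc i)" by simp
    then have "(fact (m - i) :: nat) = (m - i) * fact (m - Suc i)" by (metis fact_Suc of_nat_id)
    moreover have "of_nat m - of_nat i = (of_nat (m - i) :: complex)" using True by (simp add: of_nat_diff)
    ultimately show ?thesis using True Suc by (simp add: ffact_Suc)
  next
    case False
    then show ?thesis using Suc by (cases "i = m") (auto simp: ffact_Suc)
  qed
qed simp

lemma holomorphic_ffact [holomorphic_intros]:
  "f holomorphic_on A \<Longrightarrow> (\<lambda>s. ffact (f s) i) holomorphic_on A"
  unfolding ffact_def by (intro holomorphic_intros)

lemma continuous_ffact [continuous_intros]:
  "continuous_on A f \<Longrightarrow> continuous_on A (\<lambda>s. ffact (f s) i)"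
  unfolding ffact_def by (intro continuous_intros)

text \<open>
  The error of the Taylor polynomial of degree \<open>M\<close> for \<open>(n + 1)\<^sup>1\<^sup>-\<^sup>s\<close> around \<open>n\<close>, with \<open>n\<close> shifted by 1
  so that the summation starts at 0.
\<close>

definition taylor_rem :: "nat \<Rightarrow> nat \<Rightarrow> complex \<Rightarrow> complex" where
  "taylor_rem M n s = of_nat (Suc (Suc n)) powr (1 - s) - (\<Sum>j\<le>M. ffact (1 - s) j / fact j * of_nat (Suc n) powr (1 - s - of_nat j))"

text \<open>
  Taylor's theorem for \<open>(1 + x)\<^sup>w\<close> on \<open>[0, 1]\<close>, scaled by \<open>n\<^sup>w\<close> at \<open>x = 1/n\<close>.
\<close>

lemma taylor_rem_bound:
  "norm (taylor_rem M n s) \<le> norm (ffact (1 - s) (Suc M)) * 2 powr \<bar>Re (1 - s) - real (Suc M)\<bar> / fact M * real (Suc n) powr - (Re s + real M)"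
proof -
  define w where "w = 1 - s"
  define x where "x = 1 / real (Suc n)"
  have x: "0 < x" "x \<le> 1" by (auto simp: x_def)
  define f where "f i z = ffact w i * (1 + z) powr (w - of_nat i)" for i and z :: complex
  define S where "S = closed_segment 0 (1::complex)"
  have S: "\<exists>t. z = of_real t \<and> 0 \<le> t \<and> t \<le> 1" if "z \<in> S" for z
    using that by (auto simp: S_def closed_segment_def scaleR_conv_of_real)
  define B where "B = norm (ffact w (Suc M)) * 2 powr \<bar>Re w - real (Suc M)\<bar>"
  have "norm (f 0 (of_real x) - (\<Sum>i\<le>M. f i 0 * (of_real x - 0) ^ i / fact i)) \<le> B * norm (of_real x - (0::complex)) ^ Suc M / fact M"
  proof (rule complex_Taylor [where S = S])
    show "convex S" by (simp add: S_def)
    show "of_real x \<in> S" using x unfolding S_def closed_segment_def by (auto simp: scaleR_conv_of_real intro!: exI [of _ x])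
    show "0 \<in> S" by (simp add: S_def)
    fix i z assume z: "z \<in> S"
    obtain t where t: "z = of_real t" "0 \<le> t" "t \<le> 1" using S [OF z] by blast
    have "1 + z \<notin> \<real>\<^sub>\<le>\<^sub>0" using t by (auto simp: complex_nonpos_Reals_iff)
    then show "(f i has_field_derivative f (Suc i) z) (at z within S)"
      unfolding f_def ffact_Suc by (auto intro!: derivative_eq_intros simp: algebra_simps)
  next
    fix z assume z: "z \<in> S"
    obtain t where t: "z = of_real t" "0 \<le> t" "t \<le> 1" using S [OF z] by blast
    have "norm ((1 + z) powr (w - of_nat (Suc M))) = (1 + t) powr (Re w - real (Suc M))"
      using norm_powr_real_powr [of "1 + z" "w - of_nat (Suc M)"] t by simp
    also have "\<dots> \<le> (1 + t) powr \<bar>Re w - real (Suc M)\<bar>" using t by (intro powr_mono) auto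
    also have "\<dots> \<le> 2 powr \<bar>Re w - real (Suc M)\<bar>" using t by (intro powr_mono2) auto
    finally show "norm (f (Suc M) z) \<le> B"
      unfolding f_def B_def norm_mult by (intro mult_left_mono) auto
  qed
  then have T: "norm ((1 + of_real x) powr w - (\<Sum>i\<le>M. ffact w i / fact i * of_real x ^ i)) \<le> B * x ^ Suc M / fact M"
    using x by (simp add: f_def)
  define n' where "n' = (of_nat (Suc n) :: complex)"
  have n': "n' = of_real (real (Suc n))" "n' \<noteq> 0" by (simp_all add: n'_def del: of_nat_Suc)
  have 1: "of_nat (Suc (Suc n)) powr w = n' powr w * (1 + of_real x) powr w"
  proof -
    have "real (Suc n) * (1 + x) = real (Suc (Suc n))"
      by (simp add: x_def field_simps)
    then have "of_nat (Suc (Suc n)) = complex_of_real (real (Suc n) * (1 + x))"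
      by (simp only: of_real_of_nat_eq)
    also have "\<dots> powr w = of_real (real (Suc n)) powr w * of_real (1 + x) powr w"
      unfolding of_real_mult by (rule powr_times_real) (use x in auto)
    finally show ?thesis by (simp add: n')
  qed
  have 2: "n' powr (w - of_nat j) = n' powr w * of_real x ^ j" for j
  proof -
    have "n' powr (w - of_nat j) = n' powr w / n' powr of_nat j" by (simp add: powr_diff)
    also have "n' powr of_nat j = n' ^ j" using n' by (simp add: powr_nat')
    also have "n' powr w / n' ^ j = n' powr w * of_real x ^ j"
      using n' by (simp add: x_def power_divide field_simps)
    finally show ?thesis .
  qed
  have "taylor_rem M n s = n' powr w * ((1 + of_real x) powr w - (\<Sum>i\<le>M. ffact w i / fact i * of_real x ^ i))"
    unfolding taylor_rem_def w_def [symmetric] 1 n'_def [symmetric] 2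
    by (simp add: right_diff_distrib sum_distrib_left mult_ac)
  then have "norm (taylor_rem M n s) \<le> norm (n' powr w) * (B * x ^ Suc M / fact M)"
    using mult_left_mono [OF T, of "norm (n' powr w)"] by (simp only: norm_mult norm_ge_zero)
  also have "norm (n' powr w) = real (Suc n) powr Re w" unfolding n'_def by (rule norm_nat_powr)
  also have "real (Suc n) powr Re w * (B * x ^ Suc M / fact M) = B / fact M * (real (Suc n) powr Re w * x ^ Suc M)" by simp
  also have "real (Suc n) powr Re w * x ^ Suc M = real (Suc n) powr - (Re s + real M)"
  proof -
    have "x ^ Suc M = real (Suc n) powr - real (Suc M)"
      by (simp add: x_def powr_minus powr_realpow power_one_over inverse_eq_divide del: of_nat_Suc power_Suc)
    then have "real (Suc n) powr Re w * x ^ Suc M = real (Suc n) powr (Re w + - real (Suc M))"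
      by (simp only: powr_add)
    also have "Re w + - real (Suc M) = - (Re s + real M)" by (simp add: w_def)
    finally show ?thesis .
  qed
  finally show ?thesis by (simp add: B_def w_def)
qed

lemma taylor_rem_sum_holomorphic:
  shows "\<And>s. Re s > 1 - real M \<Longrightarrow> summable (\<lambda>n. taylor_rem M n s)"
    and "(\<lambda>s. \<Sum>n. taylor_rem M n s) holomorphic_on {s. Re s > 1 - real M}"
proof -
  have ne: "of_nat (Suc n) \<notin> (\<real>\<^sub>\<le>\<^sub>0 :: complex set)" for n
    by (simp add: complex_nonpos_Reals_iff del: of_nat_Suc)
  have hol: "taylor_rem M n holomorphic_on UNIV" for n
    unfolding taylor_rem_def [abs_def] by (intro holomorphic_intros) auto
  have cont: "continuous_on UNIV (\<lambda>s. norm (ffact (1 - s) (Suc M)) * 2 powr \<bar>Re (1 - s) - real (Suc M)\<bar> / fact M)"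
    by (intro continuous_intros) auto
  show "Re s > 1 - real M \<Longrightarrow> summable (\<lambda>n. taylor_rem M n s)" for s
    by (rule holomorphic_dirichlet_type_series(1) [OF hol cont taylor_rem_bound])
  show "(\<lambda>s. \<Sum>n. taylor_rem M n s) holomorphic_on {s. Re s > 1 - real M}"
    by (rule holomorphic_dirichlet_type_series(2) [OF hol cont taylor_rem_bound])
qed

definition dirichlet_zeta :: "complex \<Rightarrow> complex" where
  "dirichlet_zeta s = (\<Sum>n. of_nat (Suc n) powr - s)"

lemma dirichlet_zeta_props:
  shows "\<And>s. Re s > 1 \<Longrightarrow> (\<lambda>n. of_nat (Suc n) powr - s) sums dirichlet_zeta s"
    and "dirichlet_zeta holomorphic_on {s. Re s > 1}"
proof -
  have hol: "(\<lambda>s. of_nat (Suc n) powr - s :: complex) holomorphic_on UNIV" for n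
    by (intro holomorphic_intros)
  have le: "norm (of_nat (Suc n) powr - s :: complex) \<le> 1 * real (Suc n) powr - (Re s + 0)" for n s
    unfolding norm_nat_powr by simp
  note D = holomorphic_dirichlet_type_series [where C = "\<lambda>_. 1" and a = 0, OF hol continuous_on_const le]
  show "Re s > 1 \<Longrightarrow> (\<lambda>n. of_nat (Suc n) powr - s) sums dirichlet_zeta s" for s
    unfolding dirichlet_zeta_def using D(1) [of s] by (intro summable_sums) simp
  show "dirichlet_zeta holomorphic_on {s. Re s > 1}"
    using D(2) by (simp add: dirichlet_zeta_def [abs_def])
qed

text \<open>
  Summing the Taylor expansions over \<open>n\<close> telescopes to \<open>-1\<close>. The factor \<open>s + i - 1\<close> that splits off
  the falling factorial is exactly what cancels the pole of zeta at \<open>s + i = 1\<close>, so that the relation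
  is one between values of the entire function \<open>(s - 1) \<zeta>(s)\<close>.
\<close>

lemma dirichlet_zeta_recursion:
  assumes s: "Re s > 1"
  shows "(\<Sum>i<M. ffact (1 - s) i / fact (Suc i) * ((s + of_nat i - 1) * dirichlet_zeta (s + of_nat i))) = 1 + (\<Sum>n. taylor_rem M n s)"
proof -
  define w where "w = 1 - s"
  have "(\<lambda>n. of_nat (Suc n) powr w) \<longlonglongrightarrow> 0"
  proof (rule tendsto_norm_zero_cancel)
    have "(\<lambda>n. real (Suc n) powr Re w) \<longlonglongrightarrow> 0"
      by (rule LIMSEQ_Suc, rule tendsto_neg_powr) (use s in \<open>auto simp: w_def intro: filterlim_real_sequentially\<close>)
    then show "(\<lambda>n. norm (of_nat (Suc n) powr w)) \<longlonglongrightarrow> 0" unfolding norm_nat_powr .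
  qed
  from telescope_sums [OF this]
  have tel: "(\<lambda>n. of_nat (Suc (Suc n)) powr w - of_nat (Suc n) powr w) sums (- 1)"
    by simp
  have rs: "(\<lambda>n. taylor_rem M n s) sums (\<Sum>n. taylor_rem M n s)"
    by (intro summable_sums taylor_rem_sum_holomorphic) (use s in auto)
  have "(\<lambda>n. (of_nat (Suc (Suc n)) powr w - of_nat (Suc n) powr w) - taylor_rem M n s) sums (- 1 - (\<Sum>n. taylor_rem M n s))"
    by (intro sums_diff tel rs)
  moreover have "(of_nat (Suc (Suc n)) powr w - of_nat (Suc n) powr w) - taylor_rem M n s
      = (\<Sum>i<M. ffact w (Suc i) / fact (Suc i) * of_nat (Suc n) powr - (s + of_nat i))" for n
  proof -
    have "(\<Sum>j\<le>M. ffact w j / fact j * of_nat (Suc n) powr (w - of_nat j))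
        = of_nat (Suc n) powr w + (\<Sum>i<M. ffact w (Suc i) / fact (Suc i) * of_nat (Suc n) powr (w - of_nat (Suc i)))"
      by (subst sum.atMost_shift) simp
    moreover have "w - of_nat (Suc i) = - (s + of_nat i)" for i by (simp add: w_def)
    ultimately have "(\<Sum>j\<le>M. ffact w j / fact j * of_nat (Suc n) powr (w - of_nat j))
        = of_nat (Suc n) powr w + (\<Sum>i<M. ffact w (Suc i) / fact (Suc i) * of_nat (Suc n) powr - (s + of_nat i))"
      by (simp only:)
    then show ?thesis unfolding taylor_rem_def w_def [symmetric] by (simp only:) (simp only: diff_diff_eq2 add_diff_cancel_left' diff_diff_add, simp)
  qed
  ultimately have 1: "(\<lambda>n. \<Sum>i<M. ffact w (Suc i) / fact (Suc i) * of_nat (Suc n) powr - (s + of_nat i)) sums (- 1 - (\<Sum>n. taylor_rem M n s))"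
    by (simp only:)
  have 2: "(\<lambda>n. \<Sum>i<M. ffact w (Suc i) / fact (Suc i) * of_nat (Suc n) powr - (s + of_nat i))
      sums (\<Sum>i<M. ffact w (Suc i) / fact (Suc i) * dirichlet_zeta (s + of_nat i))"
    by (intro sums_sum sums_mult dirichlet_zeta_props) (use s in auto)
  have "(\<Sum>i<M. ffact w (Suc i) / fact (Suc i) * dirichlet_zeta (s + of_nat i)) = - 1 - (\<Sum>n. taylor_rem M n s)"
    using sums_unique2 [OF 2 1] .
  moreover have "ffact w (Suc i) / fact (Suc i) * dirichlet_zeta (s + of_nat i)
      = - (ffact w i / fact (Suc i) * ((s + of_nat i - 1) * dirichlet_zeta (s + of_nat i)))" for i
  proof -
    have "w - of_nat i = - (s + of_nat i - 1)" by (simp add: w_def)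
    then have "ffact w (Suc i) = - (ffact w i * (s + of_nat i - 1))"
      by (simp only: ffact_Suc mult_minus_right)
    then show ?thesis by simp
  qed
  ultimately have "- (\<Sum>i<M. ffact w i / fact (Suc i) * ((s + of_nat i - 1) * dirichlet_zeta (s + of_nat i))) = - 1 - (\<Sum>n. taylor_rem M n s)"
    by (simp add: sum_negf)
  then show ?thesis unfolding w_def [symmetric] by (simp add: minus_equation_iff algebra_simps)
qed

lemma halfplane_identity:
  assumes "f holomorphic_on {s. Re s > b}" "g holomorphic_on {s. Re s > b}" "b \<le> 1"
    and "\<And>s. Re s > 1 \<Longrightarrow> f s = g s" "Re s > b"
  shows "f s = g s"
proof (rule analytic_continuation_open [of "{s. Re s > 1}" "{s. Re s > b}" f g])
  have "2 \<in> {s. Re s > 1}" by simp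
  then show "{s. Re s > 1} \<noteq> {}" by blast
  show "connected {s. Re s > b}" by (intro convex_connected convex_halfspace_Re_gt)
qed (use assms in \<open>auto simp: open_halfspace_Re_gt\<close>)

text \<open>
  Solving the recursion for its term \<open>i = 0\<close> extends the function by one unit to the left.
\<close>

lemma continuation_step:
  "\<exists>f. f holomorphic_on {s. Re s > 1 - real N} \<and> (\<forall>s. Re s > 1 \<longrightarrow> f s = (s - 1) * dirichlet_zeta s)"
proof (induction N)
  case 0
  then show ?case
    using dirichlet_zeta_props(2) by (intro exI [of _ "\<lambda>s. (s - 1) * dirichlet_zeta s"]) (auto intro!: holomorphic_intros)
next
  case (Suc N)
  then obtain f where f: "f holomorphic_on {s. Re s > 1 - real N}"
    and f_eq: "\<And>s. Re s > 1 \<Longrightarrow> f s = (s - 1) * dirichlet_zeta s" by blast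
  define h where "h s = 1 + (\<Sum>n. taylor_rem (Suc N) n s) - (\<Sum>i<N. ffact (1 - s) (Suc i) / fact (Suc (Suc i)) * f (s + of_nat (Suc i)))" for s
  have shift: "(\<lambda>s. f (s + of_nat (Suc i))) holomorphic_on {s. Re s > 1 - real (Suc N)}" for i
  proof -
    have "(f \<circ> (\<lambda>s. s + of_nat (Suc i))) holomorphic_on {s. Re s > 1 - real (Suc N)}"
      by (rule holomorphic_on_compose_gen [OF _ f]) (auto intro!: holomorphic_intros)
    then show ?thesis by (simp add: o_def)
  qed
  have "h holomorphic_on {s. Re s > 1 - real (Suc N)}"
    unfolding h_def by (intro holomorphic_intros taylor_rem_sum_holomorphic(2) shift) auto
  moreover have "h s = (s - 1) * dirichlet_zeta s" if s: "Re s > 1" for s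
  proof -
    have "(\<Sum>i<Suc N. ffact (1 - s) i / fact (Suc i) * ((s + of_nat i - 1) * dirichlet_zeta (s + of_nat i)))
        = (s - 1) * dirichlet_zeta s + (\<Sum>i<N. ffact (1 - s) (Suc i) / fact (Suc (Suc i)) * f (s + of_nat (Suc i)))"
      by (subst sum.lessThan_Suc_shift) (use s in \<open>simp add: f_eq\<close>)
    then have "1 + (\<Sum>n. taylor_rem (Suc N) n s) = (s - 1) * dirichlet_zeta s + (\<Sum>i<N. ffact (1 - s) (Suc i) / fact (Suc (Suc i)) * f (s + of_nat (Suc i)))"
      using dirichlet_zeta_recursion [OF s, of "Suc N"] by (simp only:)
    then show ?thesis unfolding h_def by (simp only: add_diff_cancel_right')
  qed
  ultimately show ?case by blast
qed

lemma entire_continuation: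
  obtains \<Lambda> where "\<Lambda> holomorphic_on UNIV" "\<And>s. Re s > 1 \<Longrightarrow> \<Lambda> s = (s - 1) * dirichlet_zeta s"
proof -
  obtain f where f: "\<And>N. f N holomorphic_on {s. Re s > 1 - real N}"
    and f_eq: "\<And>N s. Re s > 1 \<Longrightarrow> f N s = (s - 1) * dirichlet_zeta s"
    using continuation_step by metis
  have mono: "f M s = f N s" if "N \<le> M" "Re s > 1 - real N" for N M s
    by (rule halfplane_identity [of _ "1 - real N"])
       (use that f_eq f in \<open>auto intro: holomorphic_on_subset [OF f]\<close>)
  have agree: "f M s = f N s" if "Re s > 1 - real N" "Re s > 1 - real M" for N M s
    using that mono [of N M s] mono [of M N s] by (cases "N \<le> M") auto
  \<comment> \<open>a half plane that contains \<open>s\<close>; any other choice gives the same value\<close>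
  define \<Lambda> where "\<Lambda> s = f (nat \<lceil>2 - Re s\<rceil>) s" for s
  have \<Lambda>: "\<Lambda> s = f N s" if "Re s > 1 - real N" for N s
    unfolding \<Lambda>_def by (rule agree [OF that]) linarith
  have "\<exists>f'. (\<Lambda> has_field_derivative f') (at s)" for s
  proof -
    define N where "N = nat \<lceil>2 - Re s\<rceil>"
    have s: "Re s > 1 - real N" unfolding N_def by linarith
    have op: "open {s. Re s > 1 - real N}" by (simp add: open_halfspace_Re_gt)
    have "\<Lambda> holomorphic_on {s. Re s > 1 - real N}"
      by (rule holomorphic_transform [OF f]) (simp add: \<Lambda>)
    then show ?thesis using holomorphic_on_open [OF op] s by blast
  qed
  then have "\<Lambda> holomorphic_on UNIV" by (simp add: holomorphic_on_open)
  moreover have "\<Lambda> s = (s - 1) * dirichlet_zeta s" if "Re s > 1" for s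
    using \<Lambda> [of 0 s] f_eq that by simp
  ultimately show thesis by (rule that)
qed

lemma bernoulli_recursion:
  "(\<Sum>i\<le>m. (bernoulli i + (if i = 1 then 1 else 0)) / fact i * (1 / fact (Suc (m - i)))) = 1 / fact m"
proof -
  define Q where "Q = fps_exp (1::rat) - 1"
  define F where "F = fps_X / Q"
  have Q1: "fps_nth Q 0 = 0" "fps_nth Q 1 = 1" by (simp_all add: Q_def)
  have "subdegree Q = 1" by (rule subdegreeI) (use Q1 in auto)
  then have "Q dvd fps_X" using Q1 by (subst fps_dvd_iff) auto
  then have FQ: "F * Q = fps_X" by (simp add: F_def)
  have "(F + fps_X) * Q = fps_X * fps_exp 1"
    unfolding distrib_right FQ by (simp add: Q_def algebra_simps)
  then have "fps_nth ((F + fps_X) * Q) (Suc m) = fps_nth (fps_X * fps_exp (1::rat)) (Suc m)" by simp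
  also have "\<dots> = 1 / fact m" by simp
  also have "fps_nth ((F + fps_X) * Q) (Suc m) = (\<Sum>i\<le>Suc m. fps_nth (F + fps_X) i * fps_nth Q (Suc m - i))"
    by (simp add: fps_mult_nth atLeast0AtMost)
  also have "\<dots> = (\<Sum>i\<le>m. fps_nth (F + fps_X) i * fps_nth Q (Suc m - i))" using Q1 by simp
  also have "\<dots> = (\<Sum>i\<le>m. (bernoulli i + (if i = 1 then 1 else 0)) / fact i * (1 / fact (Suc (m - i))))"
  proof (rule sum.cong)
    fix i assume "i \<in> {..m}"
    then have "Suc m - i = Suc (m - i)" by auto
    moreover have "fps_nth Q (Suc (m - i)) = 1 / fact (Suc (m - i))" by (simp add: Q_def del: fact_Suc)
    moreover have "fps_nth (F + fps_X) i = (bernoulli i + (if i = 1 then 1 else 0)) / fact i"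
      by (simp add: bernoulli_def F_def Q_def fps_X_nth)
    ultimately show "fps_nth (F + fps_X) i * fps_nth Q (Suc m - i) = (bernoulli i + (if i = 1 then 1 else 0)) / fact i * (1 / fact (Suc (m - i)))"
      by simp
  qed simp
  finally show ?thesis .
qed

text \<open>
  At \<open>s = 1 - m\<close> the Taylor expansions are finite binomial expansions, the remainders vanish, and the
  recursion is the one satisfied by the Bernoulli numbers with \<open>B\<^sub>1 = 1/2\<close>.
\<close>

theorem riemann_zeta_negative:
  assumes "m \<ge> 2"
  shows "riemann_zeta (1 - of_nat m) = - of_rat (bernoulli m) / of_nat m"
proof -
  obtain \<Lambda> where hol: "\<Lambda> holomorphic_on UNIV" and eq: "\<And>s. Re s > 1 \<Longrightarrow> \<Lambda> s = (s - 1) * dirichlet_zeta s"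
    by (rule entire_continuation) blast
  define f where "f s = (if s = 1 then 0 else \<Lambda> s / (s - 1))" for s
  have f_hol: "f holomorphic_on - {1}"
    by (rule holomorphic_transform [of "\<lambda>s. \<Lambda> s / (s - 1)"])
       (auto simp: f_def intro!: holomorphic_intros holomorphic_on_subset [OF hol])
  have f_eq: "f s = dirichlet_zeta s" if "Re s > 1" for s
    using eq [OF that] that by (auto simp: f_def)
  have "riemann_zeta = f"
    unfolding riemann_zeta_def
  proof (rule the_equality)
    have "(\<lambda>n. 1 / of_nat (Suc n) powr s) sums f s" if "Re s > 1" for s
      using dirichlet_zeta_props(1) [OF that] by (simp add: f_eq [OF that] powr_minus_divide del: of_nat_Suc)
    then show "f holomorphic_on - {1} \<and> f 1 = 0 \<and> (\<forall>s. Re s > 1 \<longrightarrow> (\<lambda>n. 1 / of_nat (Suc n) powr s) sums f s)"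
      using f_hol by (simp add: f_def)
    then have sums: "\<And>s. Re s > 1 \<Longrightarrow> (\<lambda>n. 1 / of_nat (Suc n) powr s) sums f s" by blast
    fix g :: "complex \<Rightarrow> complex"
    assume g: "g holomorphic_on - {1} \<and> g 1 = 0 \<and> (\<forall>s. Re s > 1 \<longrightarrow> (\<lambda>n. 1 / of_nat (Suc n) powr s) sums g s)"
    show "g = f"
    proof
      fix s show "g s = f s"
      proof (cases "s = 1")
        case True
        then show ?thesis using g by (simp add: f_def)
      next
        case False
        have ne: "{s. Re s > 1} \<noteq> {}" by (metis (mono_tags) Re_complex_of_real empty_iff gt_ex mem_Collect_eq)
        have "connected (- {1::complex})" by (rule connected_punctured_universe) simp
        moreover have "g z = f z" if "z \<in> {s. Re s > 1}" for z
          using g sums [of z] that sums_unique2 by blast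
        moreover have "{s. Re s > 1} \<subseteq> - {1::complex}" by auto
        ultimately show ?thesis
          using analytic_continuation_open [of "{s. Re s > 1}" "- {1}" g f s] g f_hol False ne
          by (simp add: open_halfspace_Re_gt open_Compl)
      qed
    qed
  qed
  have rec: "(\<Sum>i<M. ffact (1 - s) i / fact (Suc i) * \<Lambda> (s + of_nat i)) = 1 + (\<Sum>n. taylor_rem M n s)"
    if "Re s > 1 - real M" for M s
  proof (rule halfplane_identity [where b = "1 - real M"
        and f = "\<lambda>s. \<Sum>i<M. ffact (1 - s) i / fact (Suc i) * \<Lambda> (s + of_nat i)" and g = "\<lambda>s. 1 + (\<Sum>n. taylor_rem M n s)"])
    have "(\<lambda>s. \<Lambda> (s + of_nat i)) holomorphic_on A" for i A
    proof -
      have "(\<lambda>s. s + of_nat i) holomorphic_on A" by (intro holomorphic_intros)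
      from holomorphic_on_compose [OF this holomorphic_on_subset [OF hol]]
      show ?thesis by (simp add: o_def)
    qed
    then show "(\<lambda>s. \<Sum>i<M. ffact (1 - s) i / fact (Suc i) * \<Lambda> (s + of_nat i)) holomorphic_on {s. 1 - real M < Re s}"
      by (intro holomorphic_intros) auto
    show "(\<lambda>s. 1 + (\<Sum>n. taylor_rem M n s)) holomorphic_on {s. 1 - real M < Re s}"
      by (intro holomorphic_intros taylor_rem_sum_holomorphic(2))
    fix s assume s: "Re s > 1"
    then show "(\<Sum>i<M. ffact (1 - s) i / fact (Suc i) * \<Lambda> (s + of_nat i)) = 1 + (\<Sum>n. taylor_rem M n s)"
      using dirichlet_zeta_recursion [OF s, of M] by (simp add: eq)
  qed (use that in auto)
  define L where "L m = \<Lambda> (1 - of_nat m)" for m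
  have L_rec: "(\<Sum>i\<le>m. L i / fact i * (1 / fact (Suc (m - i)))) = 1 / fact m" for m
  proof -
    have rem0: "taylor_rem (Suc m) n (1 - of_nat m) = 0" for n
    proof -
      have *: "of_nat (Suc k) powr (of_nat j) = (of_nat (Suc k) ^ j :: complex)" for k j
        by (simp add: powr_nat' del: of_nat_Suc)
      have "(\<Sum>j\<le>Suc m. ffact (of_nat m) j / fact j * of_nat (Suc n) powr (of_nat m - of_nat j))
          = (\<Sum>j\<le>m. of_nat (m choose j) * of_nat (Suc n) ^ (m - j))"
      proof -
        have "(\<Sum>j\<le>Suc m. ffact (of_nat m) j / fact j * of_nat (Suc n) powr (of_nat m - of_nat j))
            = (\<Sum>j\<le>m. ffact (of_nat m) j / fact j * of_nat (Suc n) powr (of_nat m - of_nat j))"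
          by (simp add: ffact_of_nat)
        also have "\<dots> = (\<Sum>j\<le>m. of_nat (m choose j) * of_nat (Suc n) ^ (m - j))"
        proof (rule sum.cong)
          fix j assume j: "j \<in> {..m}"
          have "of_nat m - of_nat j = (of_nat (m - j) :: complex)" using j by (simp add: of_nat_diff)
          moreover have "ffact (of_nat m) j / fact j = of_nat (m choose j)"
            using j by (simp add: ffact_of_nat binomial_fact)
          ultimately show "ffact (of_nat m) j / fact j * of_nat (Suc n) powr (of_nat m - of_nat j)
              = of_nat (m choose j) * of_nat (Suc n) ^ (m - j)" by (simp only: *)
        qed simp
        finally show ?thesis .
      qed
      also have "\<dots> = (1 + of_nat (Suc n)) ^ m"
        unfolding binomial_ring [of 1 "of_nat (Suc n)" m] by simp
      also have "\<dots> = of_nat (Suc (Suc n)) powr of_nat m" unfolding * by simp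
      finally show ?thesis by (simp add: taylor_rem_def)
    qed
    have "(\<Sum>i<Suc m. ffact (of_nat m) i / fact (Suc i) * L (m - i)) = 1"
    proof -
      have "(\<Sum>i<Suc m. ffact (1 - (1 - of_nat m)) i / fact (Suc i) * \<Lambda> ((1 - of_nat m) + of_nat i)) = 1 + (\<Sum>n. taylor_rem (Suc m) n (1 - of_nat m))"
        by (rule rec) simp
      moreover have "(1 - of_nat m) + of_nat i = (1 - of_nat (m - i) :: complex)" if "i < Suc m" for i
        using that by (simp add: of_nat_diff)
      ultimately show ?thesis unfolding L_def rem0 by simp
    qed
    then have "(\<Sum>i\<le>m. fact m / fact (m - i) / fact (Suc i) * L (m - i)) = 1"
      unfolding lessThan_Suc_atMost by (simp add: ffact_of_nat)
    then have "fact m * (\<Sum>i\<le>m. L (m - i) / fact (m - i) * (1 / fact (Suc i))) = 1"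
      by (simp add: sum_distrib_left mult_ac)
    then have "(\<Sum>i\<le>m. L (m - i) / fact (m - i) * (1 / fact (Suc i))) = 1 / fact m"
      by (simp add: field_simps)
    moreover have "(\<Sum>i\<le>m. L (m - i) / fact (m - i) * (1 / fact (Suc i))) = (\<Sum>i\<le>m. L i / fact i * (1 / fact (Suc (m - i))))"
      by (rule sum.reindex_bij_witness [of _ "\<lambda>i. m - i" "\<lambda>i. m - i"]) auto
    ultimately show ?thesis by simp
  qed
  \<comment> \<open>the convention \<open>B\<^sub>1 = 1/2\<close>\<close>
  define b where "b i = bernoulli i + (if i = 1 then 1 else 0)" for i
  have L_eq: "L m = of_rat (b m)" for m
  proof (induction m rule: less_induct)
    case (less m)
    have "of_rat (\<Sum>i\<le>m. b i / fact i * (1 / fact (Suc (m - i)))) = (of_rat (1 / fact m) :: complex)"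
      using bernoulli_recursion [of m] unfolding b_def by (simp only:)
    moreover have "of_rat (fact n) = (fact n :: complex)" for n
      by (metis of_nat_fact of_rat_of_nat_eq)
    ultimately have "(\<Sum>i\<le>m. of_rat (b i) / fact i * (1 / fact (Suc (m - i)))) = (1 / fact m :: complex)"
      by (simp add: of_rat_sum of_rat_mult of_rat_divide del: fact_Suc)
    then have "(\<Sum>i\<le>m. of_rat (b i) / fact i * (1 / fact (Suc (m - i)))) = (\<Sum>i\<le>m. L i / fact i * (1 / fact (Suc (m - i))))"
      by (simp only: L_rec)
    moreover have "{..m} = insert m {..<m}" by auto
    ultimately have "of_rat (b m) / fact m = L m / fact m"
      using less by simp
    then show ?case by simp
  qed
  have m1: "(1 - of_nat m :: complex) \<noteq> 1" using assms by simp
  have "riemann_zeta (1 - of_nat m) = L m / (1 - of_nat m - 1)"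
    unfolding \<open>riemann_zeta = f\<close> f_def L_def using m1 by simp
  also have "\<dots> = - of_rat (bernoulli m) / of_nat m" using assms by (simp add: L_eq b_def)
  finally show ?thesis .
qed

section \<open>Congruences at a prime and p-adic order\<close>

lemma of_int_in_number_field:
  assumes "number_field K"
  shows "of_int n \<in> carrier (ring_of_integers K)"
proof -
  interpret CC: field CC by (rule field_from_type_algebra)
  have sub: "subring K CC" using assms by (simp add: number_field_def subfield_def subcring_def subdomain_def)
  have [simp]: "\<one>\<^bsub>CC\<^esub> = 1" "\<zero>\<^bsub>CC\<^esub> = 0" "x \<oplus>\<^bsub>CC\<^esub> y = x + y" for x y
    by (simp_all add: ring_of_type_algebra_def)
  have neg: "\<ominus>\<^bsub>CC\<^esub> x = - x" for x
    by (rule CC.minus_equality) (simp_all add: ring_of_type_algebra_def)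
  have nat: "of_nat m \<in> K" for m
  proof (induction m)
    case 0
    then show ?case using subringE(2) [OF sub] by simp
  next
    case (Suc m)
    then show ?case using subringE(7) [OF sub, of 1 "of_nat m"] subringE(3) [OF sub] by simp
  qed
  have "of_int n \<in> K"
    using nat subringE(5) [OF sub] by (cases n rule: int_cases2) (auto simp: neg)
  then show ?thesis by (simp add: ring_of_integers_def)
qed

text \<open>
  From \<open>-u/v = a/s\<close> follows \<open>u s = -v a \<in> P\<close> with \<open>s \<notin> P\<close>, so \<open>u \<in> P \<inter> \<int> = p \<int>\<close>.
\<close>

lemma rational_in_prime_ideal:
  assumes K: "number_field K" and P: "prime_ideal_above K p P"
    and cong: "cong_at_prime K P 0 (of_rat x)"
  shows "int p dvd fst (quotient_of x)"
proof -
  obtain u v where q: "quotient_of x = (u, v)" by (cases "quotient_of x")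
  have v: "v > 0" using quotient_of_denom_pos [OF q] .
  have x: "x = of_int u / of_int v" using quotient_of_div [OF q] .
  obtain a s where a: "a \<in> P" and s: "s \<in> carrier (ring_of_integers K)" "s \<notin> P" and eq: "0 - of_rat x = a / s"
    using cong by (auto simp: cong_at_prime_def)
  interpret P: primeideal P "ring_of_integers K" using P by (simp add: prime_ideal_above_def)
  have mult: "y \<otimes>\<^bsub>ring_of_integers K\<^esub> z = y * z" for y z
    by (simp add: ring_of_integers_def ring_of_type_algebra_def)
  have "\<zero>\<^bsub>ring_of_integers K\<^esub> = 0" by (simp add: ring_of_integers_def ring_of_type_algebra_def)
  then have "0 \<in> P" using additive_subgroup.zero_closed [OF P.additive_subgroup_axioms] by simp
  then have s0: "s \<noteq> 0" using s by auto
  have "of_rat x = (of_int u / of_int v :: complex)" by (simp add: x of_rat_divide)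
  then have uv: "of_int u / of_int v = - (a / s)" using eq by (metis diff_0 minus_minus)
  have "of_int u * s = (of_int u / of_int v) * of_int v * s" using v by simp
  also have "\<dots> = of_int (- v) * a" unfolding uv using s0 by simp
  finally have "of_int u * s = of_int (- v) * a" .
  also have "\<dots> \<in> P" using P.I_l_closed [OF a of_int_in_number_field [OF K]] by (simp only: mult)
  finally have "of_int u \<otimes>\<^bsub>ring_of_integers K\<^esub> s \<in> P" by (simp only: mult)
  then have "of_int u \<in> P" using P.I_prime [OF of_int_in_number_field [OF K] s(1)] s(2) by blast
  then have "of_int u \<in> range (\<lambda>n::int. of_int (int p * n) :: complex)"
    using P by (auto simp: prime_ideal_above_def)
  then obtain n where "of_int u = (of_int (int p * n) :: complex)" by blast
  then have "u = int p * n" by (simp only: of_int_eq_iff)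
  then show ?thesis by (simp add: q)
qed

lemma rat_ord_pos:
  assumes p: "Factorial_Ring.prime p" and u: "int p dvd u" and v: "\<not> int p dvd v"
    and x: "x * of_int v = of_int u"
  shows "rat_ord p x > 0"
proof (cases "x = 0")
  case True
  then show ?thesis by (simp add: rat_ord_def)
next
  case False
  obtain n d where q: "quotient_of x = (n, d)" by (cases "quotient_of x")
  have d: "d > 0" using quotient_of_denom_pos [OF q] .
  have cop: "coprime n d" using quotient_of_coprime [OF q] .
  have x': "x = of_int n / of_int d" using quotient_of_div [OF q] .
  have prime: "Factorial_Ring.prime (int p)" using p by simp
  have "of_int (n * v) = (of_int (u * d) :: rat)" using x d by (simp add: x' field_simps)
  then have "n * v = u * d" by (simp only: of_int_eq_iff)
  then have "int p dvd n * v" using u by simp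
  then have pn: "int p dvd n" using v prime prime_dvd_multD by blast
  have n0: "n \<noteq> 0" using False x' by auto
  have "\<not> int p dvd d" using pn cop prime by (meson coprime_common_divisor not_prime_unit)
  then have "multiplicity (int p) d = 0" by (rule not_dvd_imp_multiplicity_0)
  moreover have "multiplicity (int p) n \<ge> 1"
    using pn n0 prime by (simp add: multiplicity_geI prime_elem_def Suc_le_eq prime_multiplicity_gt_zero_iff)
  ultimately show ?thesis using False by (simp add: rat_ord_def q)
qed

lemma rat_ord_0D:
  assumes p: "Factorial_Ring.prime p" and x: "rat_ord p x = 0" and q: "quotient_of x = (n, d)"
  shows "\<not> int p dvd n"
proof
  assume pn: "int p dvd n"
  have "x * of_int d = of_int n" using quotient_of_div [OF q] quotient_of_denom_pos [OF q] by simp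
  moreover have "\<not> int p dvd d"
    using pn quotient_of_coprime [OF q] p by (meson coprime_common_divisor not_prime_unit prime_nat_int_transfer)
  ultimately have "rat_ord p x > 0" using pn p by (intro rat_ord_pos)
  then show False using x by simp
qed

section \<open>Cusp forms congruent to Eisenstein series\<close>

theorem theorem1p4:
  fixes k p :: nat
  assumes "k \<ge> 4" and "even k"
    and "Factorial_Ring.prime p" and "p \<ge> 7" and "p - 1 > 2 * k - 2"
    and "\<exists>K P F. number_field K \<and> prime_ideal_above K p P \<and>
           siegel_cusp_form k F \<and> hecke_eigenform k F \<and>
           integral_form K F \<and> nontrivial_mod K P F \<and> form_cong K P F (siegel_G k)"
  shows "rat_ord p (bernoulli k * bernoulli (2 * k - 2) * of_nat (class_number_plus p)) > 0
       \<and> (vandiver_conjecture \<and> rat_ord p (bernoulli k) = 0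
            \<longrightarrow> rat_ord p (bernoulli (2 * k - 2)) > 0)"
proof -
  note k = \<open>k \<ge> 4\<close> and p = \<open>Factorial_Ring.prime p\<close>
  obtain K P F where K: "number_field K" and P: "prime_ideal_above K p P"
    and F: "siegel_cusp_form k F" and cong: "form_cong K P F (siegel_G k)"
    using assms(6) by blast
  define m where "m = 2 * k - 2"
  define x where "x = bernoulli k * bernoulli m / of_nat (2 * k * m)"
  have "siegel_G k = (\<lambda>Z. of_rat x * siegel_E k Z)"
  proof
    fix Z
    have arg: "3 - 2 * of_nat k = (1 - of_nat m :: complex)"
      using k by (simp add: m_def of_nat_diff)
    have "riemann_zeta (1 - of_nat k) = - of_rat (bernoulli k) / of_nat k"
      using k by (intro riemann_zeta_negative) simp
    moreover have "riemann_zeta (3 - 2 * of_nat k) = - of_rat (bernoulli m) / of_nat m"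
      unfolding arg using k by (intro riemann_zeta_negative) (simp add: m_def)
    ultimately show "siegel_G k Z = of_rat x * siegel_E k Z"
      by (simp add: siegel_G_def x_def of_rat_mult of_rat_divide)
  qed
  then have "fourier_coeff (siegel_G k) 0 = of_rat x"
    using eisenstein_constant_coeff [OF k \<open>even k\<close>] by simp
  moreover have "fourier_coeff F 0 = 0"
    by (rule cusp_form_constant_coeff [OF F])
  moreover have "0 \<in> half_integral_psd"
    by (simp add: half_integral_psd_def symmetric_2_iff)
  ultimately have "cong_at_prime K P 0 (of_rat x)"
    using cong unfolding form_cong_def by metis
  then have num: "int p dvd fst (quotient_of x)"
    by (rule rational_in_prime_ideal [OF K P])
  obtain u v where q: "quotient_of x = (u, v)" by (cases "quotient_of x")
  have u: "int p dvd u" using num by (simp add: q)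
  have v: "\<not> int p dvd v"
    using u quotient_of_coprime [OF q] p
    by (meson coprime_common_divisor not_prime_unit prime_nat_int_transfer)
  have xv: "x * of_int v = of_int u"
    using quotient_of_div [OF q] quotient_of_denom_pos [OF q] by simp
  have B: "bernoulli k * bernoulli m = x * of_nat (2 * k * m)"
    using k by (simp add: x_def m_def)
  have BB: "bernoulli k * bernoulli m * of_int v = of_int (u * int (2 * k * m))"
    using xv unfolding B by (metis (no_types, opaque_lifting) mult.assoc mult.commute of_int_mult of_int_of_nat_eq)
  have "rat_ord p (bernoulli k * bernoulli m * of_nat (class_number_plus p)) > 0"
  proof (rule rat_ord_pos [OF p _ v])
    show "int p dvd u * int (2 * k * m) * int (class_number_plus p)" using u by simp
    have "bernoulli k * bernoulli m * of_nat (class_number_plus p) * of_int v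
        = bernoulli k * bernoulli m * of_int v * of_int (int (class_number_plus p))" by simp
    then show "bernoulli k * bernoulli m * of_nat (class_number_plus p) * of_int v
        = of_int (u * int (2 * k * m) * int (class_number_plus p))"
      unfolding BB of_int_mult .
  qed
  moreover have "rat_ord p (bernoulli m) > 0" if ord: "rat_ord p (bernoulli k) = 0"
  proof -
    obtain n d where nd: "quotient_of (bernoulli k) = (n, d)" by (cases "quotient_of (bernoulli k)")
    have n: "\<not> int p dvd n" by (rule rat_ord_0D [OF p ord nd])
    have d: "bernoulli k * of_int d = of_int n"
      using quotient_of_div [OF nd] quotient_of_denom_pos [OF nd] by simp
    show ?thesis
    proof (rule rat_ord_pos [OF p])
      show "int p dvd u * int (2 * k * m) * d" using u by simp
      show "\<not> int p dvd n * v" using n v p by (simp add: prime_dvd_mult_iff)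
      have "bernoulli m * of_int (n * v) = bernoulli k * bernoulli m * of_int v * of_int d"
        by (simp add: d [symmetric])
      then show "bernoulli m * of_int (n * v) = of_int (u * int (2 * k * m) * d)"
        unfolding BB of_int_mult .
    qed
  qed
  ultimately show ?thesis unfolding m_def by blast
qed

end
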